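(* Let $G$ be an infinitesimal group scheme of height at most $r$ over $k$ and let $M$ be a finite-dimensional $G$-module. Then $$\mathbb{P}(G)_M\cap\operatorname{Reg}\mathbb{P}(G)\subseteq\operatorname{Supp}\mathcal{H}^{[1]}(M).$$
   Context: $k$ is an algebraically closed field of characteristic $p>0$. A group scheme $G$ over $k$ is infinitesimal of height at most $r$ if its coordinate algebra $k[G]$ is a finite-dimensional local ring and $x^{p^r}=0$ for all $x$ in the maximal ideal. Its group algebra is $kG=\mathrm{Hom}_k(k[G],k)$; a $G$-module is a $kG$-module. $\mathbb{G}_{a(r)}$ is the $r$-th Frobenius kernel of the additive group: $k[\mathbb{G}_{a(r)}]=k[t]/t^{p^r}$ with $t$ primitive, and $k\mathbb{G}_{a(r)}=k[u_1,\dots,u_r]/(u_1^p,\dots,u_r^p)$ with $u_i$ dual to $t^{p^{i-1}}$ in the monomial basis. $V(G)=\operatorname{Spec}k[V(G)]$ is the affine scheme representing the functor $R\mapsto \mathrm{Hom}_{R\text{-grp}}(\mathbb{G}_{a(r),R},G_R)$ on commutative $k$-algebras. The ring $k[V(G)]$ is a finitely generated connected graded $k$-algebra with generators in degrees $p^i$, $0\le i<r$; the grading comes from the action of $\mathbb{A}^1$ on $V(G)$ in which $b\in R$ acts by precomposition with the endomorphism $t\mapsto bt$ of $\mathbb{G}_{a(r),R}$. $\mathbb{P}(G)=\operatorname{Proj}(k[V(G)]/\mathfrak{N})$, with $\mathfrak{N}$ the nilradical. The universal one-parameter subgroup $\mathcal{U}_G:\mathbb{G}_{a(r),k[V(G)]}\to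 G_{k[V(G)]}$ (corresponding to the identity of $k[V(G)]$) induces a map $\mathcal{U}_{G,*}$ on group algebras; put $\Theta_G=\mathcal{U}_{G,*}(1\otimes u_r)\in k[V(G)]\otimes_k kG$. For a finite-dimensional $G$-module $M$ let $\widetilde{M}=\mathcal{O}_{\mathbb{P}(G)}\otimes_k M$; the action of $\Theta_G$ on $k[V(G)]\otimes_k M$ is homogeneous of degree $p^{r-1}$ and induces the global operator $\Theta_M:\widetilde{M}\to\widetilde{M}(p^{r-1})$. (The sheaves $\mathcal{O}_{\mathbb{P}(G)}(dp^{r-1})$, $d\in\mathbb{Z}$, are invertible, and $\Theta_M^p=0$.) $\ker\Theta_M\subseteq\widetilde{M}$ is the kernel of $\Theta_M$, and $\operatorname{im}\Theta_M^{p-1}\subseteq\widetilde{M}$ is the image of the $(p-1)$-fold composite $\widetilde{M}(-(p-1)p^{r-1})\to\widetilde{M}$ of shifts of $\Theta_M$. $\mathcal{H}^{[1]}(M)=\ker\Theta_M/\operatorname{im}\Theta_M^{p-1}$, and $\operatorname{Supp}$ of a sheaf is the set of points with non-zero stalk. For $v\in\mathbb{P}(G)$ the local operator $\theta_{v,M}$ is the $k(v)$-linear, $p$-nilpotent operator on $k(v)\otimes_k M$ obtained by specializing $\Theta_M$ at $v$. The support $\mathbb{P}(G)_M$ is the set of points $v\in\mathbb{P}(G)$ at which the Jordan blocks of $\theta_{v,M}$ are not all of size $p$. $\operatorname{Reg}\mathbb{P}(G)$ is the set of points $v$ such that the local ring $\mathcal{O}_{\mathbb{P}(G),v}$ is regular.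 *)

theory Defs
  imports
    "HOL-Algebra.Algebra"
    "HOL-Algebra.Algebraic_Closure_Type"
    "HOL-Library.Poly_Mapping"
    "HOL-Library.FuncSet"
begin

hide_const (open) Poly_Mapping.degree

section \<open>Finite group schemes and their modules\<close>

text \<open>
  The type \<open>'h\<close> is the coordinate algebra \<open>k[G]\<close>, with \<open>k\<close>-structure \<open>scl\<close> and a basis \<open>bas\<close>
  (any basis; it only serves to write down elements of \<open>k[G] \<otimes> k[G]\<close>): \<open>comul G f a b\<close> is
  the coefficient of \<open>a \<otimes> b\<close> in the comultiplication of \<open>f\<close>, for \<open>a\<close>, \<open>b\<close> in the basis, so that
  the comultiplication is \<open>f \<mapsto> (\<Sum>a\<in>bas G. \<Sum>b\<in>bas G. comul G f a b \<cdot> (a \<otimes> b))\<close>.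
\<close>

record ('k, 'h) group_scheme =
  scl :: "'k \<Rightarrow> 'h \<Rightarrow> 'h"
  bas :: "'h set"
  comul :: "'h \<Rightarrow> 'h \<Rightarrow> 'h \<Rightarrow> 'k"
  counit :: "'h \<Rightarrow> 'k"
  antip :: "'h \<Rightarrow> 'h"

definition finite_basis :: "('k::field \<Rightarrow> 'v::ab_group_add \<Rightarrow> 'v) \<Rightarrow> 'v set \<Rightarrow> bool" where
  "finite_basis sc E \<longleftrightarrow> vector_space sc \<and> finite E \<and> \<not> module.dependent sc E \<and> module.span sc E = UNIV"

definition crd :: "('k::field, 'h::comm_ring_1) group_scheme \<Rightarrow> 'h \<Rightarrow> 'h \<Rightarrow> 'k" where
  "crd G x e = module.representation (scl G) (bas G) x e"

text \<open>A commutative Hopf algebra, finite-dimensional over \<open>k\<close>, i.e. a finite group scheme.\<close>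

definition finite_group_scheme :: "('k::field, 'h::comm_ring_1) group_scheme \<Rightarrow> bool" where
  "finite_group_scheme G \<longleftrightarrow>
     finite_basis (scl G) (bas G) \<and>
     (\<forall>x f g. scl G x f * g = scl G x (f * g)) \<and>
     (\<forall>a\<in>bas G. \<forall>b\<in>bas G. Vector_Spaces.linear (scl G) (*) (\<lambda>f. comul G f a b)) \<and>
     Vector_Spaces.linear (scl G) (*) (counit G) \<and>
     Vector_Spaces.linear (scl G) (scl G) (antip G) \<and>
     \<comment> \<open>comultiplication and counit are algebra homomorphisms\<close>
     (\<forall>a\<in>bas G. \<forall>b\<in>bas G. comul G 1 a b = crd G 1 a * crd G 1 b) \<and>
     (\<forall>f g. \<forall>a\<in>bas G. \<forall>b\<in>bas G. comul G (f * g) a b =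
        (\<Sum>a1\<in>bas G. \<Sum>b1\<in>bas G. \<Sum>a2\<in>bas G. \<Sum>b2\<in>bas G.
           comul G f a1 b1 * comul G g a2 b2 * crd G (a1 * a2) a * crd G (b1 * b2) b)) \<and>
     counit G 1 = 1 \<and> (\<forall>f g. counit G (f * g) = counit G f * counit G g) \<and>
     \<comment> \<open>coassociativity, compared at the basis element \<open>a \<otimes> b \<otimes> c\<close>\<close>
     (\<forall>f. \<forall>a\<in>bas G. \<forall>b\<in>bas G. \<forall>c\<in>bas G.
        (\<Sum>d\<in>bas G. comul G f d c * comul G d a b) = (\<Sum>d\<in>bas G. comul G f a d * comul G d b c)) \<and>
     \<comment> \<open>counit and antipode axioms\<close>
     (\<forall>f. (\<Sum>a\<in>bas G. \<Sum>b\<in>bas G. scl G (comul G f a b * counit G a) b) = f) \<and>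
     (\<forall>f. (\<Sum>a\<in>bas G. \<Sum>b\<in>bas G. scl G (comul G f a b * counit G b) a) = f) \<and>
     (\<forall>f. (\<Sum>a\<in>bas G. \<Sum>b\<in>bas G. scl G (comul G f a b) (antip G a * b)) = scl G (counit G f) 1) \<and>
     (\<forall>f. (\<Sum>a\<in>bas G. \<Sum>b\<in>bas G. scl G (comul G f a b) (a * antip G b)) = scl G (counit G f) 1)"

definition is_local_ring :: "('a, 'm) ring_scheme \<Rightarrow> bool" where
  "is_local_ring R \<longleftrightarrow> cring R \<and> (\<exists>!m. maximalideal m R)"

definition infinitesimal :: "('k::field, 'h::comm_ring_1) group_scheme \<Rightarrow> nat \<Rightarrow> bool" where
  "infinitesimal G r \<longleftrightarrow>
     finite_group_scheme G \<and>
     is_local_ring (ring_of_type_algebra :: 'h ring) \<and>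
     (\<forall>m. maximalideal m (ring_of_type_algebra :: 'h ring) \<longrightarrow> (\<forall>x\<in>m. x ^ (CHAR('k) ^ r) = 0))"

text \<open>The group algebra \<open>kG\<close> is the space of linear functionals on \<open>k[G]\<close>, with the product dual
  to the comultiplication and with unit the counit.\<close>

definition group_algebra :: "('k::field, 'h::comm_ring_1) group_scheme \<Rightarrow> ('h \<Rightarrow> 'k) set" where
  "group_algebra G = {l. Vector_Spaces.linear (scl G) (*) l}"

definition conv :: "('k::field, 'h::comm_ring_1) group_scheme \<Rightarrow> ('h \<Rightarrow> 'k) \<Rightarrow> ('h \<Rightarrow> 'k) \<Rightarrow> 'h \<Rightarrow> 'k" where
  "conv G l m f = (\<Sum>a\<in>bas G. \<Sum>b\<in>bas G. comul G f a b * (l a * m b))"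

record ('k, 'h, 'v) gmodule =
  mscl :: "'k \<Rightarrow> 'v \<Rightarrow> 'v"
  mbas :: "'v set"
  act :: "('h \<Rightarrow> 'k) \<Rightarrow> 'v \<Rightarrow> 'v"

definition fd_module ::
  "('k::field, 'h::comm_ring_1) group_scheme \<Rightarrow> ('k, 'h, 'v::ab_group_add) gmodule \<Rightarrow> bool" where
  "fd_module G M \<longleftrightarrow>
     finite_basis (mscl M) (mbas M) \<and>
     (\<forall>l\<in>group_algebra G. Vector_Spaces.linear (mscl M) (mscl M) (act M l)) \<and>
     (\<forall>l\<in>group_algebra G. \<forall>m\<in>group_algebra G. \<forall>x.
        act M (\<lambda>f. l f + m f) x = act M l x + act M m x) \<and>
     (\<forall>c. \<forall>l\<in>group_algebra G. \<forall>x. act M (\<lambda>f. c * l f) x = mscl M c (act M l x)) \<and>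
     (\<forall>l\<in>group_algebra G. \<forall>m\<in>group_algebra G. \<forall>x. act M (conv G l m) x = act M l (act M m x)) \<and>
     (\<forall>x. act M (counit G) x = x)"


section \<open>One-parameter subgroups and the algebra \<open>k[V(G)]\<close>\<close>

text \<open>
  Put \<open>q = p^r\<close> and let \<open>R\<close> be a commutative \<open>k\<close>-algebra with structure map \<open>\<iota>\<close>. A family
  \<open>c :: 'h \<Rightarrow> nat \<Rightarrow> R\<close> with \<open>c f i = 0\<close> for \<open>i \<ge> q\<close> encodes the map
  \<open>\<phi> : k[G] \<rightarrow> R[t]/t^q\<close>, \<open>\<phi>(f) = (\<Sum>i<q. c f i t^i)\<close>. The elements below vanish iff \<open>\<phi>\<close> is a
  homomorphism of \<open>k\<close>-algebras compatible with counits (\<open>t \<mapsto> 0\<close>) and comultiplications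
  (\<open>t \<mapsto> s + t\<close>, coefficient of \<open>s^i t^j\<close>), i.e. iff \<open>c\<close> is a homomorphism
  \<open>G_{a(r),R} \<rightarrow> G_R\<close> of group schemes over \<open>R\<close>.
\<close>

definition relators ::
  "('k::field, 'h::comm_ring_1) group_scheme \<Rightarrow> nat \<Rightarrow> ('k \<Rightarrow> 'r::comm_ring_1) \<Rightarrow> ('h \<Rightarrow> nat \<Rightarrow> 'r) \<Rightarrow> 'r set" where
  "relators G r \<iota> c = (let q = CHAR('k) ^ r in
     {c f i | f i. i \<ge> q} \<union>
     {c (f + g) i - (c f i + c g i) | f g i. True} \<union>
     {c (scl G x f) i - \<iota> x * c f i | x f i. True} \<union>
     {c 1 i - (if i = 0 then 1 else 0) | i. i < q} \<union>
     {c (f * g) i - (\<Sum>j\<le>i. c f j * c g (i - j)) | f g i. i < q} \<union>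
     {c f 0 - \<iota> (counit G f) | f. True} \<union>
     {(\<Sum>a\<in>bas G. \<Sum>b\<in>bas G. \<iota> (comul G f a b) * (c a i * c b j))
        - of_nat ((i + j) choose i) * c f (i + j) | f i j. True})"

definition k_algebra_map :: "('k::field \<Rightarrow> 'r::comm_ring_1) \<Rightarrow> bool" where
  "k_algebra_map \<iota> \<longleftrightarrow> \<iota> 1 = 1 \<and> (\<forall>x y. \<iota> (x + y) = \<iota> x + \<iota> y) \<and> (\<forall>x y. \<iota> (x * y) = \<iota> x * \<iota> y)"

definition one_param_subgroups ::
  "('k::field, 'h::comm_ring_1) group_scheme \<Rightarrow> nat \<Rightarrow> ('k \<Rightarrow> 'r::comm_ring_1) \<Rightarrow> ('h \<Rightarrow> nat \<Rightarrow> 'r) set" where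
  "one_param_subgroups G r \<iota> = {c. relators G r \<iota> c \<subseteq> {0}}"

text \<open>The polynomial ring in the variables \<open>X f i\<close> (\<open>f\<close> in \<open>k[G]\<close>), and \<open>k[V(G)]\<close> as its quotient
  by the relations of the universal one-parameter subgroup. That it represents the functor of
  one-parameter subgroups is \<open>V_ring_represents\<close> below.\<close>

type_synonym ('k, 'h) vpoly = "(('h \<times> nat) \<Rightarrow>\<^sub>0 nat) \<Rightarrow>\<^sub>0 'k"

definition vcst :: "'k::field \<Rightarrow> ('k, 'h) vpoly" where
  "vcst x = Poly_Mapping.single 0 x"

definition vvar :: "'h \<Rightarrow> nat \<Rightarrow> ('k::field, 'h) vpoly" where
  "vvar f i = Poly_Mapping.single (Poly_Mapping.single (f, i) 1) 1"

definition V_ideal :: "('k::field, 'h::comm_ring_1) group_scheme \<Rightarrow> nat \<Rightarrow> ('k, 'h) vpoly set" where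
  "V_ideal G r = genideal ring_of_type_algebra (relators G r vcst vvar)"

definition V_ring :: "('k::field, 'h::comm_ring_1) group_scheme \<Rightarrow> nat \<Rightarrow> ('k, 'h) vpoly set ring" where
  "V_ring G r = ring_of_type_algebra Quot V_ideal G r"

definition V_class :: "('k::field, 'h::comm_ring_1) group_scheme \<Rightarrow> nat \<Rightarrow> ('k, 'h) vpoly \<Rightarrow> ('k, 'h) vpoly set" where
  "V_class G r x = V_ideal G r +>\<^bsub>ring_of_type_algebra\<^esub> x"

definition vmon :: "('h \<Rightarrow> nat \<Rightarrow> 'r::comm_ring_1) \<Rightarrow> (('h \<times> nat) \<Rightarrow>\<^sub>0 nat) \<Rightarrow> 'r" where
  "vmon c m = (\<Prod>y\<in>Poly_Mapping.keys m. c (fst y) (snd y) ^ Poly_Mapping.lookup m y)"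

definition veval :: "('k::field \<Rightarrow> 'r::comm_ring_1) \<Rightarrow> ('h \<Rightarrow> nat \<Rightarrow> 'r) \<Rightarrow> ('k, 'h) vpoly \<Rightarrow> 'r" where
  "veval \<iota> c x = (\<Sum>m\<in>Poly_Mapping.keys x. \<iota> (Poly_Mapping.lookup x m) * vmon c m)"

lemma vmon_superset:
  assumes "finite S" "Poly_Mapping.keys m \<subseteq> S"
  shows "vmon c m = (\<Prod>y\<in>S. c (fst y) (snd y) ^ Poly_Mapping.lookup m y)"
  unfolding vmon_def by (rule prod.mono_neutral_left) (use assms in \<open>auto simp: in_keys_iff\<close>)

lemma vmon_add: "vmon c (m + n) = vmon c m * vmon c n"
proof -
  let ?S = "Poly_Mapping.keys m \<union> Poly_Mapping.keys n"
  have "vmon c (m + n) = (\<Prod>y\<in>?S. c (fst y) (snd y) ^ Poly_Mapping.lookup (m + n) y)"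
    by (rule vmon_superset) (auto dest!: subsetD[OF keys_add])
  also have "\<dots> = vmon c m * vmon c n"
    by (simp add: vmon_superset[of ?S] lookup_add power_add prod.distrib)
  finally show ?thesis .
qed

context
  fixes \<iota> :: "'k::field \<Rightarrow> 'r::comm_ring_1" and c :: "'h::comm_ring_1 \<Rightarrow> nat \<Rightarrow> 'r"
  assumes \<iota>: "k_algebra_map \<iota>"
begin

lemma k_algebra_map_simps: "\<iota> 1 = 1" "\<iota> (x + y) = \<iota> x + \<iota> y" "\<iota> (x * y) = \<iota> x * \<iota> y" "\<iota> 0 = 0"
proof -
  show "\<iota> 1 = 1" "\<iota> (x + y) = \<iota> x + \<iota> y" "\<iota> (x * y) = \<iota> x * \<iota> y"
    using \<iota> by (auto simp: k_algebra_map_def)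
  have "\<iota> (0 + 0) = \<iota> 0 + \<iota> 0" using \<iota> by (simp only: k_algebra_map_def)
  then show "\<iota> 0 = 0" by simp
qed

lemma veval_superset:
  assumes "finite S" "Poly_Mapping.keys x \<subseteq> S"
  shows "veval \<iota> c x = (\<Sum>m\<in>S. \<iota> (Poly_Mapping.lookup x m) * vmon c m)"
  unfolding veval_def by (rule sum.mono_neutral_left) (use assms in \<open>auto simp: in_keys_iff k_algebra_map_simps\<close>)

lemma veval_add: "veval \<iota> c (x + y) = veval \<iota> c x + veval \<iota> c y"
proof -
  let ?S = "Poly_Mapping.keys x \<union> Poly_Mapping.keys y"
  have "veval \<iota> c (x + y) = (\<Sum>m\<in>?S. \<iota> (Poly_Mapping.lookup (x + y) m) * vmon c m)"
    by (rule veval_superset) (auto dest!: subsetD[OF keys_add])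
  then show ?thesis
    by (simp add: veval_superset[of ?S] lookup_add sum.distrib k_algebra_map_simps algebra_simps)
qed

lemma veval_0: "veval \<iota> c 0 = 0" by (simp add: veval_def)

lemma veval_sum: "veval \<iota> c (sum f A) = (\<Sum>a\<in>A. veval \<iota> c (f a))"
  by (induction A rule: infinite_finite_induct) (auto simp: veval_0 veval_add)

lemma veval_uminus: "veval \<iota> c (- x) = - veval \<iota> c x"
  using veval_add[of x "- x"] by (simp add: veval_0 add_eq_0_iff)

lemma veval_diff: "veval \<iota> c (x - y) = veval \<iota> c x - veval \<iota> c y"
  using veval_add[of x "- y"] by (simp add: veval_uminus)

lemma veval_single: "veval \<iota> c (Poly_Mapping.single m a) = \<iota> a * vmon c m"
  by (auto simp: veval_def k_algebra_map_simps)

end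

lemma vpoly_sum: "x = (\<Sum>m\<in>Poly_Mapping.keys x. Poly_Mapping.single m (Poly_Mapping.lookup x m))"
  by (rule poly_mapping_eqI) (auto simp: lookup_sum lookup_single when_def in_keys_iff)

context
  fixes \<iota> :: "'k::field \<Rightarrow> 'r::comm_ring_1" and c :: "'h::comm_ring_1 \<Rightarrow> nat \<Rightarrow> 'r"
  assumes \<iota>: "k_algebra_map \<iota>"
begin

lemma veval_mult: "veval \<iota> c (x * y) = veval \<iota> c x * veval \<iota> c y"
proof -
  let ?t = "\<lambda>x m. Poly_Mapping.single m (Poly_Mapping.lookup x m)"
  have "veval \<iota> c (x * y) = veval \<iota> c ((\<Sum>m\<in>Poly_Mapping.keys x. ?t x m) * (\<Sum>n\<in>Poly_Mapping.keys y. ?t y n))"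
    by (simp flip: vpoly_sum)
  also have "\<dots> = (\<Sum>m\<in>Poly_Mapping.keys x. \<Sum>n\<in>Poly_Mapping.keys y. veval \<iota> c (?t x m * ?t y n))"
    by (simp add: sum_product veval_sum[OF \<iota>])
  also have "\<dots> = (\<Sum>m\<in>Poly_Mapping.keys x. \<Sum>n\<in>Poly_Mapping.keys y.
      (\<iota> (Poly_Mapping.lookup x m) * vmon c m) * (\<iota> (Poly_Mapping.lookup y n) * vmon c n))"
    unfolding mult_single veval_single[OF \<iota>] vmon_add k_algebra_map_simps[OF \<iota>] by (simp add: mult_ac)
  also have "\<dots> = veval \<iota> c x * veval \<iota> c y"
    by (simp add: veval_def sum_product)
  finally show ?thesis .
qed

lemma veval_vcst: "veval \<iota> c (vcst a) = \<iota> a"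
  by (simp add: vcst_def veval_single[OF \<iota>] vmon_def)

lemma veval_vvar: "veval \<iota> c (vvar f i) = c f i"
  by (simp add: vvar_def veval_single[OF \<iota>] vmon_def k_algebra_map_simps[OF \<iota>])

lemma veval_1: "veval \<iota> c 1 = 1"
  using veval_vcst[of 1] by (simp add: vcst_def k_algebra_map_simps[OF \<iota>])

lemma veval_of_nat: "veval \<iota> c (of_nat n) = of_nat n"
  by (induction n) (auto simp: veval_0[OF \<iota>] veval_add[OF \<iota>] veval_1)

lemmas veval_simps = veval_0[OF \<iota>] veval_add[OF \<iota>] veval_1 veval_of_nat veval_diff[OF \<iota>] veval_sum[OF \<iota>]
  veval_mult veval_vcst veval_vvar

lemma veval_if: "veval \<iota> c (if b then 1 else 0) = (if b then 1 else 0)"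
  by (simp add: veval_simps)

lemma veval_relators: "veval \<iota> c ` relators G r vcst vvar = relators G r \<iota> c"
proof -
  have 1: "h ` {F a | a. P a} = {h (F a) | a. P a}" for h :: "('k, 'h) vpoly \<Rightarrow> 'r" and F :: "'x \<Rightarrow> _" and P
    by blast
  have 2: "h ` {F a b | a b. P a b} = {h (F a b) | a b. P a b}"
    for h :: "('k, 'h) vpoly \<Rightarrow> 'r" and F :: "'x \<Rightarrow> 'y \<Rightarrow> _" and P
    by blast
  have 3: "h ` {F a b d | a b d. P a b d} = {h (F a b d) | a b d. P a b d}"
    for h :: "('k, 'h) vpoly \<Rightarrow> 'r" and F :: "'x \<Rightarrow> 'y \<Rightarrow> 'z \<Rightarrow> _" and P
    by blast
  show ?thesis
    unfolding relators_def Let_def image_Un 1 2 3 veval_simps veval_if ..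
qed

end

lemma single_eq_vmon: "Poly_Mapping.single m 1 = vmon (vvar :: _ \<Rightarrow> _ \<Rightarrow> ('k::field, 'h::comm_ring_1) vpoly) m"
proof -
  have pow: "Poly_Mapping.single (Poly_Mapping.single y 1) (1::'k) ^ n = Poly_Mapping.single (Poly_Mapping.single y n) 1"
    for y :: "'h \<times> nat" and n :: nat
    by (induction n) (simp_all add: mult_single single_add[symmetric])
  have "vmon vvar m = (\<Prod>y\<in>Poly_Mapping.keys m. Poly_Mapping.single (Poly_Mapping.single y (Poly_Mapping.lookup m y)) (1::'k))"
    unfolding vmon_def vvar_def by (intro prod.cong refl) (simp add: pow[simplified])
  also have "\<dots> = Poly_Mapping.single (\<Sum>y\<in>Poly_Mapping.keys m. Poly_Mapping.single y (Poly_Mapping.lookup m y)) 1"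
    by (rule finite_induct[OF finite_keys[of m]]) (auto simp: mult_single)
  also have "(\<Sum>y\<in>Poly_Mapping.keys m. Poly_Mapping.single y (Poly_Mapping.lookup m y)) = m"
    by (rule poly_mapping_eqI) (auto simp: lookup_sum lookup_single when_def in_keys_iff)
  finally show ?thesis by simp
qed

lemma veval_unique:
  fixes g :: "('k::field, 'h::comm_ring_1) vpoly \<Rightarrow> 'r::comm_ring_1"
  assumes \<iota>: "k_algebra_map \<iota>"
    and g: "\<And>x y. g (x + y) = g x + g y" "\<And>x y. g (x * y) = g x * g y" "\<And>a. g (vcst a) = \<iota> a"
  shows "g x = veval \<iota> (\<lambda>f i. g (vvar f i)) x"
proof -
  have g0: "g 0 = 0" using g(1)[of 0 0] by simp
  have g1: "g 1 = 1" using g(3)[of 1] by (simp add: vcst_def k_algebra_map_simps[OF \<iota>])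
  have sum: "g (sum h A) = (\<Sum>a\<in>A. g (h a))" for h :: "(('h \<times> nat) \<Rightarrow>\<^sub>0 nat) \<Rightarrow> _" and A
    by (induction A rule: infinite_finite_induct) (auto simp: g g0)
  have prd: "g (prod h A) = (\<Prod>a\<in>A. g (h a))" for h :: "'h \<times> nat \<Rightarrow> _" and A
    by (induction A rule: infinite_finite_induct) (auto simp: g g1)
  have pw: "g (y ^ n) = g y ^ n" for y n
    by (induction n) (auto simp: g g1)
  have m: "g (Poly_Mapping.single m a) = \<iota> a * vmon (\<lambda>f i. g (vvar f i)) m" for m a
  proof -
    have "Poly_Mapping.single m a = vcst a * vmon vvar m"
      unfolding single_eq_vmon[symmetric] vcst_def by (simp add: mult_single)
    then show ?thesis by (simp add: g vmon_def prd pw)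
  qed
  have "g x = g (\<Sum>m\<in>Poly_Mapping.keys x. Poly_Mapping.single m (Poly_Mapping.lookup x m))"
    by (simp flip: vpoly_sum)
  also have "\<dots> = veval \<iota> (\<lambda>f i. g (vvar f i)) x"
    by (simp only: sum m veval_def)
  finally show ?thesis .
qed

lemma V_ring_represents:
  fixes G :: "('k::field, 'h::comm_ring_1) group_scheme" and \<iota> :: "'k \<Rightarrow> 'r::comm_ring_1"
  assumes \<iota>: "k_algebra_map \<iota>"
  shows "bij_betw (\<lambda>h f i. h (V_class G r (vvar f i)))
     {h \<in> ring_hom (V_ring G r) ring_of_type_algebra \<inter> extensional (carrier (V_ring G r)).
        \<forall>a. h (V_class G r (vcst a)) = \<iota> a}
     (one_param_subgroups G r \<iota>)"
proof -
  let ?P = "ring_of_type_algebra :: ('k, 'h) vpoly ring"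
  let ?S = "ring_of_type_algebra :: 'r ring"
  let ?V = "V_ring G r" and ?cl = "V_class G r" and ?I = "V_ideal G r"
  interpret P: cring ?P by (rule cring_from_type_algebra)
  interpret S: cring ?S by (rule cring_from_type_algebra)
  have sel: "carrier ?P = UNIV" "x \<otimes>\<^bsub>?P\<^esub> y = x * y" "x \<oplus>\<^bsub>?P\<^esub> y = x + y" "\<one>\<^bsub>?P\<^esub> = 1" "\<zero>\<^bsub>?P\<^esub> = 0" for x y
    by (auto simp: ring_of_type_algebra_def)
  have selS: "carrier ?S = UNIV" "x \<otimes>\<^bsub>?S\<^esub> y = x * y" "x \<oplus>\<^bsub>?S\<^esub> y = x + y" "\<one>\<^bsub>?S\<^esub> = 1" "\<zero>\<^bsub>?S\<^esub> = 0" for x y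
    by (auto simp: ring_of_type_algebra_def)
  have I: "ideal ?I ?P"
    unfolding V_ideal_def by (rule P.genideal_ideal) (simp add: sel)
  interpret I: ideal ?I ?P by (rule I)
  have rI: "relators G r vcst vvar \<subseteq> ?I"
    unfolding V_ideal_def by (rule P.genideal_self) (simp add: sel)
  have cl: "ring_hom_ring ?P ?V ?cl"
    using I.rcos_ring_hom_ring unfolding V_ring_def V_class_def[abs_def] by simp
  interpret cl: ring_hom_ring ?P ?V ?cl by (rule cl)
  have carV: "carrier ?V = range ?cl"
    by (auto simp: V_ring_def V_class_def FactRing_def A_RCOSETS_def' sel)
  have minusP: "a_minus ?P x y = x - y" for x y
  proof -
    have "a_inv ?P y = - y" by (rule P.minus_equality) (auto simp: sel)
    then show ?thesis by (simp add: a_minus_def sel)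
  qed
  have cl_eq: "?cl x = ?cl y" if "x - y \<in> ?I" for x y
    using that P.quotient_eq_iff_same_a_r_cos[OF I, of x y] by (simp add: V_class_def minusP sel)
  define H where "H = {h \<in> ring_hom ?V ?S \<inter> extensional (carrier ?V). \<forall>a. h (?cl (vcst a)) = \<iota> a}"
  have hom: "h (?cl x) = veval \<iota> (\<lambda>f i. h (?cl (vvar f i))) x" if "h \<in> H" for h x
  proof (rule veval_unique[OF \<iota>])
    have h: "h \<in> ring_hom ?V ?S" using that by (auto simp: H_def)
    show "h (?cl (x + y)) = h (?cl x) + h (?cl y)" for x y
      using ring_hom_add[OF h, of "?cl x" "?cl y"] cl.hom_add[of x y] by (simp add: sel selS carV)
    show "h (?cl (x * y)) = h (?cl x) * h (?cl y)" for x y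
      using ring_hom_mult[OF h, of "?cl x" "?cl y"] cl.hom_mult[of x y] by (simp add: sel selS carV)
    show "h (?cl (vcst a)) = \<iota> a" for a using that by (auto simp: H_def)
  qed
  have into: "(\<lambda>f i. h (?cl (vvar f i))) \<in> one_param_subgroups G r \<iota>" if h: "h \<in> H" for h
  proof -
    have "veval \<iota> (\<lambda>f i. h (?cl (vvar f i))) x = 0" if "x \<in> relators G r vcst vvar" for x
    proof -
      have "?cl x = ?cl 0" by (rule cl_eq) (use that rI in auto)
      then show ?thesis using hom[OF h, of x] hom[OF h, of 0] by (simp add: veval_0[OF \<iota>])
    qed
    then show ?thesis
      unfolding one_param_subgroups_def veval_relators[OF \<iota>, symmetric] by auto
  qed
  have inj: "h = h'" if h: "h \<in> H" and h': "h' \<in> H"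
    and eq: "(\<lambda>f i. h (?cl (vvar f i))) = (\<lambda>f i. h' (?cl (vvar f i)))" for h h'
  proof -
    have *: "h (?cl x) = h' (?cl x)" for x
      by (subst hom[OF h], subst hom[OF h'], subst eq, rule refl)
    have "h xx = h' xx" if xx: "xx \<in> carrier ?V" for xx
      using xx * by (auto simp: carV)
    then show ?thesis
      using h h' extensionalityI[of h "carrier ?V" h'] by (simp add: H_def)
  qed
  have surj: "\<exists>h\<in>H. c = (\<lambda>f i. h (?cl (vvar f i)))" if c: "c \<in> one_param_subgroups G r \<iota>" for c
  proof -
    have hr: "veval \<iota> c \<in> ring_hom ?P ?S"
      by (rule ring_hom_memI) (auto simp: sel selS veval_simps[OF \<iota>])
    have e: "ring_hom_ring ?P ?S (veval \<iota> c)"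
      by (rule ring_hom_ringI2[OF P.ring_axioms S.ring_axioms hr])
    have ke: "ideal (a_kernel ?P ?S (veval \<iota> c)) ?P"
      by (rule ring_hom_ring.kernel_is_ideal[OF e])
    have "?I \<subseteq> a_kernel ?P ?S (veval \<iota> c)"
      unfolding V_ideal_def
    proof (rule P.genideal_minimal[OF ke])
      show "relators G r vcst vvar \<subseteq> a_kernel ?P ?S (veval \<iota> c)"
        using c unfolding one_param_subgroups_def veval_relators[OF \<iota>, symmetric]
        by (auto simp: a_kernel_def' sel selS)
    qed
    then have I0: "veval \<iota> c x = 0" if "x \<in> ?I" for x
      using that by (auto simp: a_kernel_def' selS)
    have coset: "veval \<iota> c y = veval \<iota> c x" if "y \<in> ?cl x" for x y
      using that I0 by (auto simp: V_class_def a_r_coset_def' sel veval_simps[OF \<iota>])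
    have self: "x \<in> ?cl x" for x
      unfolding V_class_def by (rule I.a_rcos_self) (simp add: sel)
    define h where "h = restrict (\<lambda>xx. veval \<iota> c (SOME x. x \<in> xx)) (carrier ?V)"
    have h: "h (?cl x) = veval \<iota> c x" for x
      unfolding h_def using coset[OF someI[of "\<lambda>y. y \<in> ?cl x", OF self]] by (simp add: carV)
    have "h \<in> ring_hom ?V ?S"
    proof (rule ring_hom_memI)
      show "h (xx \<otimes>\<^bsub>?V\<^esub> yy) = h xx \<otimes>\<^bsub>?S\<^esub> h yy" if "xx \<in> carrier ?V" "yy \<in> carrier ?V" for xx yy
        using that by (auto simp: carV sel selS h veval_simps[OF \<iota>] simp flip: cl.hom_mult)
      show "h (xx \<oplus>\<^bsub>?V\<^esub> yy) = h xx \<oplus>\<^bsub>?S\<^esub> h yy" if "xx \<in> carrier ?V" "yy \<in> carrier ?V" for xx yy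
        using that by (auto simp: carV sel selS h veval_simps[OF \<iota>] simp flip: cl.hom_add)
      show "h \<one>\<^bsub>?V\<^esub> = \<one>\<^bsub>?S\<^esub>"
        using h[of 1] cl.hom_one by (simp add: sel selS veval_simps[OF \<iota>])
    qed (simp add: selS)
    then have "h \<in> H"
      by (auto simp: H_def h veval_simps[OF \<iota>]) (simp add: h_def)
    then show ?thesis by (intro bexI[of _ h]) (auto simp: h veval_simps[OF \<iota>])
  qed
  show ?thesis
    unfolding bij_betw_def H_def[symmetric] inj_on_def using into inj surj by fast
qed

definition nilradical :: "('a, 'm) ring_scheme \<Rightarrow> 'a set" where
  "nilradical R = {x \<in> carrier R. \<exists>n::nat. x [^]\<^bsub>R\<^esub> n = \<zero>\<^bsub>R\<^esub>}"

text \<open>\<open>k[V(G)]\<close> modulo its nilradical, and the quotient map from the polynomial ring onto it.\<close>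

definition Vred :: "('k::field, 'h::comm_ring_1) group_scheme \<Rightarrow> nat \<Rightarrow> ('k, 'h) vpoly set set ring" where
  "Vred G r = V_ring G r Quot nilradical (V_ring G r)"

definition Vred_class :: "('k::field, 'h::comm_ring_1) group_scheme \<Rightarrow> nat \<Rightarrow> ('k, 'h) vpoly \<Rightarrow> ('k, 'h) vpoly set set" where
  "Vred_class G r x = nilradical (V_ring G r) +>\<^bsub>V_ring G r\<^esub> V_class G r x"

text \<open>Precomposition with \<open>t \<mapsto> b t\<close> replaces \<open>c f i\<close> by \<open>b^i c f i\<close>, so the variable \<open>X f i\<close> has
  degree \<open>i\<close>; see \<open>veval_scale\<close>.\<close>

definition whomog :: "nat \<Rightarrow> ('k::field, 'h) vpoly set" where
  "whomog n = {x. \<forall>m\<in>Poly_Mapping.keys x.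
     (\<Sum>y\<in>Poly_Mapping.keys m. Poly_Mapping.lookup m y * snd y) = n}"

definition Vred_gr :: "('k::field, 'h::comm_ring_1) group_scheme \<Rightarrow> nat \<Rightarrow> nat \<Rightarrow> ('k, 'h) vpoly set set set" where
  "Vred_gr G r n = Vred_class G r ` whomog n"

lemma veval_scale:
  fixes x :: "('k::field, 'h::comm_ring_1) vpoly" and c :: "'h \<Rightarrow> nat \<Rightarrow> 'r::comm_ring_1"
  assumes "x \<in> whomog n"
  shows "veval \<iota> (\<lambda>f i. b ^ i * c f i) x = b ^ n * veval \<iota> c x"
proof -
  have "vmon (\<lambda>f i. b ^ i * c f i) m = b ^ n * vmon c m" if "m \<in> Poly_Mapping.keys x" for m
  proof -
    have n: "(\<Sum>y\<in>Poly_Mapping.keys m. snd y * Poly_Mapping.lookup m y) = n"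
      using assms that unfolding whomog_def by (simp add: mult.commute)
    have "vmon (\<lambda>f i. b ^ i * c f i) m = (\<Prod>y\<in>Poly_Mapping.keys m. b ^ (snd y * Poly_Mapping.lookup m y)) * vmon c m"
      unfolding vmon_def power_mult_distrib power_mult[symmetric] prod.distrib ..
    then show ?thesis unfolding power_sum[symmetric] n .
  qed
  then show ?thesis
    by (simp add: veval_def sum_distrib_left mult_ac)
qed

text \<open>
  Since \<open>u_r\<close> is dual to \<open>t^(p^(r-1))\<close>, the element \<open>\<Theta>_G\<close> of \<open>k[V(G)] \<otimes> kG = Hom_k(k[G], k[V(G)])\<close> is
  \<open>f \<mapsto> X f (p^(r-1))\<close>, that is \<open>(\<Sum>e\<in>bas G. X e (p^(r-1)) \<otimes> crd G _ e)\<close>. Its action on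
  \<open>k[V(G)] \<otimes> M\<close>, the free module on \<open>mbas M\<close>, is given by the following matrix
  (row \<open>b'\<close>, column \<open>b\<close>), here read in \<open>k[V(G)]\<close> modulo its nilradical.
\<close>

definition Theta ::
  "('k::field, 'h::comm_ring_1) group_scheme \<Rightarrow> nat \<Rightarrow> ('k, 'h, 'v::ab_group_add) gmodule
     \<Rightarrow> 'v \<Rightarrow> 'v \<Rightarrow> ('k, 'h) vpoly set set" where
  "Theta G r M b' b = Vred_class G r (\<Sum>e\<in>bas G. vvar e (CHAR('k) ^ (r - 1)) *
      vcst (module.representation (mscl M) (mbas M) (act M (\<lambda>x. crd G x e) b) b'))"


section \<open>Proj of a graded ring\<close>

text \<open>Here \<open>A\<close> is a commutative ring graded by the additive subgroups \<open>gr n\<close>.\<close>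

definition homogeneous_ideal :: "('a, 'm) ring_scheme \<Rightarrow> (nat \<Rightarrow> 'a set) \<Rightarrow> 'a set \<Rightarrow> bool" where
  "homogeneous_ideal A gr I \<longleftrightarrow> ideal I A \<and> I = genideal A (I \<inter> (\<Union>n. gr n))"

definition proj :: "('a, 'm) ring_scheme \<Rightarrow> (nat \<Rightarrow> 'a set) \<Rightarrow> 'a set set" where
  "proj A gr = {v. primeideal v A \<and> homogeneous_ideal A gr v \<and> \<not> (\<Union>n\<in>{0<..}. gr n) \<subseteq> v}"

definition zopen :: "('a, 'm) ring_scheme \<Rightarrow> (nat \<Rightarrow> 'a set) \<Rightarrow> 'a set set \<Rightarrow> bool" where
  "zopen A gr U \<longleftrightarrow> (\<exists>T \<subseteq> (\<Union>n. gr n). U = {v \<in> proj A gr. \<not> T \<subseteq> v})"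

text \<open>Localization at the homogeneous elements outside \<open>v\<close>; a fraction is the set of all pairs
  (numerator, denominator) representing it.\<close>

definition denoms :: "(nat \<Rightarrow> 'a set) \<Rightarrow> 'a set \<Rightarrow> 'a set" where
  "denoms gr v = (\<Union>n. gr n) - v"

definition hfrac :: "('a, 'm) ring_scheme \<Rightarrow> (nat \<Rightarrow> 'a set) \<Rightarrow> 'a set \<Rightarrow> 'a \<Rightarrow> 'a \<Rightarrow> ('a \<times> 'a) set" where
  "hfrac A gr v a s = {(b, t). b \<in> carrier A \<and> t \<in> denoms gr v \<and>
     (\<exists>u\<in>denoms gr v. u \<otimes>\<^bsub>A\<^esub> (a \<otimes>\<^bsub>A\<^esub> t \<ominus>\<^bsub>A\<^esub> b \<otimes>\<^bsub>A\<^esub> s) = \<zero>\<^bsub>A\<^esub>)}"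

definition hloc :: "('a, 'm) ring_scheme \<Rightarrow> (nat \<Rightarrow> 'a set) \<Rightarrow> 'a set \<Rightarrow> ('a \<times> 'a) set ring" where
  "hloc A gr v = \<lparr>
     carrier = {hfrac A gr v a s | a s. a \<in> carrier A \<and> s \<in> denoms gr v},
     monoid.mult = (\<lambda>x y. \<Union>(a, s)\<in>x. \<Union>(b, t)\<in>y. hfrac A gr v (a \<otimes>\<^bsub>A\<^esub> b) (s \<otimes>\<^bsub>A\<^esub> t)),
     one = hfrac A gr v \<one>\<^bsub>A\<^esub> \<one>\<^bsub>A\<^esub>,
     ring.zero = hfrac A gr v \<zero>\<^bsub>A\<^esub> \<one>\<^bsub>A\<^esub>,
     add = (\<lambda>x y. \<Union>(a, s)\<in>x. \<Union>(b, t)\<in>y.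
              hfrac A gr v (a \<otimes>\<^bsub>A\<^esub> t \<oplus>\<^bsub>A\<^esub> b \<otimes>\<^bsub>A\<^esub> s) (s \<otimes>\<^bsub>A\<^esub> t)) \<rparr>"

text \<open>The part of degree \<open>n\<close> is the stalk of \<open>O(n)\<close> at \<open>v\<close>, and the part of degree \<open>0\<close> is the local ring
  of Proj at \<open>v\<close>.\<close>

definition hloc_deg :: "('a, 'm) ring_scheme \<Rightarrow> (nat \<Rightarrow> 'a set) \<Rightarrow> 'a set \<Rightarrow> int \<Rightarrow> ('a \<times> 'a) set set" where
  "hloc_deg A gr v n = {hfrac A gr v a s | a s e d.
     a \<in> gr e \<and> s \<in> gr d - v \<and> int e - int d = n}"

definition stalk_ring :: "('a, 'm) ring_scheme \<Rightarrow> (nat \<Rightarrow> 'a set) \<Rightarrow> 'a set \<Rightarrow> ('a \<times> 'a) set ring" where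
  "stalk_ring A gr v = (hloc A gr v)\<lparr>carrier := hloc_deg A gr v 0\<rparr>"

text \<open>Sections of the sheaf \<open>O(n)\<close>: functions into the stalks that are locally given by one fraction.\<close>

definition O_sec ::
  "('a, 'm) ring_scheme \<Rightarrow> (nat \<Rightarrow> 'a set) \<Rightarrow> int \<Rightarrow> 'a set set \<Rightarrow> ('a set \<Rightarrow> ('a \<times> 'a) set) set" where
  "O_sec A gr n U = {s \<in> (\<Pi>\<^sub>E v\<in>U. hloc_deg A gr v n).
     \<forall>v\<in>U. \<exists>W a f e d. zopen A gr W \<and> v \<in> W \<and> W \<subseteq> U \<and>
       a \<in> gr e \<and> f \<in> gr d \<and> int e - int d = n \<and>
       (\<forall>w\<in>W. f \<notin> w \<and> s w = hfrac A gr w a f)}"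

text \<open>Sections of \<open>O(n) \<otimes> M\<close>, where \<open>B\<close> is a basis of \<open>M\<close>, with restriction, difference and zero, and the
  operator on sections given by a matrix \<open>T\<close> over \<open>A\<close>; if the entries of \<open>T\<close> are homogeneous of
  degree \<open>m\<close>, it maps sections of \<open>O(n) \<otimes> M\<close> to sections of \<open>O(n + m) \<otimes> M\<close>.\<close>

definition OM_sec where
  "OM_sec A gr B n U = B \<rightarrow>\<^sub>E O_sec A gr n U"

definition sec_res where
  "sec_res B W x = (\<lambda>b\<in>B. restrict (x b) W)"

definition sec_diff where
  "sec_diff A gr B U x y = (\<lambda>b\<in>B. \<lambda>v\<in>U. x b v \<ominus>\<^bsub>hloc A gr v\<^esub> y b v)"

definition sec_zero where
  "sec_zero A gr B U = (\<lambda>b\<in>B. \<lambda>v\<in>U. \<zero>\<^bsub>hloc A gr v\<^esub>)"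

definition sec_op where
  "sec_op A gr B T U x = (\<lambda>b'\<in>B. \<lambda>v\<in>U.
     (\<Oplus>\<^bsub>hloc A gr v\<^esub>b\<in>B. hfrac A gr v (T b' b) \<one>\<^bsub>A\<^esub> \<otimes>\<^bsub>hloc A gr v\<^esub> x b v))"

definition ker_sec where
  "ker_sec A gr B T U = {x \<in> OM_sec A gr B 0 U. sec_op A gr B T U x = sec_zero A gr B U}"

text \<open>Sections of the image sheaf of \<open>T^k : O(-k m) \<otimes> M \<rightarrow> O \<otimes> M\<close>: those which locally are in the image.\<close>

definition im_sec where
  "im_sec A gr B T m k U = {x \<in> OM_sec A gr B 0 U. \<forall>v\<in>U. \<exists>W. zopen A gr W \<and> v \<in> W \<and> W \<subseteq> U \<and>
     (\<exists>y \<in> OM_sec A gr B (- (int k * int m)) W. sec_res B W x = (sec_op A gr B T W ^^ k) y)}"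

text \<open>The stalk at \<open>v\<close> of the quotient sheaf \<open>F/F'\<close> of a subsheaf \<open>F'\<close> of \<open>F\<close> in \<open>O \<otimes> M\<close>: the direct limit of
  \<open>F(U)/F'(U)\<close> over the open neighbourhoods \<open>U\<close> of \<open>v\<close> (sheafification does not change stalks). A germ is
  the set of all pairs \<open>(W, t)\<close> representing it.\<close>

definition quot_germ where
  "quot_germ A gr B F F' v U s = {(W, t). zopen A gr W \<and> v \<in> W \<and> t \<in> F W \<and>
     (\<exists>W'. zopen A gr W' \<and> v \<in> W' \<and> W' \<subseteq> U \<inter> W \<and>
        sec_diff A gr B W' (sec_res B W' t) (sec_res B W' s) \<in> F' W')}"

definition quot_stalk where
  "quot_stalk A gr B F F' v =
     {quot_germ A gr B F F' v U s | U s. zopen A gr U \<and> v \<in> U \<and> s \<in> F U}"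

definition quot_supp where
  "quot_supp A gr B F F' =
     {v \<in> proj A gr. quot_stalk A gr B F F' v \<noteq>
        {quot_germ A gr B F F' v (proj A gr) (sec_zero A gr B (proj A gr))}}"


section \<open>Regular local rings, residue fields and Jordan blocks\<close>

definition nonunits :: "('a, 'm) ring_scheme \<Rightarrow> 'a set" where
  "nonunits R = carrier R - Units R"

definition has_prime_chain :: "('a, 'm) ring_scheme \<Rightarrow> nat \<Rightarrow> bool" where
  "has_prime_chain R d \<longleftrightarrow>
     (\<exists>C :: nat \<Rightarrow> 'a set. (\<forall>i\<le>d. primeideal (C i) R) \<and> (\<forall>i<d. C i \<subset> C (Suc i)))"

definition krull_dim_eq :: "('a, 'm) ring_scheme \<Rightarrow> nat \<Rightarrow> bool" where
  "krull_dim_eq R d \<longleftrightarrow> has_prime_chain R d \<and> \<not> has_prime_chain R (Suc d)"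

text \<open>A Noetherian local ring whose maximal ideal is generated by as many elements as its dimension.\<close>

definition regular_local_ring :: "('a, 'm) ring_scheme \<Rightarrow> bool" where
  "regular_local_ring R \<longleftrightarrow> is_local_ring R \<and> noetherian_ring R \<and>
     (\<exists>d Y. krull_dim_eq R d \<and> Y \<subseteq> carrier R \<and> finite Y \<and> card Y = d \<and> genideal R Y = nonunits R)"

definition residue_field :: "('a, 'm) ring_scheme \<Rightarrow> 'a set ring" where
  "residue_field R = R Quot nonunits R"

definition mat_op where
  "mat_op F B T x = (\<lambda>b'\<in>B. (\<Oplus>\<^bsub>F\<^esub>b\<in>B. T b' b \<otimes>\<^bsub>F\<^esub> x b))"

text \<open>The nilpotent operator \<open>N\<close> on \<open>F^B\<close> (\<open>F\<close> a field) has Jordan blocks of sizes \<open>ls\<close>: there are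
  vectors \<open>es j\<close> with \<open>N^(ls ! j) (es j) = 0\<close> such that the \<open>N^i (es j)\<close>, \<open>i < ls ! j\<close>, form a basis.\<close>

definition jordan_blocks ::
  "('f, 'm) ring_scheme \<Rightarrow> 'b set \<Rightarrow> (('b \<Rightarrow> 'f) \<Rightarrow> ('b \<Rightarrow> 'f)) \<Rightarrow> nat list \<Rightarrow> bool" where
  "jordan_blocks F B N ls \<longleftrightarrow> 0 \<notin> set ls \<and>
     (\<exists>es :: nat \<Rightarrow> 'b \<Rightarrow> 'f.
        (\<forall>j<length ls. es j \<in> B \<rightarrow>\<^sub>E carrier F \<and> (N ^^ (ls ! j)) (es j) = (\<lambda>b\<in>B. \<zero>\<^bsub>F\<^esub>)) \<and>
        (\<forall>x \<in> B \<rightarrow>\<^sub>E carrier F. \<exists>!c. c \<in> (SIGMA j:{..<length ls}. {..<ls ! j}) \<rightarrow>\<^sub>E carrier F \<and>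
           x = (\<lambda>b\<in>B. \<Oplus>\<^bsub>F\<^esub>y\<in>(SIGMA j:{..<length ls}. {..<ls ! j}).
                   c y \<otimes>\<^bsub>F\<^esub> (N ^^ snd y) (es (fst y)) b)))"


section \<open>The objects attached to \<open>G\<close> and \<open>M\<close>\<close>

definition PG :: "('k::field, 'h::comm_ring_1) group_scheme \<Rightarrow> nat \<Rightarrow> ('k, 'h) vpoly set set set set" where
  "PG G r = proj (Vred G r) (Vred_gr G r)"

definition RegPG :: "('k::field, 'h::comm_ring_1) group_scheme \<Rightarrow> nat \<Rightarrow> ('k, 'h) vpoly set set set set" where
  "RegPG G r = {v \<in> PG G r. regular_local_ring (stalk_ring (Vred G r) (Vred_gr G r) v)}"

text \<open>The local operator at \<open>v\<close> on \<open>k(v) \<otimes> M\<close>. Specializing \<open>\<Theta>_M\<close> at \<open>v\<close> gives a map into the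
  fibre of \<open>O(p^(r-1)) \<otimes> M\<close>, which is identified with \<open>k(v) \<otimes> M\<close> by means of a homogeneous \<open>s\<close> of degree
  \<open>p^(r-1)\<close> not in \<open>v\<close>, a generator of the stalk of \<open>O(p^(r-1))\<close>. Another \<open>s\<close> changes the operator by a
  non-zero scalar, hence not its Jordan type.\<close>

definition local_op where
  "local_op G r M v s =
     (let A = Vred G r; gr = Vred_gr G r; R = stalk_ring A gr v in
      mat_op (residue_field R) (mbas M)
        (\<lambda>b' b. nonunits R +>\<^bsub>R\<^esub> hfrac A gr v (Theta G r M b' b) s))"

definition PG_support ::
  "('k::field, 'h::comm_ring_1) group_scheme \<Rightarrow> nat \<Rightarrow> ('k, 'h, 'v::ab_group_add) gmodule
     \<Rightarrow> ('k, 'h) vpoly set set set set" where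
  "PG_support G r M = {v \<in> PG G r. \<exists>s \<in> Vred_gr G r (CHAR('k) ^ (r - 1)) - v. \<exists>ls.
     jordan_blocks (residue_field (stalk_ring (Vred G r) (Vred_gr G r) v)) (mbas M)
       (local_op G r M v s) ls \<and> (\<exists>l\<in>set ls. l \<noteq> CHAR('k))}"

text \<open>The support of \<open>H^[1](M) = ker \<Theta>_M / im \<Theta>_M^(p-1)\<close>.\<close>

definition H1_supp ::
  "('k::field, 'h::comm_ring_1) group_scheme \<Rightarrow> nat \<Rightarrow> ('k, 'h, 'v::ab_group_add) gmodule
     \<Rightarrow> ('k, 'h) vpoly set set set set" where
  "H1_supp G r M =
     (let A = Vred G r; gr = Vred_gr G r; B = mbas M; T = Theta G r M in
      quot_supp A gr B (ker_sec A gr B T)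
        (im_sec A gr B T (CHAR('k) ^ (r - 1)) (CHAR('k) - 1)))"

end

theory Submission
  imports Defs
begin

text \<open>
  Let \<open>v\<close> be a point of \<open>\<P>(G)\<close> with local ring \<open>R\<close>, and let \<open>B\<close> be the basis of \<open>M\<close>. Dividing the matrix of
  \<open>\<Theta>\<close> by a homogeneous element \<open>s\<close> of degree \<open>p^(r-1)\<close> outside \<open>v\<close> turns \<open>\<Theta>\<close> near \<open>v\<close> into an
  endomorphism \<open>N\<close> of the free module \<open>R^B\<close>, and \<open>N^p = 0\<close> because already \<open>\<Theta>^p = 0\<close>
  (\<open>Theta_nilpotent\<close>). Suppose that the stalk of \<open>H^[1](M)\<close> at \<open>v\<close> is zero. Every element of \<open>R^B\<close> killed by \<open>N\<close>
  spreads out to a section of \<open>ker \<Theta>\<close> near \<open>v\<close>, which is then locally in the image of \<open>\<Theta>^(p-1)\<close>;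
  hence \<open>ker N = im N^(p-1)\<close> (\<open>exact_at_point\<close>).

  The point is that for regular \<open>R\<close> this equality survives on the fibre \<open>k(v)^B\<close>. It implies
  \<open>ker N^(p-1) = im N\<close> as well, so that \<open>N\<close> and \<open>N^(p-1)\<close> form an exact complex of period two, and such a
  complex over \<open>R/J\<close> stays exact over \<open>R/(J + (x))\<close> if \<open>x\<close> is a nonzerodivisor modulo \<open>J\<close>
  (\<open>p_exact_descends\<close>). In a regular local ring finitely many steps of this kind lead from \<open>0\<close> to the
  maximal ideal (\<open>regular_local_ring_induct\<close>). On the fibre, finally, \<open>N^p = 0\<close> and \<open>ker N = im N^(p-1)\<close>
  force all Jordan blocks to have size \<open>p\<close> (\<open>jordan_blocks_uniform\<close>), so \<open>v\<close> is not in the support of \<open>M\<close>.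

  For the steps inside a regular local ring of dimension \<open>d\<close>, let \<open>p_0 \<subset> \<dots> \<subset> p_d\<close> be a chain of primes and let
  \<open>y\<close> be one of \<open>d\<close> generators of the maximal ideal, chosen outside \<open>p_0\<close>. By Krull's principal ideal
  theorem the chain can be moved so that \<open>y\<close> lies in all members but \<open>p_0\<close>; induction on \<open>d\<close>, applied
  modulo \<open>y\<close>, identifies \<open>(y)\<close> with the second member, and Nakayama's lemma then gives \<open>p_0 = 0\<close>. The principal
  ideal theorem is used in the form \<open>krull_between\<close>. Localizations at a prime \<open>P\<close> are avoided by working with
  those ideals of the ring itself that are saturated with respect to the complement of \<open>P\<close>.
\<close>

section \<open>Saturated ideals in commutative rings\<close>

locale noetherian_cring = cring R + noetherian_ring R for R (structure)

lemma (in noetherian_ring) ideal_max_exists: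
  assumes "S \<noteq> {}" and S: "\<And>I. I \<in> S \<Longrightarrow> ideal I R"
  shows "\<exists>I\<in>S. \<forall>I'\<in>S. I \<subseteq> I' \<longrightarrow> I' = I"
proof (rule subset_Zorn_nonempty[OF assms(1)])
  fix C assume C: "C \<noteq> {}" "subset.chain S C"
  have "subset.chain {I. ideal I R} C"
    using C(2) S unfolding pred_on.chain_def by blast
  from ideal_chain_is_trivial[OF C(1) this] C(2) show "\<Union>C \<in> S"
    unfolding pred_on.chain_def by blast
qed

text \<open>For a prime \<open>P\<close> these are the contractions of ideals from the localization at \<open>P\<close>.\<close>

definition saturated :: "('a, 'm) ring_scheme \<Rightarrow> 'a set \<Rightarrow> 'a set \<Rightarrow> bool" where
  "saturated R P I \<longleftrightarrow> (\<forall>s\<in>carrier R - P. \<forall>a\<in>carrier R. s \<otimes>\<^bsub>R\<^esub> a \<in> I \<longrightarrow> a \<in> I)"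

definition saturation :: "('a, 'm) ring_scheme \<Rightarrow> 'a set \<Rightarrow> 'a set \<Rightarrow> 'a set" where
  "saturation R P I = {a \<in> carrier R. \<exists>s\<in>carrier R - P. s \<otimes>\<^bsub>R\<^esub> a \<in> I}"

definition adjoin :: "('a, 'm) ring_scheme \<Rightarrow> 'a set \<Rightarrow> 'a \<Rightarrow> 'a set" where
  "adjoin R I x = {i \<oplus>\<^bsub>R\<^esub> c \<otimes>\<^bsub>R\<^esub> x | i c. i \<in> I \<and> c \<in> carrier R}"

lemma saturatedD:
  "saturated R P I \<Longrightarrow> s \<in> carrier R \<Longrightarrow> s \<notin> P \<Longrightarrow> a \<in> carrier R \<Longrightarrow> s \<otimes>\<^bsub>R\<^esub> a \<in> I \<Longrightarrow> a \<in> I"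
  by (auto simp: saturated_def)

lemma saturated_Inter:
  assumes "\<And>L. L \<in> S \<Longrightarrow> saturated R P L" shows "saturated R P (\<Inter>S)"
  unfolding saturated_def
proof (intro ballI impI InterI)
  fix s a L assume "s \<in> carrier R - P" "a \<in> carrier R" "s \<otimes>\<^bsub>R\<^esub> a \<in> \<Inter>S" "L \<in> S"
  then show "a \<in> L" using assms[of L] saturatedD[of R P L s a] by blast
qed

lemma prime_saturated:
  assumes "primeideal Q R" "Q \<subseteq> P" shows "saturated R P Q"
  using assms primeideal.I_prime[OF assms(1)] by (auto simp: saturated_def)

context cring begin

lemma adjoin_ideal:
  assumes I: "ideal I R" and x: "x \<in> carrier R"
  shows "ideal (adjoin R I x) R"
proof -
  interpret I: ideal I R by fact
  have "adjoin R I x = I <+> PIdl x"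
    unfolding adjoin_def cgenideal_def set_add_defs by (auto simp: x; blast)
  then show ?thesis using add_ideals[OF I cgenideal_ideal[OF x]] by simp
qed

lemma adjoin_supset:
  assumes I: "ideal I R" and x: "x \<in> carrier R"
  shows "I \<subseteq> adjoin R I x" "x \<in> adjoin R I x"
proof -
  interpret I: ideal I R by fact
  show "I \<subseteq> adjoin R I x"
  proof
    fix i assume "i \<in> I"
    then have "i = i \<oplus> \<zero> \<otimes> x" using x I.a_Hcarr by simp
    with \<open>i \<in> I\<close> show "i \<in> adjoin R I x" unfolding adjoin_def by blast
  qed
  have "x = \<zero> \<oplus> \<one> \<otimes> x" using x by simp
  then show "x \<in> adjoin R I x" unfolding adjoin_def using I.zero_closed by blast
qed

lemma adjoin_least:
  assumes "ideal L R" "I \<subseteq> L" "x \<in> L"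
  shows "adjoin R I x \<subseteq> L"
proof -
  interpret L: ideal L R by fact
  show ?thesis using assms(2,3) by (auto simp: adjoin_def intro!: L.a_closed L.I_l_closed)
qed

lemma saturation_ideal:
  assumes I: "ideal I R" and P: "primeideal P R"
  shows "ideal (saturation R P I) R"
proof -
  interpret I: ideal I R by fact
  interpret P: primeideal P R by fact
  have one: "\<one> \<notin> P" using P.I_notcarr P.one_imp_carrier by blast
  show ?thesis
  proof (rule idealI[OF ring_axioms])
    show "subgroup (saturation R P I) (add_monoid R)"
    proof (rule add.subgroupI)
      show "saturation R P I \<subseteq> carrier R" by (auto simp: saturation_def)
      have "\<zero> \<in> saturation R P I" using one by (auto simp: saturation_def intro!: bexI[of _ \<one>])
      then show "saturation R P I \<noteq> {}" by auto
      fix a b assume a: "a \<in> saturation R P I"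
      then obtain s where s: "s \<in> carrier R" "s \<notin> P" "s \<otimes> a \<in> I" "a \<in> carrier R" by (auto simp: saturation_def)
      have "s \<otimes> (\<ominus> a) = \<ominus> (s \<otimes> a)" using s r_minus by simp
      then have "s \<otimes> (\<ominus> a) \<in> I" using I.a_inv_closed[OF s(3)] by simp
      then show "\<ominus> a \<in> saturation R P I" using s by (auto simp: saturation_def)
      assume b: "b \<in> saturation R P I"
      then obtain t where t: "t \<in> carrier R" "t \<notin> P" "t \<otimes> b \<in> I" "b \<in> carrier R" by (auto simp: saturation_def)
      have "(s \<otimes> t) \<otimes> (a \<oplus> b) = t \<otimes> (s \<otimes> a) \<oplus> s \<otimes> (t \<otimes> b)" using s t by algebra
      then have "(s \<otimes> t) \<otimes> (a \<oplus> b) \<in> I" using s t by (simp add: I.I_l_closed)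
      moreover have "s \<otimes> t \<notin> P" using P.I_prime s t by blast
      ultimately show "a \<oplus> b \<in> saturation R P I" using s t by (auto simp: saturation_def intro!: bexI[of _ "s \<otimes> t"])
    qed
    fix a x assume a: "a \<in> saturation R P I" and x: "x \<in> carrier R"
    then obtain s where s: "s \<in> carrier R" "s \<notin> P" "s \<otimes> a \<in> I" "a \<in> carrier R" by (auto simp: saturation_def)
    have "s \<otimes> (x \<otimes> a) = x \<otimes> (s \<otimes> a)" using s x by algebra
    then have "s \<otimes> (x \<otimes> a) \<in> I" using s x by (simp add: I.I_l_closed)
    then show "x \<otimes> a \<in> saturation R P I" using s x by (auto simp: saturation_def)
    then show "a \<otimes> x \<in> saturation R P I" using s x by (simp add: m_comm)
  qed
qed

lemma saturation_supset:
  assumes I: "ideal I R" and P: "primeideal P R"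
  shows "I \<subseteq> saturation R P I"
proof -
  interpret I: ideal I R by fact
  interpret P: primeideal P R by fact
  have one: "\<one> \<notin> P" using P.I_notcarr P.one_imp_carrier by blast
  show ?thesis using one by (auto simp: saturation_def I.a_Hcarr intro!: bexI[of _ \<one>])
qed

lemma saturation_saturated:
  assumes I: "ideal I R" and P: "primeideal P R"
  shows "saturated R P (saturation R P I)"
  unfolding saturated_def saturation_def
proof (clarsimp, goal_cases)
  case (1 s a t)
  then have "t \<otimes> s \<otimes> a \<in> I" "t \<otimes> s \<notin> P" using primeideal.I_prime[OF P, of t s] by (auto simp: m_assoc)
  then show ?case using 1 by (intro bexI[of _ "t \<otimes> s"]) auto
qed

lemma saturation_least:
  assumes "saturated R P L" "I \<subseteq> L"
  shows "saturation R P I \<subseteq> L"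
  using assms by (auto simp: saturation_def saturated_def)

end

section \<open>Nakayama's lemma and the principal ideal theorem\<close>

context noetherian_cring begin

text \<open>
  Nakayama's lemma for the localization at \<open>P\<close>: the hypothesis \<open>step\<close> says that \<open>N\<close> lies in the saturation of
  \<open>K + P N\<close>, phrased by the saturated ideals containing \<open>K + P N\<close> so that no products of ideals have to be formed. The
  proof takes a saturated \<open>L \<supseteq> K\<close> maximal among those
  that do not contain \<open>N\<close>. If some \<open>a z\<close> with \<open>a \<in> P\<close> and \<open>z \<in> N\<close> were outside \<open>L\<close>, maximality would put \<open>z\<close>
  into the saturation of \<open>L + (a z)\<close>, and \<open>(s - c a) z \<in> L\<close> with \<open>s \<notin> P\<close> would give \<open>z \<in> L\<close>. So \<open>P N \<subseteq> L\<close>,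
  hence \<open>N \<subseteq> L\<close>, which is absurd.
\<close>

lemma nakayama:
  assumes P: "primeideal P R" and K: "ideal K R" "saturated R P K"
    and N: "N \<subseteq> carrier R"
    and step: "\<And>L. ideal L R \<Longrightarrow> saturated R P L \<Longrightarrow> K \<subseteq> L \<Longrightarrow> (\<And>a z. a \<in> P \<Longrightarrow> z \<in> N \<Longrightarrow> a \<otimes> z \<in> L) \<Longrightarrow> N \<subseteq> L"
  shows "N \<subseteq> K"
proof (rule ccontr)
  assume neg: "\<not> N \<subseteq> K"
  interpret P: primeideal P R by fact
  let ?S = "{L. ideal L R \<and> saturated R P L \<and> K \<subseteq> L \<and> \<not> N \<subseteq> L}"
  have "K \<in> ?S" using K neg by blast
  then have "\<exists>L\<in>?S. \<forall>Y\<in>?S. L \<subseteq> Y \<longrightarrow> Y = L" by (intro ideal_max_exists) auto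
  then obtain L where L_in: "L \<in> ?S" and max: "\<And>L'. L' \<in> ?S \<Longrightarrow> L \<subseteq> L' \<Longrightarrow> L' = L"
    by (elim bexE) (simp only:)
  have L: "ideal L R" "saturated R P L" "K \<subseteq> L" "\<not> N \<subseteq> L" using L_in by auto
  have "a \<otimes> z \<in> L" if a: "a \<in> P" and z: "z \<in> N" for a z
  proof (rule ccontr)
    assume az: "a \<otimes> z \<notin> L"
    have car: "a \<in> carrier R" "z \<in> carrier R" using a z N P.a_Hcarr by auto
    interpret L: ideal L R by fact
    let ?A = "adjoin R L (a \<otimes> z)"
    have A: "ideal ?A R" "L \<subseteq> ?A" "a \<otimes> z \<in> ?A"
      using adjoin_ideal[OF L(1)] adjoin_supset[OF L(1)] car by auto
    note S = saturation_ideal[OF A(1) P] saturation_supset[OF A(1) P] saturation_saturated[OF A(1) P]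
    have "N \<subseteq> saturation R P ?A"
    proof (rule ccontr)
      assume "\<not> N \<subseteq> saturation R P ?A"
      then have "saturation R P ?A = L" by (intro max) (use S A L in auto)
      then show False using S(2) A(3) az by auto
    qed
    then obtain s where s: "s \<in> carrier R" "s \<notin> P" "s \<otimes> z \<in> ?A" using z by (auto simp: saturation_def)
    then obtain l c where l: "l \<in> L" and c: "c \<in> carrier R" and eq: "s \<otimes> z = l \<oplus> c \<otimes> (a \<otimes> z)"
      by (auto simp: adjoin_def)
    have lc: "l \<in> carrier R" using l L.a_Hcarr by auto
    have "(s \<ominus> c \<otimes> a) \<otimes> z = s \<otimes> z \<ominus> c \<otimes> (a \<otimes> z)" using s c car by algebra
    also have "\<dots> = l" unfolding eq using lc c car by algebra
    finally have in_L: "(s \<ominus> c \<otimes> a) \<otimes> z \<in> L" using l by simp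
    have "s \<ominus> c \<otimes> a \<notin> P"
    proof
      assume "s \<ominus> c \<otimes> a \<in> P"
      then have "(s \<ominus> c \<otimes> a) \<oplus> c \<otimes> a \<in> P" using a c by (intro P.a_closed P.I_l_closed)
      moreover have "(s \<ominus> c \<otimes> a) \<oplus> c \<otimes> a = s" using s c car by algebra
      ultimately show False using s by simp
    qed
    with in_L have "z \<in> L" using saturatedD[OF L(2), of "s \<ominus> c \<otimes> a" z] s c car by auto
    then show False using az L.I_l_closed car by auto
  qed
  then show False using step[OF L(1-3)] L(4) by blast
qed

text \<open>
  The existence of associated primes of \<open>R/I\<close>: an annihilator that is maximal among the annihilators of non-zero
  elements is prime.
\<close>

lemma annihilator_prime_exists:
  assumes I: "ideal I R" and ne: "I \<noteq> carrier R"
  obtains z where "z \<in> carrier R" "z \<notin> I" "primeideal {a \<in> carrier R. a \<otimes> z \<in> I} R"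
proof -
  interpret I: ideal I R by fact
  let ?ann = "\<lambda>z. {a \<in> carrier R. a \<otimes> z \<in> I}"
  have id: "ideal (?ann z) R" if z: "z \<in> carrier R" for z
  proof (rule idealI[OF ring_axioms])
    show "subgroup (?ann z) (add_monoid R)"
    proof (rule add.subgroupI)
      have "\<zero> \<in> ?ann z" using z by simp
      then show "?ann z \<noteq> {}" by blast
    qed (use z in \<open>auto simp: l_distr l_minus\<close>)
    fix a x assume a: "a \<in> ?ann z" and x: "x \<in> carrier R"
    show "x \<otimes> a \<in> ?ann z" using a x z by (auto simp: m_assoc I.I_l_closed)
    then show "a \<otimes> x \<in> ?ann z" using a x by (simp add: m_comm)
  qed
  let ?S = "?ann ` (carrier R - I)"
  have "?S \<noteq> {}" using ne I.a_subset by blast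
  then have "\<exists>Q\<in>?S. \<forall>Y\<in>?S. Q \<subseteq> Y \<longrightarrow> Y = Q" by (rule ideal_max_exists) (use id in auto)
  then obtain Q where Q: "Q \<in> ?S" and max: "\<And>Q'. Q' \<in> ?S \<Longrightarrow> Q \<subseteq> Q' \<Longrightarrow> Q' = Q"
    by (elim bexE) (simp only:)
  from Q obtain z where z: "z \<in> carrier R" "z \<notin> I" and Qz: "Q = ?ann z" by auto
  have "primeideal Q R"
  proof (rule primeidealI)
    show "ideal Q R" using id z Qz by simp
    show "cring R" by (rule is_cring)
    have "\<one> \<notin> Q" using z Qz by simp
    then show "carrier R \<noteq> Q" by auto
    fix a b assume ab: "a \<in> carrier R" "b \<in> carrier R" "a \<otimes> b \<in> Q"
    show "a \<in> Q \<or> b \<in> Q"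
    proof (rule disjCI)
      assume "b \<notin> Q"
      then have bz: "b \<otimes> z \<in> carrier R - I" using ab z Qz by auto
      have "Q \<subseteq> ?ann (b \<otimes> z)"
      proof
        fix q assume "q \<in> Q"
        then have q: "q \<in> carrier R" "q \<otimes> z \<in> I" by (auto simp: Qz)
        have "q \<otimes> (b \<otimes> z) = b \<otimes> (q \<otimes> z)" using q ab z by algebra
        then show "q \<in> ?ann (b \<otimes> z)" using q ab I.I_l_closed by auto
      qed
      then have "?ann (b \<otimes> z) = Q" using bz by (intro max) auto
      moreover have "a \<in> ?ann (b \<otimes> z)" using ab z Qz by (auto simp: m_assoc)
      ultimately show "a \<in> Q" by simp
    qed
  qed
  then show ?thesis using that z Qz by blast
qed

text \<open>
  If \<open>P\<close> is the only prime between \<open>D\<close> and \<open>P\<close>, the localization of \<open>R/(D)\<close> at \<open>P\<close> is Artinian. Among the saturated ideals above which some chain descends strictly at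
  every step, take a maximal \<open>I\<close>. By uniqueness \<open>P\<close> is associated to \<open>R/I\<close>, which gives \<open>z \<notin> I\<close> with \<open>P z \<subseteq> I\<close>. Every chain
  above \<open>I\<close> and \<open>z\<close> has a stable step, and no saturated ideal lies strictly between \<open>I\<close> and the saturation of
  \<open>I + (z)\<close>, so by modularity the same holds for every chain above \<open>I\<close>.
\<close>

lemma descending_stable:
  assumes P: "primeideal P R"
    and uniq: "\<And>Q. primeideal Q R \<Longrightarrow> D \<subseteq> Q \<Longrightarrow> Q \<subseteq> P \<Longrightarrow> Q = P"
    and L: "\<And>n::nat. ideal (L n) R" "\<And>n. saturated R P (L n)" "\<And>n. D \<subseteq> L n" "\<And>n. L (Suc n) \<subseteq> L n"
  shows "\<exists>n. L (Suc n) = L n"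
proof (rule ccontr)
  assume neg: "\<nexists>n. L (Suc n) = L n"
  define bad where "bad I L \<longleftrightarrow> (\<forall>n::nat. ideal (L n) R \<and> saturated R P (L n) \<and> I \<subseteq> L n \<and> L (Suc n) \<subseteq> L n \<and> L (Suc n) \<noteq> L n)"
    for I and L :: "nat \<Rightarrow> 'a set"
  let ?S = "{I. ideal I R \<and> saturated R P I \<and> D \<subseteq> I \<and> (\<exists>L. bad I L)}"
  have in_S: "(\<Inter>n. L n) \<in> ?S"
  proof (intro CollectI conjI exI)
    show "ideal (\<Inter>n. L n) R" using i_Intersect[of "range L"] L(1) by auto
    show "saturated R P (\<Inter>n. L n)" using L(2) by (intro saturated_Inter) auto
    show "D \<subseteq> (\<Inter>n. L n)" using L(3) by blast
    show "bad (\<Inter>n. L n) L" using L neg by (auto simp: bad_def)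
  qed
  have "\<exists>I\<in>?S. \<forall>Y\<in>?S. I \<subseteq> Y \<longrightarrow> Y = I"
    by (rule ideal_max_exists) (use in_S in auto)
  then obtain I where I_in: "I \<in> ?S" and max: "\<And>I'. I' \<in> ?S \<Longrightarrow> I \<subseteq> I' \<Longrightarrow> I' = I"
    by (elim bexE) (simp only:)
  have I: "ideal I R" "saturated R P I" "D \<subseteq> I" "\<exists>L. bad I L" using I_in by auto
  from I(4) obtain L where bad: "bad I L" by blast
  then have L: "\<And>n. ideal (L n) R" "\<And>n. saturated R P (L n)" "\<And>n. I \<subseteq> L n" "\<And>n. L (Suc n) \<subseteq> L n" "\<And>n. L (Suc n) \<noteq> L n"
    by (auto simp: bad_def)
  interpret I: ideal I R by fact
  interpret P: primeideal P R by fact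
  have sub: "L n \<subseteq> carrier R" for n using ideal.Icarr[OF L(1)] by blast
  have anti: "L (n + m) \<subseteq> L n" for n m by (induction m) (use L(4) in \<open>auto dest!: subsetD[OF L(4)]\<close>)
  have "I \<noteq> carrier R" using L(3)[of 0] L(3)[of 1] L(5)[of 0] sub[of 0] sub[of 1] by auto
  then obtain z where z: "z \<in> carrier R" "z \<notin> I" and prime: "primeideal {a \<in> carrier R. a \<otimes> z \<in> I} R"
    using annihilator_prime_exists[OF I(1)] by blast
  have "{a \<in> carrier R. a \<otimes> z \<in> I} = P"
  proof (rule uniq[OF prime])
    show "D \<subseteq> {a \<in> carrier R. a \<otimes> z \<in> I}" using I(3) z I.a_Hcarr I.I_r_closed by auto
    show "{a \<in> carrier R. a \<otimes> z \<in> I} \<subseteq> P" using saturatedD[OF I(2)] z by blast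
  qed
  then have annP: "a \<otimes> z \<in> I" if "a \<in> P" for a using that by blast
  define J where "J = saturation R P (adjoin R I z)"
  have A: "ideal (adjoin R I z) R" "I \<subseteq> adjoin R I z" "z \<in> adjoin R I z"
    using adjoin_ideal[OF I(1)] adjoin_supset[OF I(1)] z by auto
  have J: "ideal J R" "saturated R P J" "I \<subseteq> J" "z \<in> J"
    using saturation_ideal[OF A(1) P] saturation_saturated[OF A(1) P] saturation_supset[OF A(1) P] A
    by (auto simp: J_def)
  have noJ: "\<not> bad J L'" for L'
  proof
    assume "bad J L'"
    then have "J \<in> ?S" using J I(3) by blast
    then have "J = I" using max J(3) by blast
    then show False using J(4) z by simp
  qed
  have "\<exists>n0. z \<notin> L n0"
  proof (rule ccontr)
    assume "\<nexists>n0. z \<notin> L n0"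
    then have "adjoin R I z \<subseteq> L n" for n using adjoin_least[OF L(1) L(3)] by blast
    then have "J \<subseteq> L n" for n using saturation_least[OF L(2)] by (simp add: J_def)
    then have "bad J L" using L by (simp add: bad_def)
    then show False using noJ by blast
  qed
  then obtain n0 where n0: "z \<notin> L n0" by blast
  \<comment> \<open>Adding \<open>z\<close> to a tail of the chain gives a chain above \<open>J\<close>, which is stable somewhere.\<close>
  define L' where "L' n = saturation R P (adjoin R (L (n0 + n)) z)" for n
  have A': "ideal (adjoin R (L n) z) R" "L n \<subseteq> adjoin R (L n) z" "z \<in> adjoin R (L n) z" for n
    using adjoin_ideal[OF L(1)] adjoin_supset[OF L(1)] z by auto
  have L': "ideal (L' n) R" "saturated R P (L' n)" "L (n0 + n) \<subseteq> L' n" "z \<in> L' n" for n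
    unfolding L'_def
    by (rule saturation_ideal[OF A'(1) P] saturation_saturated[OF A'(1) P]
        subset_trans[OF A'(2) saturation_supset[OF A'(1) P]] subsetD[OF saturation_supset[OF A'(1) P] A'(3)])+
  have J': "J \<subseteq> L' n" for n
    unfolding J_def
    using L'(3)[of n] L(3)[of "n0 + n"] L'(4) by (intro saturation_least[OF L'(2)] adjoin_least[OF L'(1)]) auto
  have d': "L' (Suc n) \<subseteq> L' n" for n
    unfolding L'_def[of "Suc n"] using L'(3)[of n] L(4)[of "n0 + n"] L'(4)
    by (intro saturation_least[OF L'(2)] adjoin_least[OF L'(1)]) auto
  obtain n where n: "L' (Suc n) = L' n"
    using noJ[of L'] L' J' d' by (auto simp: bad_def)
  let ?n = "n0 + n"
  have zn: "z \<notin> L ?n" using n0 anti by blast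
  have "L ?n \<subseteq> L (Suc ?n)"
  proof
    fix w assume w: "w \<in> L ?n"
    interpret Ln: ideal "L ?n" R by (rule L)
    interpret Ls: ideal "L (Suc ?n)" R by (rule L)
    have "w \<in> L' (Suc n)" using w L'(3) n by auto
    then obtain s where s: "s \<in> carrier R" "s \<notin> P" "s \<otimes> w \<in> adjoin R (L (Suc ?n)) z"
      by (auto simp: L'_def saturation_def)
    then obtain l a where l: "l \<in> L (Suc ?n)" and a: "a \<in> carrier R" and eq: "s \<otimes> w = l \<oplus> a \<otimes> z"
      by (auto simp: adjoin_def)
    have lc: "l \<in> carrier R" using l Ls.a_Hcarr by auto
    have wc: "w \<in> carrier R" using w Ln.a_Hcarr by auto
    have "a \<otimes> z = s \<otimes> w \<ominus> l" unfolding eq using lc a z by algebra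
    also have "\<dots> \<in> L ?n"
      unfolding a_minus_def using s w l L(4)[of ?n] by (intro Ln.a_closed Ln.I_l_closed Ln.a_inv_closed) auto
    finally have "a \<otimes> z \<in> L ?n" .
    then have "a \<in> P" using saturatedD[OF L(2)[of ?n], of a z] zn z a by blast
    then have "a \<otimes> z \<in> L (Suc ?n)" using annP L(3) by blast
    then have "s \<otimes> w \<in> L (Suc ?n)" unfolding eq using l by (intro Ls.a_closed)
    then show "w \<in> L (Suc ?n)" using saturatedD[OF L(2)] s wc by blast
  qed
  then show False using L(4,5)[of ?n] by auto
qed

text \<open>
  Krull's principal ideal theorem: if the conclusion failed, then modulo \<open>p0\<close> and localized at \<open>p2\<close> the maximal ideal would
  be the only prime containing \<open>x\<close>, although its height is at least two. The symbolic powers \<open>Q n\<close> of \<open>p1\<close> modulo \<open>p0\<close>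
  become stationary modulo \<open>x\<close>. As \<open>x \<notin> p1\<close>, this gives \<open>Q n \<subseteq> Q (n + 1) + x Q n\<close> after saturation, so
  \<open>Q n = Q (n + 1)\<close> by Nakayama at \<open>p2\<close>, and then \<open>Q n \<subseteq> p0\<close> by Nakayama at \<open>p1\<close>. This contradicts \<open>p1 \<noteq> p0\<close>.
\<close>

theorem krull_between:
  assumes p0: "primeideal p0 R" and p1: "primeideal p1 R" and p2: "primeideal p2 R"
    and less: "p0 \<subset> p1" "p1 \<subset> p2" and x: "x \<in> p2"
  obtains q where "primeideal q R" "p0 \<subset> q" "q \<subset> p2" "x \<in> q"
proof (rule ccontr)
  assume "\<not> thesis"
  with that have no: "\<not> (p0 \<subset> q \<and> q \<subset> p2 \<and> x \<in> q)" if "primeideal q R" for q using that by blast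
  interpret p0: primeideal p0 R by fact
  interpret p1: primeideal p1 R by fact
  interpret p2: primeideal p2 R by fact
  have xc: "x \<in> carrier R" using x p2.a_Hcarr by auto
  have x1: "x \<notin> p1" using no[OF p1] less by blast
  have x0: "x \<notin> p0" using x1 less by blast
  \<comment> \<open>The ideal \<open>Q (n + 1)\<close> is the smallest \<open>p1\<close>-saturated ideal that contains \<open>p0\<close> and \<open>p1 Q n\<close>.\<close>
  define cand where "cand Q = {L. ideal L R \<and> saturated R p1 L \<and> p0 \<subseteq> L \<and> (\<forall>a\<in>p1. \<forall>z\<in>Q. a \<otimes> z \<in> L)}" for Q
  define Q where "Q = rec_nat (carrier R) (\<lambda>_ Q. \<Inter>(cand Q))"
  have Q0: "Q 0 = carrier R" and QS: "Q (Suc n) = \<Inter>(cand (Q n))" for n by (auto simp: Q_def)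
  have Q: "ideal (Q n) R \<and> saturated R p1 (Q n) \<and> p0 \<subseteq> Q n" for n
  proof (induction n)
    case 0
    then show ?case using oneideal p0.a_subset by (auto simp: Q0 saturated_def)
  next
    case (Suc n)
    interpret Qn: ideal "Q n" R using Suc by simp
    have ne: "Q n \<in> cand (Q n)" using Suc Qn.I_l_closed p1.a_Hcarr by (auto simp: cand_def)
    show ?case
    proof (intro conjI)
      show "ideal (Q (Suc n)) R" unfolding QS using ne by (intro i_Intersect) (auto simp: cand_def)
      show "saturated R p1 (Q (Suc n))" unfolding QS by (rule saturated_Inter) (simp add: cand_def)
      show "p0 \<subseteq> Q (Suc n)" by (auto simp: QS cand_def)
    qed
  qed
  have desc: "Q (Suc n) \<subseteq> Q n" for n
  proof -
    interpret Qn: ideal "Q n" R using Q by simp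
    have "Q n \<in> cand (Q n)" using Q Qn.I_l_closed p1.a_Hcarr by (auto simp: cand_def)
    then show ?thesis by (auto simp: QS)
  qed
  have prodQ: "a \<otimes> z \<in> Q (Suc n)" if "a \<in> p1" "z \<in> Q n" for a z n
    using that by (auto simp: QS cand_def)
  have Qp2: "saturated R p2 (Q n)" for n
    using Q[of n] less by (auto simp: saturated_def)
  have not0: "\<not> Q n \<subseteq> p0" for n
  proof (induction n)
    case 0
    then show ?case using p0.I_notcarr p0.a_subset by (auto simp: Q0)
  next
    case (Suc n)
    then obtain z where z: "z \<in> Q n" "z \<notin> p0" by blast
    obtain a where a: "a \<in> p1" "a \<notin> p0" using less by blast
    have "z \<in> carrier R" using ideal.Icarr[of "Q n" R z] z(1) Q[of n] by simp
    then have "a \<otimes> z \<notin> p0" using p0.I_prime[of a z] a z p1.a_Hcarr[of a] by auto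
    then show ?case using prodQ[OF a(1) z(1)] by blast
  qed
  define L where "L n = saturation R p2 (adjoin R (Q n) x)" for n
  have A: "ideal (adjoin R (Q n) x) R" "Q n \<subseteq> adjoin R (Q n) x" "x \<in> adjoin R (Q n) x" for n
    using adjoin_ideal[of "Q n"] adjoin_supset[of "Q n"] Q xc by auto
  have L: "ideal (L n) R" "saturated R p2 (L n)" "Q n \<subseteq> L n" "x \<in> L n" for n
    unfolding L_def
    by (rule saturation_ideal[OF A(1) p2] saturation_saturated[OF A(1) p2]
        subset_trans[OF A(2) saturation_supset[OF A(1) p2]] subsetD[OF saturation_supset[OF A(1) p2] A(3)])+
  have "\<exists>n. L (Suc n) = L n"
  proof (rule descending_stable[OF p2, where D = "insert x p0"])
    show "q = p2" if "primeideal q R" "insert x p0 \<subseteq> q" "q \<subseteq> p2" for q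
      using no[OF that(1)] that x0 by auto
    show "insert x p0 \<subseteq> L n" for n using L(3,4)[of n] Q[of n] by auto
    show "L (Suc n) \<subseteq> L n" for n
      unfolding L_def[of "Suc n"] using L(3,4)[of n] desc[of n]
      by (intro saturation_least[OF L(2)] adjoin_least[OF L(1)]) auto
  qed (use L in auto)
  then obtain n where n: "L (Suc n) = L n" by blast
  interpret Qn: ideal "Q n" R using Q by simp
  interpret Qs: ideal "Q (Suc n)" R using Q by simp
  have "Q n \<subseteq> Q (Suc n)"
  proof (rule nakayama[OF p2])
    show "ideal (Q (Suc n)) R" using Q by simp
    show "saturated R p2 (Q (Suc n))" by (rule Qp2)
    show "Q n \<subseteq> carrier R" by (rule Qn.a_subset)
    fix K assume K: "ideal K R" "saturated R p2 K" "Q (Suc n) \<subseteq> K"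
      and prod: "\<And>a z. a \<in> p2 \<Longrightarrow> z \<in> Q n \<Longrightarrow> a \<otimes> z \<in> K"
    interpret K: ideal K R by fact
    show "Q n \<subseteq> K"
    proof
      fix a assume a: "a \<in> Q n"
      have ac: "a \<in> carrier R" using a Qn.a_Hcarr by auto
      have "a \<in> L (Suc n)" using a L(3) n by blast
      then obtain s where s: "s \<in> carrier R" "s \<notin> p2" "s \<otimes> a \<in> adjoin R (Q (Suc n)) x"
        by (auto simp: L_def saturation_def)
      then obtain b c where b: "b \<in> Q (Suc n)" and c: "c \<in> carrier R" and eq: "s \<otimes> a = b \<oplus> c \<otimes> x"
        by (auto simp: adjoin_def)
      have bc: "b \<in> carrier R" using b Qs.a_Hcarr by auto
      have "x \<otimes> c = s \<otimes> a \<ominus> b" unfolding eq using bc c xc by algebra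
      also have "\<dots> \<in> Q n"
        unfolding a_minus_def using s a b desc[of n] by (intro Qn.a_closed Qn.I_l_closed Qn.a_inv_closed) auto
      finally have "c \<in> Q n" using saturatedD[of R p1 "Q n" x c] Q xc x1 c by blast
      then have "x \<otimes> c \<in> K" using prod x by blast
      then have "s \<otimes> a \<in> K" unfolding eq using b K(3) c xc by (intro K.a_closed) (auto simp: m_comm)
      then show "a \<in> K" using saturatedD[OF K(2)] s ac by blast
    qed
  qed
  have "Q n \<subseteq> p0"
  proof (rule nakayama[OF p1])
    show "ideal p0 R" ..
    show "saturated R p1 p0" using prime_saturated[OF p0] less by blast
    show "Q n \<subseteq> carrier R" by (rule Qn.a_subset)
    fix K assume K: "ideal K R" "saturated R p1 K" "p0 \<subseteq> K"
      and prod: "\<And>a z. a \<in> p1 \<Longrightarrow> z \<in> Q n \<Longrightarrow> a \<otimes> z \<in> K"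
    have "K \<in> cand (Q n)" unfolding cand_def by (intro CollectI conjI ballI K prod)
    then have "Q (Suc n) \<subseteq> K" unfolding QS by (rule Inter_lower)
    with \<open>Q n \<subseteq> Q (Suc n)\<close> show "Q n \<subseteq> K" by (rule subset_trans)
  qed
  then show False using not0 by blast
qed

end

section \<open>Prime ideals generated by parameters of a regular local ring\<close>

context noetherian_cring begin

text \<open>
  An element of the top of a chain of primes can be moved into every member but the bottom one, without changing
  the two ends: replace the members one at a time from the top by \<open>krull_between\<close>.
\<close>

lemma prime_chain_through:
  assumes "\<And>i. i \<le> Suc e \<Longrightarrow> primeideal (C i) R" "\<And>i. i \<le> e \<Longrightarrow> C i \<subset> C (Suc i)" "x \<in> C (Suc e)"
  shows "\<exists>C'. C' 0 = C 0 \<and> C' (Suc e) = C (Suc e) \<and> (\<forall>i\<le>Suc e. primeideal (C' i) R) \<and>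
    (\<forall>i\<le>e. C' i \<subset> C' (Suc i)) \<and> x \<in> C' (Suc 0)"
  using assms
proof (induction e arbitrary: C)
  case 0
  then show ?case by (intro exI[of _ C]) auto
next
  case (Suc e)
  obtain q where q: "primeideal q R" "C e \<subset> q" "q \<subset> C (Suc (Suc e))" "x \<in> q"
    using krull_between[of "C e" "C (Suc e)" "C (Suc (Suc e))" x] Suc.prems by (metis le_SucI le_refl)
  have "\<exists>C'. C' 0 = (C(Suc e := q)) 0 \<and> C' (Suc e) = (C(Suc e := q)) (Suc e) \<and> (\<forall>i\<le>Suc e. primeideal (C' i) R) \<and>
    (\<forall>i\<le>e. C' i \<subset> C' (Suc i)) \<and> x \<in> C' (Suc 0)"
  proof (rule Suc.IH)
    show "primeideal ((C(Suc e := q)) i) R" if "i \<le> Suc e" for i using Suc.prems(1)[of i] q that by auto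
    show "(C(Suc e := q)) i \<subset> (C(Suc e := q)) (Suc i)" if "i \<le> e" for i
      using Suc.prems(2)[of i] q that by auto
  qed (use q in auto)
  then obtain C' where C': "C' 0 = C 0" "C' (Suc e) = q" "\<And>i. i \<le> Suc e \<Longrightarrow> primeideal (C' i) R"
    "\<And>i. i \<le> e \<Longrightarrow> C' i \<subset> C' (Suc i)" "x \<in> C' (Suc 0)" by auto
  let ?D = "C'(Suc (Suc e) := C (Suc (Suc e)))"
  have "primeideal (?D i) R" if "i \<le> Suc (Suc e)" for i
    using C'(3)[of i] Suc.prems(1)[of i] that by (cases "i = Suc (Suc e)") auto
  moreover have "?D i \<subset> ?D (Suc i)" if "i \<le> Suc e" for i
    using C'(2) C'(4)[of i] q(3) that by (cases "i = Suc e") auto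
  ultimately show ?case using C' by (intro exI[of _ ?D]) auto
qed

lemma nonunits_prime:
  assumes m: "ideal (nonunits R) R"
  shows "primeideal (nonunits R) R"
proof (rule primeidealI[OF m is_cring])
  have "\<one> \<notin> nonunits R" by (simp add: nonunits_def)
  then show "carrier R \<noteq> nonunits R" by auto
qed (auto simp: nonunits_def)

lemma prime_nonunits:
  assumes P: "primeideal P R" shows "P \<subseteq> nonunits R"
proof
  interpret P: primeideal P R by fact
  fix a assume a: "a \<in> P"
  have "a \<notin> Units R" using ideal_eq_carrier_iff a P.I_notcarr P.is_ideal P.I_r_closed
    by (metis P.a_Hcarr P.one_imp_carrier Units_r_inv_ex)
  then show "a \<in> nonunits R" using a P.a_Hcarr by (simp add: nonunits_def)
qed

lemma ideal_saturated_nonunits: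
  assumes "ideal L R" shows "saturated R (nonunits R) L"
proof -
  interpret L: ideal L R by fact
  show ?thesis unfolding saturated_def nonunits_def
  proof (intro ballI impI)
    fix s a assume s: "s \<in> carrier R - (carrier R - Units R)" and a: "a \<in> carrier R" "s \<otimes> a \<in> L"
    then have sU: "s \<in> Units R" by simp
    have "inv s \<otimes> (s \<otimes> a) = a" using sU a(1) by (metis Units_closed Units_inv_closed Units_l_inv l_one m_assoc)
    then show "a \<in> L" using L.I_l_closed[OF a(2) Units_inv_closed[OF sU]] by simp
  qed
qed

text \<open>
  If the maximal ideal is generated by \<open>J\<close> and \<open>e\<close> further elements and there is a chain of primes of length \<open>e\<close>
  above \<open>J\<close>, then \<open>J\<close> is prime, in fact the bottom of the chain. The second conclusion is the induction principle
  that results when the elements are added to \<open>J\<close> in a suitable order, every intermediate ideal being prime.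
  The ideals stay in \<open>R\<close> so that no quotient rings occur in the induction.
\<close>

lemma parameters_prime_induct:
  assumes m: "ideal (nonunits R) R"
    and "ideal J R" "finite Y" "J \<subseteq> nonunits R" "Y \<subseteq> nonunits R"
    and gen: "\<And>L. ideal L R \<Longrightarrow> J \<subseteq> L \<Longrightarrow> Y \<subseteq> L \<Longrightarrow> nonunits R \<subseteq> L"
    and "\<And>i. i \<le> card Y \<Longrightarrow> primeideal (C i) R" "\<And>i. i < card Y \<Longrightarrow> C i \<subset> C (Suc i)" "J \<subseteq> C 0"
    and step: "\<And>J x. primeideal J R \<Longrightarrow> x \<in> carrier R - J \<Longrightarrow> Q J \<Longrightarrow> Q (adjoin R J x)"
  shows "J = C 0 \<and> (Q J \<longrightarrow> Q (nonunits R))"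
  using assms(2-9)
proof (induction "card Y" arbitrary: J Y C)
  case 0
  then have "nonunits R \<subseteq> J" by (intro "0.prems"(5)) auto
  then show ?case using 0 prime_nonunits[of "C 0"] by auto
next
  case (Suc e)
  let ?m = "nonunits R"
  note e = Suc.hyps(2)[symmetric]
  interpret J: ideal J R by fact
  have C0: "primeideal (C 0) R" using Suc.prems(6)[of 0] by simp
  interpret C0: primeideal "C 0" R by fact
  have less_m: "C 0 \<subset> ?m"
    using Suc.prems(7)[of 0] prime_nonunits[OF Suc.prems(6)[of "Suc 0"]] e by auto
  have "\<not> Y \<subseteq> C 0" using Suc.prems(5)[OF C0.is_ideal Suc.prems(8)] less_m by auto
  then obtain x where x: "x \<in> Y" "x \<notin> C 0" by blast
  have xm: "x \<in> ?m" using x Suc.prems by auto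
  then have xc: "x \<in> carrier R" by (simp add: nonunits_def)
  \<comment> \<open>The top of the chain is replaced by the maximal ideal, which contains \<open>x\<close>.\<close>
  let ?D = "C(Suc e := ?m)"
  have "\<exists>C'. C' 0 = ?D 0 \<and> C' (Suc e) = ?D (Suc e) \<and> (\<forall>i\<le>Suc e. primeideal (C' i) R) \<and>
    (\<forall>i\<le>e. C' i \<subset> C' (Suc i)) \<and> x \<in> C' (Suc 0)"
  proof (rule prime_chain_through)
    show "primeideal (?D i) R" if "i \<le> Suc e" for i
      using Suc.prems(6)[of i] nonunits_prime[OF m] that e by auto
    show "?D i \<subset> ?D (Suc i)" if "i \<le> e" for i
      using Suc.prems(7)[of i] prime_nonunits[OF Suc.prems(6)[of "Suc i"]] that e by auto
  qed (use xm in auto)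
  then obtain C' where C': "C' 0 = C 0" "\<And>i. i \<le> Suc e \<Longrightarrow> primeideal (C' i) R"
    "\<And>i. i \<le> e \<Longrightarrow> C' i \<subset> C' (Suc i)" "x \<in> C' (Suc 0)" by auto
  let ?J = "adjoin R J x" and ?Y = "Y - {x}"
  have A: "ideal ?J R" "J \<subseteq> ?J" "x \<in> ?J"
    using adjoin_ideal[OF Suc.prems(1) xc] adjoin_supset[OF Suc.prems(1) xc] by auto
  have cardY: "card ?Y = e" using x Suc.prems(2) e by simp
  have C1: "primeideal (C' (Suc 0)) R" using C'(2) by simp
  have J_C1: "?J \<subseteq> C' (Suc 0)"
    using C'(1,3,4) Suc.prems(8) by (intro adjoin_least primeideal.axioms(1)[OF C1]) auto
  have IH: "?J = C' (Suc 0) \<and> (Q ?J \<longrightarrow> Q ?m)"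
  proof (rule Suc.hyps(1)[of ?Y ?J "\<lambda>i. C' (Suc i)", unfolded cardY])
    show "e = e" ..
    show "ideal ?J R" by (rule A)
    show "finite ?Y" "?Y \<subseteq> ?m" using Suc.prems by auto
    show "?J \<subseteq> ?m" using J_C1 prime_nonunits[OF C1] by blast
    show "?m \<subseteq> L" if "ideal L R" "?J \<subseteq> L" "?Y \<subseteq> L" for L
      using Suc.prems(5)[OF that(1)] that(2,3) A by auto
    show "primeideal (C' (Suc i)) R" if "i \<le> e" for i using C'(2) that by simp
    show "C' (Suc i) \<subset> C' (Suc (Suc i))" if "i < e" for i using C'(3) that by simp
  qed (use J_C1 step in auto)
  \<comment> \<open>As \<open>J + (x)\<close> contains \<open>C 0\<close> and \<open>x \<notin> C 0\<close>, one has \<open>C 0 \<subseteq> J + x C 0\<close>.\<close>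
  have "C 0 \<subseteq> J"
  proof (rule nakayama[OF nonunits_prime[OF m] Suc.prems(1) ideal_saturated_nonunits[OF Suc.prems(1)] C0.a_subset])
    fix L assume L: "ideal L R" "J \<subseteq> L" and prod: "\<And>a z. a \<in> ?m \<Longrightarrow> z \<in> C 0 \<Longrightarrow> a \<otimes> z \<in> L"
    interpret L: ideal L R by fact
    show "C 0 \<subseteq> L"
    proof
      fix z assume z: "z \<in> C 0"
      then have "z \<in> ?J" using IH C'(1,3) by blast
      then obtain j c where j: "j \<in> J" and c: "c \<in> carrier R" and zeq: "z = j \<oplus> c \<otimes> x"
        by (auto simp: adjoin_def)
      have jc: "j \<in> carrier R" using j by (rule J.Icarr)
      have "c \<otimes> x = z \<ominus> j" unfolding zeq using jc c xc by algebra
      also have "\<dots> \<in> C 0" unfolding a_minus_def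
        using z j Suc.prems(8) by (intro C0.a_closed C0.a_inv_closed) auto
      finally have "c \<in> C 0" using C0.I_prime[OF c xc] x by blast
      then have "x \<otimes> c \<in> L" using prod xm by blast
      then show "z \<in> L" unfolding zeq using j L(2) c xc by (intro L.a_closed) (auto simp: m_comm)
    qed
  qed
  then have "J = C 0" using Suc.prems(8) by blast
  moreover have "Q J \<longrightarrow> Q ?m" using IH step[of J x] C0 x xc \<open>J = C 0\<close> by auto
  ultimately show ?case by blast
qed

end

text \<open>
  A property of ideals passes from \<open>0\<close> to the maximal ideal if it can be passed on by adjoining an element to a prime ideal
  that does not contain it. Geometrically, one cuts \<open>Spec R\<close> by one parameter at a time and stays irreducible.
\<close>

theorem regular_local_ring_induct:
  assumes "regular_local_ring R"
    and init: "Q {\<zero>\<^bsub>R\<^esub>}"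
    and step: "\<And>J x. primeideal J R \<Longrightarrow> x \<in> carrier R - J \<Longrightarrow> Q J \<Longrightarrow> Q (adjoin R J x)"
  shows "Q (nonunits R)"
proof -
  obtain Y where loc: "cring R" and noeth: "noetherian_ring R" and chain: "has_prime_chain R (card Y)"
    and Y: "Y \<subseteq> carrier R" "finite Y" "genideal R Y = nonunits R"
    using assms(1) by (auto simp: regular_local_ring_def is_local_ring_def krull_dim_eq_def)
  interpret noetherian_cring R by (intro noetherian_cring.intro loc noeth)
  obtain C where C: "\<And>i. i \<le> card Y \<Longrightarrow> primeideal (C i) R" "\<And>i. i < card Y \<Longrightarrow> C i \<subset> C (Suc i)"
    using chain by (auto simp: has_prime_chain_def)
  have m: "ideal (nonunits R) R" using genideal_ideal[OF Y(1)] Y(3) by simp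
  interpret m: ideal "nonunits R" R by (rule m)
  interpret C0: primeideal "C 0" R using C(1) by simp
  have "{\<zero>\<^bsub>R\<^esub>} = C 0 \<and> (Q {\<zero>\<^bsub>R\<^esub>} \<longrightarrow> Q (nonunits R))"
  proof (rule parameters_prime_induct[OF m zeroideal Y(2)])
    show "Y \<subseteq> nonunits R" using genideal_self[OF Y(1)] Y(3) by simp
    show "nonunits R \<subseteq> L" if "ideal L R" "Y \<subseteq> L" for L
      using genideal_minimal[OF that] Y(3) by simp
  qed (use C step in auto)
  then show ?thesis using init by blast
qed

section \<open>Nilpotent endomorphisms with exact powers\<close>

text \<open>
  Here \<open>G\<close> is a module, \<open>K\<close> plays the part of \<open>J G\<close> and \<open>Z\<close> that of multiplication by a nonzerodivisor \<open>x\<close> modulo \<open>J\<close>.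
  From \<open>ker N = im N^(p-1)\<close> modulo \<open>K\<close> one gets \<open>ker N^j = im N^(p-j)\<close> modulo \<open>K\<close> for all \<open>j \<le> p\<close> by induction on \<open>j\<close>.
  If \<open>N w = k + Z z\<close>, applying \<open>N^(p-1)\<close> gives \<open>N^(p-1) z \<in> K\<close>, because \<open>Z\<close> is injective modulo \<open>K\<close>. So
  \<open>z = N u\<close> modulo \<open>K\<close>, and \<open>w - Z u\<close> is killed by \<open>N\<close> modulo \<open>K\<close>.
\<close>

lemma (in abelian_group) p_exact_descends:
  fixes p :: nat
  assumes N: "N \<in> carrier G \<rightarrow> carrier G" "\<And>x y. x \<in> carrier G \<Longrightarrow> y \<in> carrier G \<Longrightarrow> N (x \<oplus> y) = N x \<oplus> N y"
    and Z: "Z \<in> carrier G \<rightarrow> carrier G" "\<And>x y. x \<in> carrier G \<Longrightarrow> y \<in> carrier G \<Longrightarrow> Z (x \<oplus> y) = Z x \<oplus> Z y"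
    and comm: "\<And>x. x \<in> carrier G \<Longrightarrow> N (Z x) = Z (N x)"
    and p: "p \<ge> 1" and nil: "\<And>x. x \<in> carrier G \<Longrightarrow> (N ^^ p) x = \<zero>"
    and K: "additive_subgroup K G" and NK: "\<And>x. x \<in> K \<Longrightarrow> N x \<in> K" and ZK: "\<And>x. x \<in> K \<Longrightarrow> Z x \<in> K"
    and Zreg: "\<And>z. z \<in> carrier G \<Longrightarrow> Z z \<in> K \<Longrightarrow> z \<in> K"
    and ex: "\<And>x. x \<in> carrier G \<Longrightarrow> N x \<in> K \<Longrightarrow> \<exists>y\<in>carrier G. x \<ominus> (N ^^ (p - 1)) y \<in> K"
    and w: "w \<in> carrier G" "k \<in> K" "z \<in> carrier G" "N w = k \<oplus> Z z"
  shows "\<exists>y\<in>carrier G. \<exists>k'\<in>K. \<exists>z'\<in>carrier G. w \<ominus> (N ^^ (p - 1)) y = k' \<oplus> Z z'"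
proof -
  interpret K: additive_subgroup K G by (rule K)
  have Nc: "N x \<in> carrier G" if "x \<in> carrier G" for x using N(1) that by auto
  have Zc: "Z x \<in> carrier G" if "x \<in> carrier G" for x using Z(1) that by auto
  have Nkc: "(N ^^ i) x \<in> carrier G" if "x \<in> carrier G" for x i using that by (induction i) (auto simp: Nc)
  have Nk_add: "(N ^^ i) (x \<oplus> y) = (N ^^ i) x \<oplus> (N ^^ i) y" if "x \<in> carrier G" "y \<in> carrier G" for x y i
    using that by (induction i) (auto simp: N(2) Nkc)
  have Nk_0: "(N ^^ i) \<zero> = \<zero>" for i
    using Nk_add[of \<zero> \<zero> i] Nkc[of \<zero> i] by (metis add.r_cancel_one' zero_closed l_zero)
  have Nk_neg: "(N ^^ i) (\<ominus> x) = \<ominus> (N ^^ i) x" if "x \<in> carrier G" for x i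
    using Nk_add[of "\<ominus> x" x i] that by (metis Nk_0 Nkc a_inv_closed l_neg minus_equality)
  have Nk_diff: "(N ^^ i) (x \<ominus> y) = (N ^^ i) x \<ominus> (N ^^ i) y" if "x \<in> carrier G" "y \<in> carrier G" for x y i
    using that by (simp add: a_minus_def Nk_add Nk_neg)
  have NkK: "(N ^^ i) x \<in> K" if "x \<in> K" for x i using that by (induction i) (auto simp: NK)
  have NkZ: "(N ^^ i) (Z x) = Z ((N ^^ i) x)" if "x \<in> carrier G" for x i
    using that by (induction i) (auto simp: comm Nkc)
  have Kc: "x \<in> carrier G" if "x \<in> K" for x using that by (rule K.a_Hcarr)
  have all: "\<exists>y\<in>carrier G. x \<ominus> (N ^^ (p - j)) y \<in> K" if "j \<le> p" "x \<in> carrier G" "(N ^^ j) x \<in> K" for j x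
    using that
  proof (induction j arbitrary: x)
    case 0
    then show ?case using NkK
      by (intro bexI[of _ \<zero>]) (auto simp: a_minus_def Nk_0)
  next
    case (Suc j)
    have "N ((N ^^ j) x) \<in> K" using Suc.prems by simp
    then obtain y where y: "y \<in> carrier G" "(N ^^ j) x \<ominus> (N ^^ (p - 1)) y \<in> K"
      using ex[OF Nkc[OF Suc.prems(2)]] by blast
    have "p - 1 = j + (p - Suc j)" using Suc.prems(1) by simp
    then have "(N ^^ (p - 1)) y = (N ^^ j) ((N ^^ (p - Suc j)) y)" by (simp add: funpow_add)
    then have "(N ^^ j) (x \<ominus> (N ^^ (p - Suc j)) y) \<in> K" using y Suc.prems by (simp add: Nk_diff Nkc)
    then obtain u where u: "u \<in> carrier G" "x \<ominus> (N ^^ (p - Suc j)) y \<ominus> (N ^^ (p - j)) u \<in> K"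
      using Suc.IH[of "x \<ominus> (N ^^ (p - Suc j)) y"] Suc.prems y Nkc by auto
    have "p - j = (p - Suc j) + 1" using Suc.prems(1) by simp
    then have e: "(N ^^ (p - j)) u = (N ^^ (p - Suc j)) (N u)" by (simp add: funpow_swap1)
    have "x \<ominus> (N ^^ (p - Suc j)) (y \<oplus> N u) = x \<ominus> (N ^^ (p - Suc j)) y \<ominus> (N ^^ (p - j)) u"
      using u y Suc.prems Nkc[of y "p - Suc j"] Nkc[of "N u" "p - Suc j"]
      by (simp add: e Nk_add Nc a_minus_def minus_add a_assoc)
    then show ?case using u y Nc by (intro bexI[of _ "y \<oplus> N u"]) auto
  qed
  have kc: "k \<in> carrier G" using w Kc by auto
  have "(N ^^ (p - 1)) (N w) = (N ^^ p) w" using p by (cases p) (auto simp: funpow_swap1)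
  then have "\<zero> = (N ^^ (p - 1)) (k \<oplus> Z z)" using nil w by simp
  also have "\<dots> = (N ^^ (p - 1)) k \<oplus> Z ((N ^^ (p - 1)) z)" using w kc by (simp add: Nk_add NkZ Zc)
  finally have eq0: "Z ((N ^^ (p - 1)) z) \<oplus> (N ^^ (p - 1)) k = \<zero>"
    using kc w Nkc Zc by (simp add: a_comm)
  have "Z ((N ^^ (p - 1)) z) = \<ominus> (N ^^ (p - 1)) k"
    using minus_equality[OF eq0] kc w Nkc Zc by simp
  then have "Z ((N ^^ (p - 1)) z) \<in> K" using K.a_inv_closed[OF NkK[OF w(2)]] by simp
  then have "(N ^^ (p - 1)) z \<in> K" by (rule Zreg[OF Nkc[OF w(3)]])
  moreover have "p - (p - 1) = 1" using p by simp
  ultimately obtain u where u: "u \<in> carrier G" "z \<ominus> N u \<in> K"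
    using all[of "p - 1" z] w(3) by auto
  have zeq: "z = (z \<ominus> N u) \<oplus> N u" using u w Nc by (simp add: a_minus_def a_assoc l_neg)
  have "N w = k \<oplus> (Z (z \<ominus> N u) \<oplus> Z (N u))" using w(4) Z(2)[of "z \<ominus> N u" "N u"] zeq u w Nc by simp
  then have "N (w \<ominus> Z u) = k \<oplus> Z (z \<ominus> N u)"
    using Nk_diff[of w "Z u" 1] u w kc Zc Nc comm[of u] by (simp add: a_minus_def a_assoc r_neg)
  moreover have "k \<oplus> Z (z \<ominus> N u) \<in> K" using w ZK u by (intro K.a_closed) auto
  ultimately obtain y where y: "y \<in> carrier G" "w \<ominus> Z u \<ominus> (N ^^ (p - 1)) y \<in> K"
    using ex[of "w \<ominus> Z u"] w u Zc by auto
  have "w \<ominus> (N ^^ (p - 1)) y = (w \<ominus> Z u \<ominus> (N ^^ (p - 1)) y) \<oplus> Z u"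
    using w u y Zc[of u] Nkc[of y "p - 1"] by (simp add: a_minus_def a_assoc l_neg a_comm[of "\<ominus> Z u"])
  then show ?thesis using y u by blast
qed

section \<open>Matrices acting on free modules\<close>

text \<open>
  The additive group of the free module \<open>R^B\<close>. It is packed into a ring record, with unspecified multiplication,
  because the theory of additive groups is stated for such records.
\<close>

definition fun_group :: "('f, 'm) ring_scheme \<Rightarrow> 'b set \<Rightarrow> ('b \<Rightarrow> 'f) ring" where
  "fun_group R B = \<lparr>carrier = B \<rightarrow>\<^sub>E carrier R, monoid.mult = undefined, one = undefined,
     ring.zero = (\<lambda>b\<in>B. \<zero>\<^bsub>R\<^esub>), add = (\<lambda>x y. \<lambda>b\<in>B. x b \<oplus>\<^bsub>R\<^esub> y b)\<rparr>"

lemma fun_group_sel: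
  "carrier (fun_group R B) = B \<rightarrow>\<^sub>E carrier R"
  "\<zero>\<^bsub>fun_group R B\<^esub> = (\<lambda>b\<in>B. \<zero>\<^bsub>R\<^esub>)"
  "x \<oplus>\<^bsub>fun_group R B\<^esub> y = (\<lambda>b\<in>B. x b \<oplus>\<^bsub>R\<^esub> y b)"
  by (simp_all add: fun_group_def)

context ring begin

lemma fun_group: "abelian_group (fun_group R B)"
proof (rule abelian_groupI, unfold fun_group_sel)
  fix x assume x: "x \<in> B \<rightarrow>\<^sub>E carrier R"
  show "\<exists>y\<in>B \<rightarrow>\<^sub>E carrier R. (\<lambda>b\<in>B. y b \<oplus> x b) = (\<lambda>b\<in>B. \<zero>)"
    using x by (intro bexI[of _ "\<lambda>b\<in>B. \<ominus> x b"]) (auto intro!: restrict_ext l_neg)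
  show "(\<lambda>b\<in>B. (\<lambda>b\<in>B. \<zero>) b \<oplus> x b) = x"
    using x by (intro extensionalityI[of _ B]) (auto simp: PiE_iff)
  fix y assume y: "y \<in> B \<rightarrow>\<^sub>E carrier R"
  show "(\<lambda>b\<in>B. x b \<oplus> y b) = (\<lambda>b\<in>B. y b \<oplus> x b)"
    using x y by (intro restrict_ext a_comm) auto
  show "(\<lambda>b\<in>B. x b \<oplus> y b) \<in> B \<rightarrow>\<^sub>E carrier R" using x y by auto
  fix z assume z: "z \<in> B \<rightarrow>\<^sub>E carrier R"
  show "(\<lambda>b\<in>B. (\<lambda>b\<in>B. x b \<oplus> y b) b \<oplus> z b) = (\<lambda>b\<in>B. x b \<oplus> (\<lambda>b\<in>B. y b \<oplus> z b) b)"
    using x y z by (intro restrict_ext) (auto simp: PiE_iff intro!: a_assoc)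
qed auto

lemma fun_group_minus:
  assumes "x \<in> B \<rightarrow>\<^sub>E carrier R" "y \<in> B \<rightarrow>\<^sub>E carrier R"
  shows "x \<ominus>\<^bsub>fun_group R B\<^esub> y = (\<lambda>b\<in>B. x b \<ominus> y b)"
proof -
  interpret V: abelian_group "fun_group R B" by (rule fun_group)
  have "\<ominus>\<^bsub>fun_group R B\<^esub> y = (\<lambda>b\<in>B. \<ominus> y b)"
    by (rule V.minus_equality) (use assms in \<open>auto simp: fun_group_sel PiE_iff l_neg intro!: restrict_ext\<close>)
  then show ?thesis using assms by (auto simp: a_minus_def fun_group_sel intro!: restrict_ext)
qed

lemma fun_group_subgroup:
  assumes "ideal J R"
  shows "additive_subgroup (B \<rightarrow>\<^sub>E J) (fun_group R B)"
proof -
  interpret J: ideal J R by fact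
  interpret V: abelian_group "fun_group R B" by (rule fun_group)
  have minus: "\<ominus>\<^bsub>fun_group R B\<^esub> y = (\<lambda>b\<in>B. \<ominus> y b)" if "y \<in> B \<rightarrow>\<^sub>E carrier R" for y
    by (rule V.minus_equality) (use that in \<open>auto simp: fun_group_sel PiE_iff l_neg intro!: restrict_ext\<close>)
  have sub: "B \<rightarrow>\<^sub>E J \<subseteq> B \<rightarrow>\<^sub>E carrier R" using J.a_subset by (rule PiE_mono)
  show ?thesis
  proof (intro additive_subgroup.intro V.add.subgroupI)
    show "B \<rightarrow>\<^sub>E J \<subseteq> carrier (fun_group R B)" using sub by (simp add: fun_group_sel)
    have "(\<lambda>b\<in>B. \<zero>) \<in> B \<rightarrow>\<^sub>E J" by auto
    then show "B \<rightarrow>\<^sub>E J \<noteq> {}" by blast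
    fix x assume x: "x \<in> B \<rightarrow>\<^sub>E J"
    show "\<ominus>\<^bsub>fun_group R B\<^esub> x \<in> B \<rightarrow>\<^sub>E J" using minus[OF subsetD[OF sub x]] x by (auto simp: PiE_iff)
    fix y assume y: "y \<in> B \<rightarrow>\<^sub>E J"
    show "x \<oplus>\<^bsub>fun_group R B\<^esub> y \<in> B \<rightarrow>\<^sub>E J" using x y by (auto simp: fun_group_sel)
  qed
qed

end

context cring begin

lemma mat_op_closed:
  assumes "\<And>b b'. b \<in> B \<Longrightarrow> b' \<in> B \<Longrightarrow> T b' b \<in> carrier R" "x \<in> B \<rightarrow>\<^sub>E carrier R"
  shows "mat_op R B T x \<in> B \<rightarrow>\<^sub>E carrier R"
  using assms by (auto simp: mat_op_def intro!: finsum_closed)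

lemma mat_op_funpow_closed:
  assumes "\<And>b b'. b \<in> B \<Longrightarrow> b' \<in> B \<Longrightarrow> T b' b \<in> carrier R" "x \<in> B \<rightarrow>\<^sub>E carrier R"
  shows "(mat_op R B T ^^ i) x \<in> B \<rightarrow>\<^sub>E carrier R"
  using assms(2) by (induction i) (simp_all add: mat_op_closed assms(1))

lemma mat_op_add:
  assumes T: "\<And>b b'. b \<in> B \<Longrightarrow> b' \<in> B \<Longrightarrow> T b' b \<in> carrier R"
    and "x \<in> B \<rightarrow>\<^sub>E carrier R" "y \<in> B \<rightarrow>\<^sub>E carrier R"
  shows "mat_op R B T (\<lambda>b\<in>B. x b \<oplus> y b) = (\<lambda>b\<in>B. mat_op R B T x b \<oplus> mat_op R B T y b)"
proof -
  have "(\<Oplus>b\<in>B. T b' b \<otimes> (\<lambda>b\<in>B. x b \<oplus> y b) b) = (\<Oplus>b\<in>B. T b' b \<otimes> x b) \<oplus> (\<Oplus>b\<in>B. T b' b \<otimes> y b)"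
    if "b' \<in> B" for b'
  proof -
    have "(\<Oplus>b\<in>B. T b' b \<otimes> (\<lambda>b\<in>B. x b \<oplus> y b) b) = (\<Oplus>b\<in>B. T b' b \<otimes> x b \<oplus> T b' b \<otimes> y b)"
      using assms that by (intro finsum_cong') (auto simp: r_distr PiE_iff)
    then show ?thesis using assms that by (subst finsum_addf[symmetric]) (auto simp: PiE_iff)
  qed
  then show ?thesis by (auto simp: mat_op_def intro!: restrict_ext)
qed

lemma mat_op_smult:
  assumes T: "\<And>b b'. b \<in> B \<Longrightarrow> b' \<in> B \<Longrightarrow> T b' b \<in> carrier R" and B: "finite B"
    and "x \<in> B \<rightarrow>\<^sub>E carrier R" and c: "c \<in> carrier R"
  shows "mat_op R B T (\<lambda>b\<in>B. c \<otimes> x b) = (\<lambda>b\<in>B. c \<otimes> mat_op R B T x b)"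
proof -
  have "(\<Oplus>b\<in>B. T b' b \<otimes> (\<lambda>b\<in>B. c \<otimes> x b) b) = c \<otimes> (\<Oplus>b\<in>B. T b' b \<otimes> x b)"
    if "b' \<in> B" for b'
  proof -
    have "(\<Oplus>b\<in>B. T b' b \<otimes> (\<lambda>b\<in>B. c \<otimes> x b) b) = (\<Oplus>b\<in>B. c \<otimes> (T b' b \<otimes> x b))"
      using assms that by (intro finsum_cong') (auto simp: m_lcomm PiE_iff)
    then show ?thesis using assms that by (subst finsum_rdistr) (auto simp: PiE_iff)
  qed
  then show ?thesis by (auto simp: mat_op_def intro!: restrict_ext)
qed

lemma mat_op_ideal:
  assumes T: "\<And>b b'. b \<in> B \<Longrightarrow> b' \<in> B \<Longrightarrow> T b' b \<in> carrier R" and J: "ideal J R"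
    and x: "x \<in> B \<rightarrow>\<^sub>E J" and B: "finite B"
  shows "mat_op R B T x \<in> B \<rightarrow>\<^sub>E J"
proof -
  interpret J: ideal J R by fact
  have xc: "x b \<in> carrier R" if "b \<in> B" for b using x that J.a_Hcarr by (auto simp: PiE_iff)
  have "(\<Oplus>b\<in>C. T b' b \<otimes> x b) \<in> J" if "b' \<in> B" "C \<subseteq> B" for b' C
    using finite_subset[OF that(2) B] that
  proof (induction C)
    case (insert b C)
    then have "(\<Oplus>b\<in>insert b C. T b' b \<otimes> x b) = T b' b \<otimes> x b \<oplus> (\<Oplus>b\<in>C. T b' b \<otimes> x b)"
      using T xc by (intro finsum_insert) auto
    moreover have "T b' b \<otimes> x b \<in> J" using insert T x by (intro J.I_l_closed) auto
    ultimately show ?case using insert J.a_closed by auto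
  qed auto
  then show ?thesis by (auto simp: mat_op_def)
qed

lemma mat_op_zero:
  assumes T: "\<And>b b'. b \<in> B \<Longrightarrow> b' \<in> B \<Longrightarrow> T b' b \<in> carrier R"
  shows "mat_op R B T (\<lambda>b\<in>B. \<zero>) = (\<lambda>b\<in>B. \<zero>)"
proof -
  have "(\<Oplus>b\<in>B. T b' b \<otimes> (\<lambda>b\<in>B. \<zero>) b) = (\<Oplus>b\<in>B. \<zero>)" if "b' \<in> B" for b'
    using T that by (intro finsum_cong') auto
  then show ?thesis by (auto simp: mat_op_def intro!: restrict_ext)
qed

lemma mat_op_finsum:
  assumes T: "\<And>b b'. b \<in> B \<Longrightarrow> b' \<in> B \<Longrightarrow> T b' b \<in> carrier R" and B: "finite B"
    and I: "finite I" and c: "\<And>i. i \<in> I \<Longrightarrow> c i \<in> carrier R"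
    and w: "\<And>i. i \<in> I \<Longrightarrow> w i \<in> B \<rightarrow>\<^sub>E carrier R"
  shows "(mat_op R B T ^^ k) (\<lambda>b\<in>B. \<Oplus>i\<in>I. c i \<otimes> w i b) = (\<lambda>b\<in>B. \<Oplus>i\<in>I. c i \<otimes> (mat_op R B T ^^ k) (w i) b)"
proof -
  have one: "mat_op R B T (\<lambda>b\<in>B. \<Oplus>i\<in>I. c i \<otimes> w i b) = (\<lambda>b\<in>B. \<Oplus>i\<in>I. c i \<otimes> mat_op R B T (w i) b)"
    if w: "\<And>i. i \<in> I \<Longrightarrow> w i \<in> B \<rightarrow>\<^sub>E carrier R" for w
    using I c w
  proof (induction I)
    case empty
    then show ?case using mat_op_zero[of B T, OF T] by (simp add: restrict_def)
  next
    case (insert j I)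
    have wj: "w i b \<in> carrier R" if "i \<in> insert j I" "b \<in> B" for i b
      using insert.prems(2)[OF that(1)] that(2) by (auto simp: PiE_iff)
    have cj: "c i \<in> carrier R" if "i \<in> insert j I" for i using insert.prems that by auto
    have Nw: "mat_op R B T (w i) b \<in> carrier R" if "i \<in> insert j I" "b \<in> B" for i b
      using mat_op_closed[of B T, OF T insert.prems(2)[OF that(1)]] that(2) by (auto simp: PiE_iff)
    have e1: "(\<lambda>b\<in>B. \<Oplus>i\<in>insert j I. c i \<otimes> w i b) = (\<lambda>b\<in>B. (\<lambda>b\<in>B. c j \<otimes> w j b) b \<oplus> (\<lambda>b\<in>B. \<Oplus>i\<in>I. c i \<otimes> w i b) b)"
      using insert.hyps wj cj by (intro restrict_ext) (auto intro!: finsum_insert)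
    have "mat_op R B T (\<lambda>b\<in>B. \<Oplus>i\<in>insert j I. c i \<otimes> w i b) =
      (\<lambda>b\<in>B. mat_op R B T (\<lambda>b\<in>B. c j \<otimes> w j b) b \<oplus> mat_op R B T (\<lambda>b\<in>B. \<Oplus>i\<in>I. c i \<otimes> w i b) b)"
      unfolding e1 using wj cj by (intro mat_op_add[of B T, OF T]) (auto intro!: finsum_closed)
    also have "mat_op R B T (\<lambda>b\<in>B. c j \<otimes> w j b) = (\<lambda>b\<in>B. c j \<otimes> mat_op R B T (w j) b)"
      using insert.prems by (intro mat_op_smult[of B T, OF T B]) auto
    also have "mat_op R B T (\<lambda>b\<in>B. \<Oplus>i\<in>I. c i \<otimes> w i b) = (\<lambda>b\<in>B. \<Oplus>i\<in>I. c i \<otimes> mat_op R B T (w i) b)"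
      by (rule insert.IH) (use insert.prems in auto)
    also have "(\<lambda>b\<in>B. (\<lambda>b\<in>B. c j \<otimes> mat_op R B T (w j) b) b \<oplus> (\<lambda>b\<in>B. \<Oplus>i\<in>I. c i \<otimes> mat_op R B T (w i) b) b) =
      (\<lambda>b\<in>B. \<Oplus>i\<in>insert j I. c i \<otimes> mat_op R B T (w i) b)"
      using insert.hyps Nw cj by (intro restrict_ext) (auto intro!: finsum_insert[symmetric])
    finally show ?case .
  qed
  show ?thesis
  proof (induction k)
    case 0
    then show ?case by simp
  next
    case (Suc k)
    have "(mat_op R B T ^^ k) (w i) \<in> B \<rightarrow>\<^sub>E carrier R" if "i \<in> I" for i
      by (rule mat_op_funpow_closed[of B T, OF T w[OF that]])
    from one[OF this] show ?case by (simp only: funpow.simps comp_apply Suc.IH)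
  qed
qed

text \<open>
  A block of size \<open>l > p\<close> contradicts \<open>N^p = 0\<close>. In a block of size \<open>l < p\<close> the last vector \<open>N^(l-1) e\<close> is killed by \<open>N\<close>,
  hence of the form \<open>N^(p-1) y\<close>; but as all blocks have size at most \<open>p\<close>, the image of \<open>N^(p-1)\<close> is spanned by the last vectors
  of the blocks of size exactly \<open>p\<close>, and \<open>N^(l-1) e\<close> is not among these basis vectors.
\<close>

lemma jordan_blocks_uniform:
  fixes p :: nat
  assumes nontriv: "\<one> \<noteq> \<zero>" and T: "\<And>b b'. b \<in> B \<Longrightarrow> b' \<in> B \<Longrightarrow> T b' b \<in> carrier R" and B: "finite B"
    and p: "p \<ge> 1"
    and nil: "\<And>x. x \<in> B \<rightarrow>\<^sub>E carrier R \<Longrightarrow> (mat_op R B T ^^ p) x = (\<lambda>b\<in>B. \<zero>)"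
    and ex: "\<And>x. x \<in> B \<rightarrow>\<^sub>E carrier R \<Longrightarrow> mat_op R B T x = (\<lambda>b\<in>B. \<zero>) \<Longrightarrow>
      \<exists>y\<in>B \<rightarrow>\<^sub>E carrier R. x = (mat_op R B T ^^ (p - 1)) y"
    and jb: "jordan_blocks R B (mat_op R B T) ls" and l: "l \<in> set ls"
  shows "l = p"
proof -
  define N where "N = mat_op R B T"
  define I where "I = (SIGMA j:{..<length ls}. {..<ls ! j})"
  have jb': "0 \<notin> set ls \<and> (\<exists>es :: nat \<Rightarrow> _.
      (\<forall>j<length ls. es j \<in> B \<rightarrow>\<^sub>E carrier R \<and> (N ^^ (ls ! j)) (es j) = (\<lambda>b\<in>B. \<zero>)) \<and>
      (\<forall>x \<in> B \<rightarrow>\<^sub>E carrier R. \<exists>!c. c \<in> I \<rightarrow>\<^sub>E carrier R \<and>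
         x = (\<lambda>b\<in>B. \<Oplus>y\<in>I. c y \<otimes> (N ^^ snd y) (es (fst y)) b)))"
    using jb unfolding jordan_blocks_def N_def[symmetric] I_def[symmetric] .
  then have ls0: "0 \<notin> set ls" by (rule conjunct1)
  obtain es where es': "\<forall>j<length ls. es j \<in> B \<rightarrow>\<^sub>E carrier R \<and> (N ^^ (ls ! j)) (es j) = (\<lambda>b\<in>B. \<zero>)"
    and uni: "\<forall>x \<in> B \<rightarrow>\<^sub>E carrier R. \<exists>!c. c \<in> I \<rightarrow>\<^sub>E carrier R \<and>
         x = (\<lambda>b\<in>B. \<Oplus>y\<in>I. c y \<otimes> (N ^^ snd y) (es (fst y)) b)"
    using jb' by (elim conjE exE) (rule that)
  have es: "es j \<in> B \<rightarrow>\<^sub>E carrier R" "(N ^^ (ls ! j)) (es j) = (\<lambda>b\<in>B. \<zero>)" if "j < length ls" for j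
    using es'[rule_format, OF that] by (rule conjunct1, rule conjunct2)
  define vec where "vec y = (N ^^ snd y) (es (fst y))" for y :: "nat \<times> nat"
  define comb where "comb c = (\<lambda>b\<in>B. \<Oplus>y\<in>I. c y \<otimes> vec y b)" for c
  have uni': "\<exists>!c. c \<in> I \<rightarrow>\<^sub>E carrier R \<and> x = comb c" if "x \<in> B \<rightarrow>\<^sub>E carrier R" for x
    using bspec[OF uni that] unfolding comb_def vec_def .
  have finI: "finite I" by (auto simp: I_def)
  have Nk: "(N ^^ i) x \<in> B \<rightarrow>\<^sub>E carrier R" if "x \<in> B \<rightarrow>\<^sub>E carrier R" for x i
    using mat_op_funpow_closed[of B T, OF T that] by (simp add: N_def)
  have Nzero: "(N ^^ i) (\<lambda>b\<in>B. \<zero>) = (\<lambda>b\<in>B. \<zero>)" for i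
    by (induction i) (simp_all only: funpow.simps comp_apply id_apply N_def mat_op_zero[of B T, OF T])
  have vec: "vec y \<in> B \<rightarrow>\<^sub>E carrier R" if "y \<in> I" for y
    unfolding vec_def by (rule Nk, rule es) (use that in \<open>auto simp: I_def\<close>)
  have vecb: "vec y b \<in> carrier R" if "y \<in> I" "b \<in> B" for y b using vec[OF that(1)] that(2) by (auto simp: PiE_iff)
  have comb: "comb c \<in> B \<rightarrow>\<^sub>E carrier R" if "c \<in> I \<rightarrow>\<^sub>E carrier R" for c
    using that vecb by (auto simp: comb_def PiE_iff intro!: finsum_closed)
  have inj: "c = c'" if "c \<in> I \<rightarrow>\<^sub>E carrier R" "c' \<in> I \<rightarrow>\<^sub>E carrier R" "comb c = comb c'" for c c'
    using uni'[OF comb[OF that(1)]] that by blast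
  have surj: "\<exists>c\<in>I \<rightarrow>\<^sub>E carrier R. x = comb c" if "x \<in> B \<rightarrow>\<^sub>E carrier R" for x
    using uni'[OF that] by blast
  define delta where "delta i = (\<lambda>y\<in>I. if y = i then \<one> else \<zero>)" for i
  have delta: "delta i \<in> I \<rightarrow>\<^sub>E carrier R" for i by (auto simp: delta_def)
  have comb_delta: "comb (delta i) = vec i" if i: "i \<in> I" for i
  proof -
    have "(\<Oplus>y\<in>I. delta i y \<otimes> vec y b) = (\<Oplus>y\<in>I. if i = y then vec y b else \<zero>)" if "b \<in> B" for b
      using vecb that by (intro finsum_cong') (auto simp: delta_def)
    also have "\<dots> b = vec i b" if "b \<in> B" for b
      using finsum_singleton[OF i finI, of "\<lambda>y. vec y b"] vecb that by auto
    finally show ?thesis using vec[OF i] by (intro extensionalityI[of _ B]) (auto simp: comb_def PiE_iff)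
  qed
  define zeroc where "zeroc = (\<lambda>y\<in>I. \<zero>)"
  have zeroc: "zeroc \<in> I \<rightarrow>\<^sub>E carrier R" by (auto simp: zeroc_def)
  have comb_zero: "comb zeroc = (\<lambda>b\<in>B. \<zero>)"
  proof -
    have "(\<Oplus>y\<in>I. zeroc y \<otimes> vec y b) = (\<Oplus>y\<in>I. \<zero>)" if "b \<in> B" for b
      using vecb that by (intro finsum_cong') (auto simp: zeroc_def)
    then show ?thesis by (auto simp: comb_def intro!: restrict_ext)
  qed
  have vec_ne: "vec i \<noteq> comb c" if "i \<in> I" "c \<in> I \<rightarrow>\<^sub>E carrier R" "c i = \<zero>" for i c
  proof
    assume "vec i = comb c"
    then have "delta i = c" by (intro inj delta that) (simp add: comb_delta that)
    then have "c i = delta i i" by simp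
    also have "\<dots> = \<one>" using that(1) by (simp add: delta_def)
    finally have "c i = \<one>" .
    then show False using that nontriv by simp
  qed
  have le: "ls ! j \<le> p" if j: "j < length ls" for j
  proof (rule ccontr)
    assume "\<not> ls ! j \<le> p"
    then have "(j, p) \<in> I" using j by (auto simp: I_def)
    moreover have "vec (j, p) = (\<lambda>b\<in>B. \<zero>)" using nil es(1)[OF j] by (simp add: vec_def N_def)
    ultimately show False using vec_ne[OF _ zeroc] comb_zero by (auto simp: zeroc_def)
  qed
  obtain j where j: "j < length ls" "l = ls ! j" using l by (auto simp: in_set_conv_nth)
  show "l = p"
  proof (rule ccontr)
    assume neq: "l \<noteq> p"
    then have lp: "l < p" using le j by fastforce
    have l0: "l > 0" using l ls0 by (metis gr0I)
    define i0 where "i0 = (j, l - 1)"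
    have i0: "i0 \<in> I" using j l0 by (auto simp: i0_def I_def)
    have "N (vec i0) = (N ^^ Suc (l - 1)) (es j)" by (simp add: vec_def i0_def)
    then have "N (vec i0) = (\<lambda>b\<in>B. \<zero>)" using es(2)[OF j(1)] j(2) l0 by simp
    then obtain y where y: "y \<in> B \<rightarrow>\<^sub>E carrier R" "vec i0 = (N ^^ (p - 1)) y"
      using ex[OF vec[OF i0]] by (auto simp: N_def)
    obtain c where c: "c \<in> I \<rightarrow>\<^sub>E carrier R" "y = comb c" using surj[OF y(1)] by blast
    have cc: "c i \<in> carrier R" if "i \<in> I" for i using c that by (auto simp: PiE_iff)
    have img: "(N ^^ (p - 1)) y = (\<lambda>b\<in>B. \<Oplus>y\<in>I. c y \<otimes> (N ^^ (p - 1)) (vec y) b)"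
      unfolding c(2) comb_def N_def using cc vec finI by (intro mat_op_finsum[of B T, OF T B]) auto
    \<comment> \<open>Vectors without component along the last vector of the block; \<open>W\<close> turns out to contain the image of \<open>N^(p-1)\<close>.\<close>
    define W where "W = {comb c | c. c \<in> I \<rightarrow>\<^sub>E carrier R \<and> c i0 = \<zero>}"
    have W0: "(\<lambda>b\<in>B. \<zero>) \<in> W" using comb_zero zeroc i0 by (auto simp: W_def zeroc_def intro!: exI[of _ zeroc])
    have Wadd: "(\<lambda>b\<in>B. a \<otimes> x b \<oplus> x' b) \<in> W" if a: "a \<in> carrier R" and x: "x \<in> W" and x': "x' \<in> W" for a x x'
    proof -
      obtain d d' where d: "d \<in> I \<rightarrow>\<^sub>E carrier R" "d i0 = \<zero>" "x = comb d"
        and d': "d' \<in> I \<rightarrow>\<^sub>E carrier R" "d' i0 = \<zero>" "x' = comb d'" using x x' by (auto simp: W_def)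
      let ?e = "\<lambda>y\<in>I. a \<otimes> d y \<oplus> d' y"
      have dc: "d i \<in> carrier R" "d' i \<in> carrier R" if "i \<in> I" for i using d d' that by (auto simp: PiE_iff)
      have "a \<otimes> (\<Oplus>y\<in>I. d y \<otimes> vec y b) \<oplus> (\<Oplus>y\<in>I. d' y \<otimes> vec y b) = (\<Oplus>y\<in>I. ?e y \<otimes> vec y b)" if b: "b \<in> B" for b
      proof -
        have "(\<Oplus>y\<in>I. ?e y \<otimes> vec y b) = (\<Oplus>y\<in>I. a \<otimes> (d y \<otimes> vec y b) \<oplus> d' y \<otimes> vec y b)"
          using a dc vecb b by (intro finsum_cong') (auto simp: l_distr m_assoc)
        also have "\<dots> = (\<Oplus>y\<in>I. a \<otimes> (d y \<otimes> vec y b)) \<oplus> (\<Oplus>y\<in>I. d' y \<otimes> vec y b)"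
          using a dc vecb b by (intro finsum_addf) auto
        also have "(\<Oplus>y\<in>I. a \<otimes> (d y \<otimes> vec y b)) = a \<otimes> (\<Oplus>y\<in>I. d y \<otimes> vec y b)"
          using a dc vecb b finI by (intro finsum_rdistr[symmetric]) auto
        finally show ?thesis ..
      qed
      then have "(\<lambda>b\<in>B. a \<otimes> x b \<oplus> x' b) = comb ?e"
        unfolding d(3) d'(3) comb_def by (intro restrict_ext) auto
      moreover have "?e \<in> I \<rightarrow>\<^sub>E carrier R" "?e i0 = \<zero>" using dc a i0 d(2) d'(2) by auto
      ultimately show ?thesis unfolding W_def by blast
    qed
    have Wvec: "(N ^^ (p - 1)) (vec i) \<in> W" if i: "i \<in> I" for i
    proof -
      obtain j' k where jk: "i = (j', k)" "j' < length ls" "k < ls ! j'" using i by (auto simp: I_def)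
      have e: "(N ^^ (p - 1)) (vec i) = (N ^^ (p - 1 + k)) (es j')" by (simp add: vec_def jk funpow_add)
      show ?thesis
      proof (cases "k = 0 \<and> ls ! j' = p")
        case True
        then have ip: "(j', p - 1) \<in> I" using jk p by (auto simp: I_def)
        have "(N ^^ (p - 1)) (vec i) = comb (delta (j', p - 1))"
          unfolding e comb_delta[OF ip] using True by (simp add: vec_def)
        moreover have "delta (j', p - 1) i0 = \<zero>" using i0 lp l0 by (auto simp: delta_def i0_def)
        ultimately show ?thesis using delta unfolding W_def by blast
      next
        case False
        then have "ls ! j' \<le> p - 1 + k" using le[OF jk(2)] p by auto
        then have "(N ^^ (p - 1 + k)) (es j') = (N ^^ (p - 1 + k - ls ! j')) ((N ^^ (ls ! j')) (es j'))"
          by (simp flip: funpow_add[THEN fun_cong, unfolded comp_def])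
        also have "\<dots> = (\<lambda>b\<in>B. \<zero>)" unfolding es(2)[OF jk(2)] Nzero ..
        finally show ?thesis unfolding e using W0 by simp
      qed
    qed
    have Wb: "x b \<in> carrier R" if "x \<in> W" "b \<in> B" for x b
      using that comb by (auto simp: W_def PiE_iff)
    have "(\<lambda>b\<in>B. \<Oplus>y\<in>J. c y \<otimes> (N ^^ (p - 1)) (vec y) b) \<in> W" if "J \<subseteq> I" for J
      using finite_subset[OF that finI] that
    proof (induction J)
      case empty
      then show ?case by (simp only: finsum_empty W0)
    next
      case (insert i J)
      have sub: "i \<in> I" "J \<subseteq> I" using insert.prems by simp_all
      have "(\<Oplus>y\<in>insert i J. c y \<otimes> (N ^^ (p - 1)) (vec y) b) =
        c i \<otimes> (N ^^ (p - 1)) (vec i) b \<oplus> (\<Oplus>y\<in>J. c y \<otimes> (N ^^ (p - 1)) (vec y) b)" if "b \<in> B" for b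
        by (intro finsum_insert insert.hyps Pi_I m_closed cc Wb Wvec that subsetD[OF sub(2)] sub(1))
      then have "(\<lambda>b\<in>B. \<Oplus>y\<in>insert i J. c y \<otimes> (N ^^ (p - 1)) (vec y) b) =
        (\<lambda>b\<in>B. c i \<otimes> (N ^^ (p - 1)) (vec i) b \<oplus> (\<lambda>b\<in>B. \<Oplus>y\<in>J. c y \<otimes> (N ^^ (p - 1)) (vec y) b) b)"
        by (intro restrict_ext) simp
      also have "\<dots> \<in> W" by (intro Wadd cc Wvec sub insert.IH)
      finally show ?case .
    qed
    then have "vec i0 \<in> W" using img y(2) by simp
    then show False using vec_ne[OF i0] by (auto simp: W_def)
  qed
qed

end

section \<open>Passage to the residue field\<close>

lemma mat_op_hom:
  assumes "ring_hom_cring R S h" and T: "\<And>b b'. b \<in> B \<Longrightarrow> b' \<in> B \<Longrightarrow> T b' b \<in> carrier R"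
    and x: "x \<in> B \<rightarrow>\<^sub>E carrier R"
  shows "mat_op S B (\<lambda>b' b. h (T b' b)) (\<lambda>b\<in>B. h (x b)) = (\<lambda>b\<in>B. h (mat_op R B T x b))"
proof -
  interpret ring_hom_cring R S h by fact
  have xc: "x b \<in> carrier R" if "b \<in> B" for b using x that by (auto simp: PiE_iff)
  have "h (\<Oplus>\<^bsub>R\<^esub>b\<in>B. T b' b \<otimes>\<^bsub>R\<^esub> x b) = (\<Oplus>\<^bsub>S\<^esub>b\<in>B. h (T b' b) \<otimes>\<^bsub>S\<^esub> (\<lambda>b\<in>B. h (x b)) b)" if b': "b' \<in> B" for b'
  proof -
    have "h (\<Oplus>\<^bsub>R\<^esub>b\<in>B. T b' b \<otimes>\<^bsub>R\<^esub> x b) = (\<Oplus>\<^bsub>S\<^esub>b\<in>B. (h \<circ> (\<lambda>b. T b' b \<otimes>\<^bsub>R\<^esub> x b)) b)"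
      using T xc b' by (subst hom_finsum) (auto simp: comp_def)
    also have "\<dots> = (\<Oplus>\<^bsub>S\<^esub>b\<in>B. h (T b' b) \<otimes>\<^bsub>S\<^esub> (\<lambda>b\<in>B. h (x b)) b)"
      using T xc b' by (intro S.finsum_cong') auto
    finally show ?thesis .
  qed
  then show ?thesis by (auto simp: mat_op_def intro!: restrict_ext)
qed

lemma mat_op_funpow_hom:
  assumes h: "ring_hom_cring R S h" and T: "\<And>b b'. b \<in> B \<Longrightarrow> b' \<in> B \<Longrightarrow> T b' b \<in> carrier R"
    and x: "x \<in> B \<rightarrow>\<^sub>E carrier R"
  shows "(mat_op S B (\<lambda>b' b. h (T b' b)) ^^ k) (\<lambda>b\<in>B. h (x b)) = (\<lambda>b\<in>B. h ((mat_op R B T ^^ k) x b))"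
proof (induction k)
  case (Suc k)
  interpret ring_hom_cring R S h by fact
  have "(mat_op R B T ^^ k) x \<in> B \<rightarrow>\<^sub>E carrier R" by (rule R.mat_op_funpow_closed[of B T, OF T x])
  from mat_op_hom[OF h, of B T, OF T this] show ?case by (simp only: funpow.simps comp_apply Suc.IH)
qed simp

context cring begin

lemma adjoin_vector:
  assumes J: "ideal J R" and c: "c \<in> carrier R" and x: "x \<in> B \<rightarrow>\<^sub>E adjoin R J c"
  obtains k z where "k \<in> B \<rightarrow>\<^sub>E J" "z \<in> B \<rightarrow>\<^sub>E carrier R" "x = (\<lambda>b\<in>B. k b \<oplus> c \<otimes> z b)"
proof -
  interpret J: ideal J R by fact
  have "\<exists>k z. k \<in> J \<and> z \<in> carrier R \<and> x b = k \<oplus> c \<otimes> z" if "b \<in> B" for b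
  proof -
    have "x b \<in> adjoin R J c" using x that by (auto simp: PiE_iff)
    then obtain k z where "k \<in> J" "z \<in> carrier R" "x b = k \<oplus> z \<otimes> c" by (auto simp: adjoin_def)
    then show ?thesis using c by (intro exI[of _ k] exI[of _ z]) (auto simp: m_comm)
  qed
  then obtain k z where kz: "\<And>b. b \<in> B \<Longrightarrow> k b \<in> J \<and> z b \<in> carrier R \<and> x b = k b \<oplus> c \<otimes> z b" by metis
  have "x = (\<lambda>b\<in>B. restrict k B b \<oplus> c \<otimes> restrict z B b)"
    using x kz by (intro extensionalityI[of _ B]) (auto simp: PiE_iff)
  then show ?thesis by (intro that[of "restrict k B" "restrict z B"]) (use kz in auto)
qed

text \<open>The instance of \<open>p_exact_descends\<close> for \<open>R^B\<close>, its subgroup \<open>J^B\<close> and multiplication by \<open>c\<close>, a nonzerodivisor modulo the prime \<open>J\<close>.\<close>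

lemma p_exact_adjoin:
  fixes p :: nat
  assumes T: "\<And>b b'. b \<in> B \<Longrightarrow> b' \<in> B \<Longrightarrow> T b' b \<in> carrier R" and B: "finite B" and p: "p \<ge> 1"
    and nil: "\<And>x. x \<in> B \<rightarrow>\<^sub>E carrier R \<Longrightarrow> (mat_op R B T ^^ p) x = (\<lambda>b\<in>B. \<zero>)"
    and J: "primeideal J R" and c: "c \<in> carrier R - J"
    and ex: "\<And>x. x \<in> B \<rightarrow>\<^sub>E carrier R \<Longrightarrow> mat_op R B T x \<in> B \<rightarrow>\<^sub>E J \<Longrightarrow>
      \<exists>y\<in>B \<rightarrow>\<^sub>E carrier R. (\<lambda>b\<in>B. x b \<ominus> (mat_op R B T ^^ (p - 1)) y b) \<in> B \<rightarrow>\<^sub>E J"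
    and x: "x \<in> B \<rightarrow>\<^sub>E carrier R" "mat_op R B T x \<in> B \<rightarrow>\<^sub>E adjoin R J c"
  shows "\<exists>y\<in>B \<rightarrow>\<^sub>E carrier R. (\<lambda>b\<in>B. x b \<ominus> (mat_op R B T ^^ (p - 1)) y b) \<in> B \<rightarrow>\<^sub>E adjoin R J c"
proof -
  let ?V = "fun_group R B" and ?N = "mat_op R B T" and ?Z = "\<lambda>x. \<lambda>b\<in>B. c \<otimes> x b"
  interpret V: abelian_group ?V by (rule fun_group)
  interpret J: primeideal J R by fact
  have cc: "c \<in> carrier R" "c \<notin> J" using c by auto
  note sel = fun_group_sel
  have Nc: "?N x \<in> B \<rightarrow>\<^sub>E carrier R" if "x \<in> B \<rightarrow>\<^sub>E carrier R" for x
    by (rule mat_op_closed[of B T, OF T that])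
  have Nkc: "(?N ^^ i) x \<in> B \<rightarrow>\<^sub>E carrier R" if "x \<in> B \<rightarrow>\<^sub>E carrier R" for x i
    by (rule mat_op_funpow_closed[of B T, OF T that])
  obtain k z where kz: "k \<in> B \<rightarrow>\<^sub>E J" "z \<in> B \<rightarrow>\<^sub>E carrier R" "?N x = (\<lambda>b\<in>B. k b \<oplus> c \<otimes> z b)"
    using adjoin_vector[OF J.is_ideal cc(1) x(2)] .
  have "\<exists>y\<in>carrier ?V. \<exists>k'\<in>B \<rightarrow>\<^sub>E J. \<exists>z'\<in>carrier ?V. x \<ominus>\<^bsub>?V\<^esub> (?N ^^ (p - 1)) y = k' \<oplus>\<^bsub>?V\<^esub> ?Z z'"
  proof (rule V.p_exact_descends[where N = ?N and Z = ?Z and K = "B \<rightarrow>\<^sub>E J", OF _ _ _ _ _ p])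
    show "?N \<in> carrier ?V \<rightarrow> carrier ?V" using Nc by (auto simp only: sel)
    show "?N (x \<oplus>\<^bsub>?V\<^esub> y) = ?N x \<oplus>\<^bsub>?V\<^esub> ?N y" if "x \<in> carrier ?V" "y \<in> carrier ?V" for x y
      using mat_op_add[of B T, OF T] that by (simp only: sel)
    show "?Z \<in> carrier ?V \<rightarrow> carrier ?V" using cc by (auto simp: sel PiE_iff)
    show "?Z (x \<oplus>\<^bsub>?V\<^esub> y) = ?Z x \<oplus>\<^bsub>?V\<^esub> ?Z y" if "x \<in> carrier ?V" "y \<in> carrier ?V" for x y
      using cc that by (auto simp: sel PiE_iff r_distr intro!: restrict_ext)
    show "?N (?Z x) = ?Z (?N x)" if "x \<in> carrier ?V" for x
      using mat_op_smult[of B T, OF T B _ cc(1)] that by (simp only: sel)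
    show "(?N ^^ p) x = \<zero>\<^bsub>?V\<^esub>" if "x \<in> carrier ?V" for x
      using nil that by (simp only: sel)
    show "additive_subgroup (B \<rightarrow>\<^sub>E J) ?V" by (rule fun_group_subgroup[OF J.is_ideal])
    show "?N x \<in> B \<rightarrow>\<^sub>E J" if "x \<in> B \<rightarrow>\<^sub>E J" for x by (rule mat_op_ideal[of B T, OF T J.is_ideal that B])
    show "?Z x \<in> B \<rightarrow>\<^sub>E J" if "x \<in> B \<rightarrow>\<^sub>E J" for x
      using that cc J.I_l_closed by (auto simp: PiE_iff)
    show "z \<in> B \<rightarrow>\<^sub>E J" if "z \<in> carrier ?V" "?Z z \<in> B \<rightarrow>\<^sub>E J" for z
    proof (rule PiE_I)
      fix b assume b: "b \<in> B"
      have "z b \<in> carrier R" "c \<otimes> z b \<in> J" using that b by (auto simp: sel PiE_iff)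
      then show "z b \<in> J" using J.I_prime cc by blast
    qed (use that in \<open>auto simp: sel PiE_iff extensional_def\<close>)
    show "\<exists>y\<in>carrier ?V. x \<ominus>\<^bsub>?V\<^esub> (?N ^^ (p - 1)) y \<in> B \<rightarrow>\<^sub>E J" if x: "x \<in> carrier ?V" "?N x \<in> B \<rightarrow>\<^sub>E J" for x
    proof -
      have x': "x \<in> B \<rightarrow>\<^sub>E carrier R" using x by (simp only: sel)
      obtain y where "y \<in> B \<rightarrow>\<^sub>E carrier R" "(\<lambda>b\<in>B. x b \<ominus> (?N ^^ (p - 1)) y b) \<in> B \<rightarrow>\<^sub>E J"
        using ex[OF x' x(2)] by blast
      then show ?thesis using x' by (intro bexI[of _ y]) (simp_all only: sel fun_group_minus[OF x' Nkc])
    qed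
    show "?N x = k \<oplus>\<^bsub>?V\<^esub> ?Z z" unfolding kz(3) sel by (rule restrict_ext) simp
  qed (use x kz in \<open>simp_all only: sel\<close>)
  then obtain y k' z' where y: "y \<in> B \<rightarrow>\<^sub>E carrier R" and k': "k' \<in> B \<rightarrow>\<^sub>E J" and z': "z' \<in> B \<rightarrow>\<^sub>E carrier R"
    and eq: "x \<ominus>\<^bsub>?V\<^esub> (?N ^^ (p - 1)) y = k' \<oplus>\<^bsub>?V\<^esub> ?Z z'"
    unfolding sel(1) by (elim bexE)
  have "(\<lambda>b\<in>B. x b \<ominus> (?N ^^ (p - 1)) y b) = (\<lambda>b\<in>B. k' b \<oplus> z' b \<otimes> c)"
    unfolding fun_group_minus[OF x(1) Nkc[OF y], symmetric] eq sel
    using cc z' by (intro restrict_ext) (auto simp: PiE_iff m_comm)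
  also have "\<dots> \<in> B \<rightarrow>\<^sub>E adjoin R J c" using k' z' by (auto simp: PiE_iff adjoin_def)
  finally show ?thesis using y by blast
qed

end

text \<open>
  The condition \<open>Q J\<close> below says that \<open>ker N = im N^(p-1)\<close> modulo \<open>J\<close>. It holds for \<open>J = 0\<close> and is carried to the
  maximal ideal by \<open>p_exact_adjoin\<close>, along the prime ideals generated by suitable parameters.
\<close>

theorem p_exact_residue_field:
  fixes R (structure) and p :: nat
  defines "F \<equiv> residue_field R" and "h \<equiv> \<lambda>a. nonunits R +> a"
  assumes reg: "regular_local_ring R"
    and T: "\<And>b b'. b \<in> B \<Longrightarrow> b' \<in> B \<Longrightarrow> T b' b \<in> carrier R" and B: "finite B" and p: "p \<ge> 1"
    and nil: "\<And>x. x \<in> B \<rightarrow>\<^sub>E carrier R \<Longrightarrow> (mat_op R B T ^^ p) x = (\<lambda>b\<in>B. \<zero>)"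
    and ex: "\<And>x. x \<in> B \<rightarrow>\<^sub>E carrier R \<Longrightarrow> mat_op R B T x = (\<lambda>b\<in>B. \<zero>) \<Longrightarrow>
      \<exists>y\<in>B \<rightarrow>\<^sub>E carrier R. x = (mat_op R B T ^^ (p - 1)) y"
    and jb: "jordan_blocks F B (mat_op F B (\<lambda>b' b. h (T b' b))) ls" and l: "l \<in> set ls"
  shows "l = p"
proof -
  obtain Y where "cring R" and noeth: "noetherian_ring R"
    and Y: "Y \<subseteq> carrier R" "genideal R Y = nonunits R"
    using reg by (auto simp: regular_local_ring_def is_local_ring_def krull_dim_eq_def)
  interpret noetherian_cring R by (intro noetherian_cring.intro noeth) fact
  have m: "ideal (nonunits R) R" using genideal_ideal[OF Y(1)] Y(2) by simp
  interpret m: ideal "nonunits R" R by (rule m)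
  define Q where "Q J \<longleftrightarrow> (\<forall>x\<in>B \<rightarrow>\<^sub>E carrier R. mat_op R B T x \<in> B \<rightarrow>\<^sub>E J \<longrightarrow>
    (\<exists>y\<in>B \<rightarrow>\<^sub>E carrier R. (\<lambda>b\<in>B. x b \<ominus> (mat_op R B T ^^ (p - 1)) y b) \<in> B \<rightarrow>\<^sub>E J))" for J
  have Nkc: "(mat_op R B T ^^ i) x \<in> B \<rightarrow>\<^sub>E carrier R" if "x \<in> B \<rightarrow>\<^sub>E carrier R" for x i
    by (rule mat_op_funpow_closed[of B T, OF T that])
  have "Q (nonunits R)"
  proof (rule regular_local_ring_induct[OF reg])
    show "Q {\<zero>}" unfolding Q_def
    proof (intro ballI impI)
      fix x assume x: "x \<in> B \<rightarrow>\<^sub>E carrier R" and "mat_op R B T x \<in> B \<rightarrow>\<^sub>E {\<zero>}"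
      then have "mat_op R B T x = (\<lambda>b\<in>B. \<zero>)" by (intro extensionalityI[of _ B]) (auto simp: PiE_iff)
      then obtain y where y: "y \<in> B \<rightarrow>\<^sub>E carrier R" "x = (mat_op R B T ^^ (p - 1)) y" using ex[OF x] by blast
      have "(\<lambda>b\<in>B. x b \<ominus> (mat_op R B T ^^ (p - 1)) y b) \<in> B \<rightarrow>\<^sub>E {\<zero>}"
        unfolding y(2)[symmetric] using x by (auto simp: PiE_iff r_neg a_minus_def)
      then show "\<exists>y\<in>B \<rightarrow>\<^sub>E carrier R. (\<lambda>b\<in>B. x b \<ominus> (mat_op R B T ^^ (p - 1)) y b) \<in> B \<rightarrow>\<^sub>E {\<zero>}"
        using y(1) by blast
    qed
    show "Q (adjoin R J c)" if "primeideal J R" "c \<in> carrier R - J" "Q J" for J c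
      unfolding Q_def
    proof (intro ballI impI p_exact_adjoin[of B T, OF T B p nil that(1,2)])
    qed (use that(3) in \<open>auto simp only: Q_def\<close>)
  qed
  interpret hh: ring_hom_cring R F h
    unfolding F_def h_def residue_field_def by (rule m.rcos_ring_hom_cring[OF is_cring])
  have carF: "carrier F = h ` carrier R"
    by (auto simp: F_def h_def residue_field_def FactRing_def A_RCOSETS_def')
  have h0: "h a = \<zero>\<^bsub>F\<^esub> \<longleftrightarrow> a \<in> nonunits R" if "a \<in> carrier R" for a
    using m.a_rcos_const m.a_rcos_self[OF that] by (auto simp: F_def h_def residue_field_def FactRing_def)
  let ?N = "mat_op R B T" and ?M = "mat_op F B (\<lambda>b' b. h (T b' b))"
  have lift: "\<exists>x\<in>B \<rightarrow>\<^sub>E carrier R. x' = (\<lambda>b\<in>B. h (x b))" if "x' \<in> B \<rightarrow>\<^sub>E carrier F" for x'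
  proof -
    have "\<exists>a. a \<in> carrier R \<and> x' b = h a" if "b \<in> B" for b
      using \<open>x' \<in> _\<close> that by (auto simp: PiE_iff carF)
    then obtain x where x: "\<And>b. b \<in> B \<Longrightarrow> x b \<in> carrier R \<and> x' b = h (x b)" by metis
    have "x' = (\<lambda>b\<in>B. h (restrict x B b))" using that x by (intro extensionalityI[of _ B]) (auto simp: PiE_iff)
    then show ?thesis using x by (intro bexI[of _ "restrict x B"]) auto
  qed
  have hom: "(?M ^^ k) (\<lambda>b\<in>B. h (x b)) = (\<lambda>b\<in>B. h ((?N ^^ k) x b))" if "x \<in> B \<rightarrow>\<^sub>E carrier R" for x k
    by (rule mat_op_funpow_hom[OF hh.ring_hom_cring_axioms, of B T, OF T that])
  show ?thesis
  proof (rule hh.S.jordan_blocks_uniform[of B "\<lambda>b' b. h (T b' b)", OF _ _ B p _ _ jb l])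
    have "\<one> \<notin> nonunits R" by (simp add: nonunits_def)
    then show "\<one>\<^bsub>F\<^esub> \<noteq> \<zero>\<^bsub>F\<^esub>" using h0[of \<one>] by simp
    show "h (T b' b) \<in> carrier F" if "b \<in> B" "b' \<in> B" for b b' using T that by simp
    show "(?M ^^ p) x' = (\<lambda>b\<in>B. \<zero>\<^bsub>F\<^esub>)" if x': "x' \<in> B \<rightarrow>\<^sub>E carrier F" for x'
    proof -
      obtain x where x: "x \<in> B \<rightarrow>\<^sub>E carrier R" "x' = (\<lambda>b\<in>B. h (x b))" using lift[OF x'] by blast
      have "(?M ^^ p) x' = (\<lambda>b\<in>B. h ((\<lambda>b\<in>B. \<zero>) b))" unfolding x(2) hom[OF x(1)] nil[OF x(1)] ..
      also have "\<dots> = (\<lambda>b\<in>B. \<zero>\<^bsub>F\<^esub>)" by (intro restrict_ext) simp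
      finally show ?thesis .
    qed
    show "\<exists>y'\<in>B \<rightarrow>\<^sub>E carrier F. x' = (?M ^^ (p - 1)) y'"
      if x': "x' \<in> B \<rightarrow>\<^sub>E carrier F" and ker: "?M x' = (\<lambda>b\<in>B. \<zero>\<^bsub>F\<^esub>)" for x'
    proof -
      obtain x where x: "x \<in> B \<rightarrow>\<^sub>E carrier R" "x' = (\<lambda>b\<in>B. h (x b))" using lift[OF x'] by blast
      have Nx: "?N x \<in> B \<rightarrow>\<^sub>E carrier R" by (rule mat_op_closed[of B T, OF T x(1)])
      have "h (?N x b) = \<zero>\<^bsub>F\<^esub>" if "b \<in> B" for b
        using fun_cong[OF ker[unfolded x(2) hom[OF x(1), of 1, simplified]], of b] that by simp
      then have "?N x \<in> B \<rightarrow>\<^sub>E nonunits R" using Nx h0 by (auto simp: PiE_iff)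
      from \<open>Q (nonunits R)\<close>[unfolded Q_def, rule_format, OF x(1) this]
      obtain y where y: "y \<in> B \<rightarrow>\<^sub>E carrier R" "(\<lambda>b\<in>B. x b \<ominus> (?N ^^ (p - 1)) y b) \<in> B \<rightarrow>\<^sub>E nonunits R"
        by (elim bexE)
      have "h (x b) = h ((?N ^^ (p - 1)) y b)" if b: "b \<in> B" for b
      proof -
        have car: "x b \<in> carrier R" "(?N ^^ (p - 1)) y b \<in> carrier R"
          using x(1) Nkc[OF y(1)] b by (auto simp: PiE_iff)
        have "x b \<ominus> (?N ^^ (p - 1)) y b \<in> nonunits R" using y(2) b by (auto simp: PiE_iff)
        then have "h (x b) \<ominus>\<^bsub>F\<^esub> h ((?N ^^ (p - 1)) y b) = \<zero>\<^bsub>F\<^esub>"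
          using h0[of "x b \<ominus> (?N ^^ (p - 1)) y b"] car by (simp add: a_minus_def)
        then show ?thesis using car by simp
      qed
      then have "x' = (?M ^^ (p - 1)) (\<lambda>b\<in>B. h (y b))"
        unfolding x(2) hom[OF y(1)] by (intro restrict_ext) auto
      moreover have "(\<lambda>b\<in>B. h (y b)) \<in> B \<rightarrow>\<^sub>E carrier F" using y(1) by (auto simp: PiE_iff)
      ultimately show ?thesis by blast
    qed
  qed
qed

section \<open>Homogeneous localization\<close>

lemma (in ring) minus_zero_iff:
  assumes "x \<in> carrier R" "y \<in> carrier R" shows "x \<ominus> y = \<zero> \<longleftrightarrow> x = y"
  using assms by (metis a_minus_def r_neg r_right_minus_eq)

locale graded_cring = cring A for A (structure) +
  fixes gr :: "nat \<Rightarrow> 'a set"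
  assumes gr_carrier: "a \<in> gr n \<Longrightarrow> a \<in> carrier A"
    and gr_zero: "\<zero> \<in> gr n" and gr_one: "\<one> \<in> gr 0"
    and gr_add: "a \<in> gr n \<Longrightarrow> b \<in> gr n \<Longrightarrow> a \<oplus> b \<in> gr n"
    and gr_neg: "a \<in> gr n \<Longrightarrow> \<ominus> a \<in> gr n"
    and gr_mult: "a \<in> gr m \<Longrightarrow> b \<in> gr n \<Longrightarrow> a \<otimes> b \<in> gr (m + n)"

locale graded_prime = graded_cring + prime: primeideal v A for v
begin

abbreviation "D \<equiv> denoms gr v"
abbreviation "hfr \<equiv> hfrac A gr v"
abbreviation "H \<equiv> hloc A gr v"

lemma D_carrier: "s \<in> D \<Longrightarrow> s \<in> carrier A" by (auto simp: denoms_def gr_carrier)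

lemma one_notin: "\<one> \<notin> v" using prime.I_notcarr prime.one_imp_carrier by blast

lemma one_D: "\<one> \<in> D" using gr_one one_notin by (auto simp: denoms_def)

lemma mult_D: "s \<in> D \<Longrightarrow> t \<in> D \<Longrightarrow> s \<otimes> t \<in> D"
  using gr_mult[of s _ t] prime.I_prime[of s t] gr_carrier by (auto simp: denoms_def; blast)

lemma gr_D: "s \<in> gr d \<Longrightarrow> s \<notin> v \<Longrightarrow> s \<in> D" by (auto simp: denoms_def)

lemma frac_mem:
  assumes "a \<in> carrier A" "s \<in> D"
  shows "(b, t) \<in> hfr a s \<longleftrightarrow> b \<in> carrier A \<and> t \<in> D \<and> (\<exists>u\<in>D. u \<otimes> (a \<otimes> t) = u \<otimes> (b \<otimes> s))"
proof -
  have "u \<otimes> (a \<otimes> t \<ominus> b \<otimes> s) = \<zero> \<longleftrightarrow> u \<otimes> (a \<otimes> t) = u \<otimes> (b \<otimes> s)" if "b \<in> carrier A" "t \<in> D" "u \<in> D" for u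
  proof -
    have "u \<otimes> (a \<otimes> t \<ominus> b \<otimes> s) = u \<otimes> (a \<otimes> t) \<ominus> u \<otimes> (b \<otimes> s)"
      using assms that D_carrier[of s] D_carrier[of t] D_carrier[of u] by algebra
    then show ?thesis using assms that D_carrier minus_zero_iff by simp
  qed
  then show ?thesis by (auto simp: hfrac_def)
qed

lemma frac_self: "a \<in> carrier A \<Longrightarrow> s \<in> D \<Longrightarrow> (a, s) \<in> hfr a s"
  using one_D by (auto simp: frac_mem)

lemma frac_eq:
  assumes "a \<in> carrier A" "s \<in> D" "b \<in> carrier A" "t \<in> D"
  shows "hfr a s = hfr b t \<longleftrightarrow> (\<exists>u\<in>D. u \<otimes> (a \<otimes> t) = u \<otimes> (b \<otimes> s))"
proof
  assume "hfr a s = hfr b t"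
  then have "(b, t) \<in> hfr a s" using frac_self[OF assms(3,4)] by simp
  then show "\<exists>u\<in>D. u \<otimes> (a \<otimes> t) = u \<otimes> (b \<otimes> s)" using assms by (simp add: frac_mem)
next
  have sub: "hfr a s \<subseteq> hfr b t"
    if as: "a \<in> carrier A" "s \<in> D" "b \<in> carrier A" "t \<in> D" and u: "u \<in> D" "u \<otimes> (a \<otimes> t) = u \<otimes> (b \<otimes> s)" for a s b t u
  proof (rule subrelI)
    fix c w assume "(c, w) \<in> hfr a s"
    then obtain u' where c: "c \<in> carrier A" and w: "w \<in> D" and u': "u' \<in> D" "u' \<otimes> (a \<otimes> w) = u' \<otimes> (c \<otimes> s)"
      using as by (auto simp: frac_mem)
    note car = D_carrier[OF as(2)] D_carrier[OF as(4)] D_carrier[OF w] D_carrier[OF u(1)] D_carrier[OF u'(1)] as(1,3) c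
    have "(u \<otimes> u' \<otimes> s) \<otimes> (b \<otimes> w) = (u' \<otimes> w) \<otimes> (u \<otimes> (b \<otimes> s))" using car by algebra
    also have "\<dots> = (u \<otimes> t) \<otimes> (u' \<otimes> (a \<otimes> w))" unfolding u(2)[symmetric] using car by algebra
    also have "\<dots> = (u \<otimes> u' \<otimes> s) \<otimes> (c \<otimes> t)" unfolding u'(2) using car by algebra
    finally show "(c, w) \<in> hfr b t" using as c w u u' by (auto simp: frac_mem intro!: bexI[of _ "u \<otimes> u' \<otimes> s"] mult_D)
  qed
  assume "\<exists>u\<in>D. u \<otimes> (a \<otimes> t) = u \<otimes> (b \<otimes> s)"
  then obtain u where u: "u \<in> D" "u \<otimes> (a \<otimes> t) = u \<otimes> (b \<otimes> s)" by blast
  show "hfr a s = hfr b t" using sub[OF assms u] sub[OF assms(3,4,1,2) u(1) u(2)[symmetric]] by (rule equalityI)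
qed

lemma frac_eqI:
  assumes "a \<in> carrier A" "s \<in> D" "b \<in> carrier A" "t \<in> D" "a \<otimes> t = b \<otimes> s"
  shows "hfr a s = hfr b t"
  using assms one_D by (auto simp: frac_eq)

lemma frac_Union:
  assumes "\<And>b t. (b, t) \<in> hfr a s \<Longrightarrow> f b t = x" "a \<in> carrier A" "s \<in> D"
  shows "(\<Union>(b, t)\<in>hfr a s. f b t) = x"
  using assms(1) frac_self[OF assms(2,3)] by (auto; blast)

lemma frac_mult:
  assumes "a \<in> carrier A" "s \<in> D" "b \<in> carrier A" "t \<in> D"
  shows "hfr a s \<otimes>\<^bsub>H\<^esub> hfr b t = hfr (a \<otimes> b) (s \<otimes> t)"
proof -
  have "hfr (a' \<otimes> b') (s' \<otimes> t') = hfr (a \<otimes> b) (s \<otimes> t)" if "(a', s') \<in> hfr a s" "(b', t') \<in> hfr b t" for a' s' b' t'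
  proof -
    from that assms obtain u w where u: "a' \<in> carrier A" "s' \<in> D" "u \<in> D" "u \<otimes> (a \<otimes> s') = u \<otimes> (a' \<otimes> s)"
      and w: "b' \<in> carrier A" "t' \<in> D" "w \<in> D" "w \<otimes> (b \<otimes> t') = w \<otimes> (b' \<otimes> t)" by (auto simp: frac_mem)
    note car = D_carrier[OF assms(2)] D_carrier[OF assms(4)] D_carrier[OF u(2)] D_carrier[OF u(3)] D_carrier[OF w(2)] D_carrier[OF w(3)]
      assms(1,3) u(1) w(1)
    have "(u \<otimes> w) \<otimes> ((a' \<otimes> b') \<otimes> (s \<otimes> t)) = (u \<otimes> (a' \<otimes> s)) \<otimes> (w \<otimes> (b' \<otimes> t))" using car by algebra
    also have "\<dots> = (u \<otimes> w) \<otimes> ((a \<otimes> b) \<otimes> (s' \<otimes> t'))" unfolding u(4)[symmetric] w(4)[symmetric] using car by algebra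
    finally show ?thesis using assms u w mult_D by (subst frac_eq) auto
  qed
  then have "(\<Union>(a', s')\<in>hfr a s. \<Union>(b', t')\<in>hfr b t. hfr (a' \<otimes> b') (s' \<otimes> t')) = hfr (a \<otimes> b) (s \<otimes> t)"
    by (intro frac_Union assms)
  then show ?thesis by (simp add: hloc_def)
qed

lemma frac_add:
  assumes "a \<in> carrier A" "s \<in> D" "b \<in> carrier A" "t \<in> D"
  shows "hfr a s \<oplus>\<^bsub>H\<^esub> hfr b t = hfr (a \<otimes> t \<oplus> b \<otimes> s) (s \<otimes> t)"
proof -
  have "hfr (a' \<otimes> t' \<oplus> b' \<otimes> s') (s' \<otimes> t') = hfr (a \<otimes> t \<oplus> b \<otimes> s) (s \<otimes> t)"
    if "(a', s') \<in> hfr a s" "(b', t') \<in> hfr b t" for a' s' b' t'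
  proof -
    from that assms obtain u w where u: "a' \<in> carrier A" "s' \<in> D" "u \<in> D" "u \<otimes> (a \<otimes> s') = u \<otimes> (a' \<otimes> s)"
      and w: "b' \<in> carrier A" "t' \<in> D" "w \<in> D" "w \<otimes> (b \<otimes> t') = w \<otimes> (b' \<otimes> t)" by (auto simp: frac_mem)
    note car = D_carrier[OF assms(2)] D_carrier[OF assms(4)] D_carrier[OF u(2)] D_carrier[OF u(3)] D_carrier[OF w(2)] D_carrier[OF w(3)]
      assms(1,3) u(1) w(1)
    have "(u \<otimes> w) \<otimes> ((a' \<otimes> t' \<oplus> b' \<otimes> s') \<otimes> (s \<otimes> t)) =
      w \<otimes> t \<otimes> t' \<otimes> (u \<otimes> (a' \<otimes> s)) \<oplus> u \<otimes> s \<otimes> s' \<otimes> (w \<otimes> (b' \<otimes> t))" using car by algebra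
    also have "\<dots> = (u \<otimes> w) \<otimes> ((a \<otimes> t \<oplus> b \<otimes> s) \<otimes> (s' \<otimes> t'))" unfolding u(4)[symmetric] w(4)[symmetric] using car by algebra
    finally show ?thesis using assms u w mult_D D_carrier by (subst frac_eq) auto
  qed
  then have "(\<Union>(a', s')\<in>hfr a s. \<Union>(b', t')\<in>hfr b t. hfr (a' \<otimes> t' \<oplus> b' \<otimes> s') (s' \<otimes> t')) = hfr (a \<otimes> t \<oplus> b \<otimes> s) (s \<otimes> t)"
    by (intro frac_Union assms)
  then show ?thesis by (simp add: hloc_def)
qed

lemma H_carrier: "x \<in> carrier H \<longleftrightarrow> (\<exists>a s. x = hfr a s \<and> a \<in> carrier A \<and> s \<in> D)"
  by (auto simp: hloc_def)

lemma H_one: "\<one>\<^bsub>H\<^esub> = hfr \<one> \<one>" and H_zero: "\<zero>\<^bsub>H\<^esub> = hfr \<zero> \<one>"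
  by (auto simp: hloc_def)

lemma H_cases:
  assumes "x \<in> carrier H" obtains a s where "x = hfr a s" "a \<in> carrier A" "s \<in> D"
  using assms H_carrier by blast

lemma frac_in_H: "a \<in> carrier A \<Longrightarrow> s \<in> D \<Longrightarrow> hfr a s \<in> carrier H"
  using H_carrier by blast

lemma H_cring: "cring H"
proof (rule cringI)
  show "abelian_group H"
  proof (rule abelian_groupI)
    show "\<zero>\<^bsub>H\<^esub> \<in> carrier H" unfolding H_zero by (intro frac_in_H one_D) simp
    fix x assume "x \<in> carrier H"
    then obtain a s where x: "x = hfr a s" "a \<in> carrier A" "s \<in> D" by (rule H_cases)
    note sc = D_carrier[OF x(3)]
    show "\<zero>\<^bsub>H\<^esub> \<oplus>\<^bsub>H\<^esub> x = x"
      unfolding H_zero x(1) using x sc by (subst frac_add) (auto simp: one_D)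
    have "hfr (\<ominus> a) s \<oplus>\<^bsub>H\<^esub> x = \<zero>\<^bsub>H\<^esub>"
    proof -
      have "(\<ominus> a \<otimes> s \<oplus> a \<otimes> s) \<otimes> \<one> = \<zero> \<otimes> (s \<otimes> s)" using x sc by algebra
      then show ?thesis unfolding H_zero x(1) using x sc
        by (subst frac_add; (intro frac_eqI)?) (simp_all add: one_D mult_D)
    qed
    then show "\<exists>y\<in>carrier H. y \<oplus>\<^bsub>H\<^esub> x = \<zero>\<^bsub>H\<^esub>" using x by (intro bexI[of _ "hfr (\<ominus> a) s"] frac_in_H) auto
    fix y assume "y \<in> carrier H"
    then obtain b t where y: "y = hfr b t" "b \<in> carrier A" "t \<in> D" by (rule H_cases)
    note tc = D_carrier[OF y(3)]
    show "x \<oplus>\<^bsub>H\<^esub> y \<in> carrier H" unfolding x(1) y(1) using x y sc tc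
      by (subst frac_add) (auto intro!: frac_in_H mult_D)
    show "x \<oplus>\<^bsub>H\<^esub> y = y \<oplus>\<^bsub>H\<^esub> x"
      unfolding x(1) y(1) frac_add[OF x(2,3) y(2,3)] frac_add[OF y(2,3) x(2,3)]
      using x y sc tc by (simp add: m_comm a_comm)
    fix z assume "z \<in> carrier H"
    then obtain c w where z: "z = hfr c w" "c \<in> carrier A" "w \<in> D" by (rule H_cases)
    note wc = D_carrier[OF z(3)]
    have "((a \<otimes> t \<oplus> b \<otimes> s) \<otimes> w \<oplus> c \<otimes> (s \<otimes> t)) = (a \<otimes> (t \<otimes> w) \<oplus> (b \<otimes> w \<oplus> c \<otimes> t) \<otimes> s)"
      using x(2) y(2) z(2) sc tc wc by algebra
    then show "x \<oplus>\<^bsub>H\<^esub> y \<oplus>\<^bsub>H\<^esub> z = x \<oplus>\<^bsub>H\<^esub> (y \<oplus>\<^bsub>H\<^esub> z)"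
      unfolding x(1) y(1) z(1) using x(2,3) y(2,3) z(2,3) sc tc wc by (simp add: frac_add mult_D m_assoc)
  qed
  show "comm_monoid H"
  proof (rule comm_monoidI)
    show "\<one>\<^bsub>H\<^esub> \<in> carrier H" unfolding H_one by (intro frac_in_H one_D) simp
    fix x assume "x \<in> carrier H"
    then obtain a s where x: "x = hfr a s" "a \<in> carrier A" "s \<in> D" by (rule H_cases)
    note sc = D_carrier[OF x(3)]
    show "\<one>\<^bsub>H\<^esub> \<otimes>\<^bsub>H\<^esub> x = x" unfolding H_one x(1) using x sc by (subst frac_mult) (auto simp: one_D)
    fix y assume "y \<in> carrier H"
    then obtain b t where y: "y = hfr b t" "b \<in> carrier A" "t \<in> D" by (rule H_cases)
    note tc = D_carrier[OF y(3)]
    show "x \<otimes>\<^bsub>H\<^esub> y \<in> carrier H" unfolding x(1) y(1) using x y by (subst frac_mult) (auto intro!: frac_in_H mult_D)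
    show "x \<otimes>\<^bsub>H\<^esub> y = y \<otimes>\<^bsub>H\<^esub> x"
      unfolding x(1) y(1) frac_mult[OF x(2,3) y(2,3)] frac_mult[OF y(2,3) x(2,3)] using x y sc tc by (simp add: m_comm)
    fix z assume "z \<in> carrier H"
    then obtain c w where z: "z = hfr c w" "c \<in> carrier A" "w \<in> D" by (rule H_cases)
    show "x \<otimes>\<^bsub>H\<^esub> y \<otimes>\<^bsub>H\<^esub> z = x \<otimes>\<^bsub>H\<^esub> (y \<otimes>\<^bsub>H\<^esub> z)"
      unfolding x(1) y(1) z(1) using x(2,3) y(2,3) z(2,3) D_carrier by (simp add: frac_mult mult_D m_assoc)
  qed
  fix x y z assume "x \<in> carrier H" "y \<in> carrier H" "z \<in> carrier H"
  then obtain a s b t c w where x: "x = hfr a s" "a \<in> carrier A" "s \<in> D" and y: "y = hfr b t" "b \<in> carrier A" "t \<in> D"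
    and z: "z = hfr c w" "c \<in> carrier A" "w \<in> D" by (metis H_cases)
  note sc = D_carrier[OF x(3)] and tc = D_carrier[OF y(3)] and wc = D_carrier[OF z(3)]
  have "((a \<otimes> t \<oplus> b \<otimes> s) \<otimes> c) \<otimes> ((s \<otimes> w) \<otimes> (t \<otimes> w)) = ((a \<otimes> c) \<otimes> (t \<otimes> w) \<oplus> (b \<otimes> c) \<otimes> (s \<otimes> w)) \<otimes> ((s \<otimes> t) \<otimes> w)"
    using x(2) y(2) z(2) sc tc wc by algebra
  then show "(x \<oplus>\<^bsub>H\<^esub> y) \<otimes>\<^bsub>H\<^esub> z = x \<otimes>\<^bsub>H\<^esub> z \<oplus>\<^bsub>H\<^esub> y \<otimes>\<^bsub>H\<^esub> z"
    unfolding x(1) y(1) z(1) using x(2,3) y(2,3) z(2,3) sc tc wc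
    by (simp add: frac_add frac_mult mult_D) (intro frac_eqI; simp add: mult_D)
qed

sublocale H: cring H by (rule H_cring)

lemma frac_neg:
  assumes "a \<in> carrier A" "s \<in> D"
  shows "\<ominus>\<^bsub>H\<^esub> hfr a s = hfr (\<ominus> a) s"
proof (rule H.minus_equality)
  have "(\<ominus> a \<otimes> s \<oplus> a \<otimes> s) \<otimes> \<one> = \<zero> \<otimes> (s \<otimes> s)" using assms D_carrier[OF assms(2)] by algebra
  then show "hfr (\<ominus> a) s \<oplus>\<^bsub>H\<^esub> hfr a s = \<zero>\<^bsub>H\<^esub>"
    unfolding H_zero using assms D_carrier[OF assms(2)]
    by (subst frac_add; (intro frac_eqI)?) (simp_all add: one_D mult_D)
qed (use assms frac_in_H in auto)

lemma frac_zero: "s \<in> D \<Longrightarrow> hfr \<zero> s = \<zero>\<^bsub>H\<^esub>"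
  unfolding H_zero using D_carrier one_D by (intro frac_eqI) auto

lemma frac_add_same:
  assumes "a \<in> carrier A" "b \<in> carrier A" "s \<in> D"
  shows "hfr a s \<oplus>\<^bsub>H\<^esub> hfr b s = hfr (a \<oplus> b) s"
proof -
  note sc = D_carrier[OF assms(3)]
  have "(a \<otimes> s \<oplus> b \<otimes> s) \<otimes> s = (a \<oplus> b) \<otimes> (s \<otimes> s)" using assms sc by algebra
  then show ?thesis using assms sc by (subst frac_add; (intro frac_eqI)?) (simp_all add: mult_D)
qed

lemma frac_finsum:
  assumes "finite B" "\<And>b. b \<in> B \<Longrightarrow> a b \<in> carrier A" "s \<in> D"
  shows "(\<Oplus>\<^bsub>H\<^esub>b\<in>B. hfr (a b) s) = hfr (\<Oplus>b\<in>B. a b) s"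
  using assms(1,2)
proof (induction B)
  case empty
  then show ?case using frac_zero[OF assms(3)] by simp
next
  case (insert b B)
  have "(\<Oplus>\<^bsub>H\<^esub>c\<in>insert b B. hfr (a c) s) = hfr (a b) s \<oplus>\<^bsub>H\<^esub> (\<Oplus>\<^bsub>H\<^esub>c\<in>B. hfr (a c) s)"
    using insert assms(3) by (intro H.finsum_insert) (auto intro!: frac_in_H)
  also have "\<dots> = hfr (a b \<oplus> (\<Oplus>b\<in>B. a b)) s"
    using insert assms(3) by (simp add: frac_add_same)
  also have "a b \<oplus> (\<Oplus>b\<in>B. a b) = (\<Oplus>c\<in>insert b B. a c)"
    using insert by (intro finsum_insert[symmetric]) auto
  finally show ?case .
qed

lemma unit_hom: "ring_hom_cring A H (\<lambda>a. hfr a \<one>)"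
  by (intro ring_hom_cring.intro ring_hom_cring_axioms.intro is_cring H_cring ring_hom_memI)
     (auto simp: frac_in_H one_D frac_mult frac_add H_one)

abbreviation "Hdeg \<equiv> hloc_deg A gr v"

lemma Hdeg_I: "a \<in> gr e \<Longrightarrow> s \<in> gr d \<Longrightarrow> s \<notin> v \<Longrightarrow> int e - int d = n \<Longrightarrow> hfr a s \<in> Hdeg n"
  unfolding hloc_deg_def by blast

lemma Hdeg_E:
  assumes "x \<in> Hdeg n"
  obtains a s e d where "x = hfr a s" "a \<in> gr e" "s \<in> gr d" "s \<notin> v" "int e - int d = n" "s \<in> D" "a \<in> carrier A"
proof -
  obtain a s e d where "x = hfr a s" "a \<in> gr e" "s \<in> gr d" "s \<notin> v" "int e - int d = n"
    using assms unfolding hloc_deg_def by blast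
  then show ?thesis using that gr_D gr_carrier by blast
qed

lemma Hdeg_carrier: "x \<in> Hdeg n \<Longrightarrow> x \<in> carrier H"
  by (elim Hdeg_E) (auto intro: frac_in_H)

lemma Hdeg_mult:
  assumes "x \<in> Hdeg m" "y \<in> Hdeg n" shows "x \<otimes>\<^bsub>H\<^esub> y \<in> Hdeg (m + n)"
proof -
  obtain a s e d where x: "x = hfr a s" "a \<in> gr e" "s \<in> gr d" "s \<notin> v" "int e - int d = m" "s \<in> D" "a \<in> carrier A"
    using assms(1) by (rule Hdeg_E)
  obtain b t e' d' where y: "y = hfr b t" "b \<in> gr e'" "t \<in> gr d'" "t \<notin> v" "int e' - int d' = n" "t \<in> D" "b \<in> carrier A"
    using assms(2) by (rule Hdeg_E)
  have "s \<otimes> t \<notin> v" using x y prime.I_prime D_carrier by blast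
  then show ?thesis unfolding x(1) y(1) frac_mult[OF x(7,6) y(7,6)] using x y
    by (intro Hdeg_I[of _ "e + e'" _ "d + d'"] gr_mult) auto
qed

lemma Hdeg_add:
  assumes "x \<in> Hdeg n" "y \<in> Hdeg n" shows "x \<oplus>\<^bsub>H\<^esub> y \<in> Hdeg n"
proof -
  obtain a s e d where x: "x = hfr a s" "a \<in> gr e" "s \<in> gr d" "s \<notin> v" "int e - int d = n" "s \<in> D" "a \<in> carrier A"
    using assms(1) by (rule Hdeg_E)
  obtain b t e' d' where y: "y = hfr b t" "b \<in> gr e'" "t \<in> gr d'" "t \<notin> v" "int e' - int d' = n" "t \<in> D" "b \<in> carrier A"
    using assms(2) by (rule Hdeg_E)
  have st: "s \<otimes> t \<notin> v" using x y prime.I_prime D_carrier by blast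
  have "e' + d = e + d'" using x(5) y(5) by linarith
  then have "b \<otimes> s \<in> gr (e + d')" using gr_mult[OF y(2) x(3)] by simp
  then have "a \<otimes> t \<oplus> b \<otimes> s \<in> gr (e + d')" using gr_mult[OF x(2) y(3)] by (intro gr_add)
  then show ?thesis unfolding x(1) y(1) frac_add[OF x(7,6) y(7,6)]
    by (rule Hdeg_I[OF _ gr_mult[OF x(3) y(3)] st]) (use x(5) in simp)
qed

abbreviation "R \<equiv> stalk_ring A gr v"

lemma Hdeg_one: "\<one>\<^bsub>H\<^esub> \<in> Hdeg 0" unfolding H_one by (rule Hdeg_I[OF gr_one gr_one one_notin]) simp

lemma Hdeg_subring: "subring (Hdeg 0) H"
proof (rule H.subringI)
  show "Hdeg 0 \<subseteq> carrier H" using Hdeg_carrier by blast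
  show "\<one>\<^bsub>H\<^esub> \<in> Hdeg 0" by (rule Hdeg_one)
  show "\<ominus>\<^bsub>H\<^esub> x \<in> Hdeg 0" if "x \<in> Hdeg 0" for x
    using that by (elim Hdeg_E) (auto simp: frac_neg gr_neg intro!: Hdeg_I)
  show "x \<otimes>\<^bsub>H\<^esub> y \<in> Hdeg 0" "x \<oplus>\<^bsub>H\<^esub> y \<in> Hdeg 0" if "x \<in> Hdeg 0" "y \<in> Hdeg 0" for x y
    using Hdeg_mult[OF that] Hdeg_add[OF that] by simp_all
qed

lemma R_sel: "carrier R = Hdeg 0" "\<zero>\<^bsub>R\<^esub> = \<zero>\<^bsub>H\<^esub>" "\<one>\<^bsub>R\<^esub> = \<one>\<^bsub>H\<^esub>" "x \<otimes>\<^bsub>R\<^esub> y = x \<otimes>\<^bsub>H\<^esub> y" "x \<oplus>\<^bsub>R\<^esub> y = x \<oplus>\<^bsub>H\<^esub> y"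
  by (auto simp: stalk_ring_def)

lemma R_cring: "cring R"
proof -
  have "subcring (Hdeg 0) H" by (rule H.subcringI'[OF Hdeg_subring])
  then show ?thesis using H.subcring_iff[of "Hdeg 0"] Hdeg_carrier unfolding stalk_ring_def by blast
qed

sublocale R: cring R by (rule R_cring)

lemma R_inclusion: "ring_hom_cring R H (\<lambda>x. x)"
  by (intro ring_hom_cring.intro ring_hom_cring_axioms.intro R_cring H_cring ring_hom_memI)
     (auto simp: R_sel Hdeg_carrier)

end

section \<open>From the stalk of the quotient sheaf to exactness over the local ring\<close>

context cring begin

lemma mat_op_cong:
  assumes "\<And>b b'. b \<in> B \<Longrightarrow> b' \<in> B \<Longrightarrow> T b' b = T' b' b" "\<And>b b'. b \<in> B \<Longrightarrow> b' \<in> B \<Longrightarrow> T' b' b \<in> carrier R"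
    and "x \<in> B \<rightarrow>\<^sub>E carrier R"
  shows "mat_op R B T x = mat_op R B T' x"
  unfolding mat_op_def using assms by (intro restrict_ext finsum_cong') (auto simp: PiE_iff)

lemma mat_op_scale:
  assumes T: "\<And>b b'. b \<in> B \<Longrightarrow> b' \<in> B \<Longrightarrow> T b' b \<in> carrier R" and B: "finite B" and c: "c \<in> carrier R"
    and x: "x \<in> B \<rightarrow>\<^sub>E carrier R"
  shows "mat_op R B (\<lambda>b' b. c \<otimes> T b' b) x = (\<lambda>b\<in>B. c \<otimes> mat_op R B T x b)"
proof -
  have xc: "x b \<in> carrier R" if "b \<in> B" for b using x that by (auto simp: PiE_iff)
  have "(\<Oplus>b\<in>B. (c \<otimes> T b' b) \<otimes> x b) = c \<otimes> (\<Oplus>b\<in>B. T b' b \<otimes> x b)" if "b' \<in> B" for b'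
    using T c xc that B by (subst finsum_rdistr) (auto simp: m_assoc intro!: finsum_cong')
  then show ?thesis unfolding mat_op_def by (intro restrict_ext) auto
qed

lemma mat_op_smult_funpow:
  assumes T: "\<And>b b'. b \<in> B \<Longrightarrow> b' \<in> B \<Longrightarrow> T b' b \<in> carrier R" and B: "finite B" and c: "c \<in> carrier R"
    and x: "x \<in> B \<rightarrow>\<^sub>E carrier R"
  shows "(mat_op R B T ^^ k) (\<lambda>b\<in>B. c \<otimes> x b) = (\<lambda>b\<in>B. c \<otimes> (mat_op R B T ^^ k) x b)"
proof (induction k)
  case (Suc k)
  have "(mat_op R B T ^^ k) x \<in> B \<rightarrow>\<^sub>E carrier R" by (rule mat_op_funpow_closed[of B T, OF T x])
  from mat_op_smult[of B T, OF T B this c] show ?case by (simp only: funpow.simps comp_apply Suc.IH)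
qed simp

lemma mat_op_scale_funpow:
  assumes T: "\<And>b b'. b \<in> B \<Longrightarrow> b' \<in> B \<Longrightarrow> T b' b \<in> carrier R" and B: "finite B" and c: "c \<in> carrier R"
    and x: "x \<in> B \<rightarrow>\<^sub>E carrier R"
  shows "(mat_op R B (\<lambda>b' b. c \<otimes> T b' b) ^^ k) x = (\<lambda>b\<in>B. c [^] k \<otimes> (mat_op R B T ^^ k) x b)"
proof (induction k)
  case 0
  have "(\<lambda>b\<in>B. c [^] (0::nat) \<otimes> x b) = restrict x B"
    using x c by (intro restrict_ext) (auto simp: PiE_iff)
  also have "\<dots> = x" using x by (intro extensional_restrict) (auto simp: PiE_iff)
  finally show ?case by simp
next
  case (Suc k)
  let ?N = "mat_op R B T" and ?T = "mat_op R B (\<lambda>b' b. c \<otimes> T b' b)"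
  have Nk: "(?N ^^ i) x \<in> B \<rightarrow>\<^sub>E carrier R" for i by (rule mat_op_funpow_closed[of B T, OF T x])
  have cT: "c \<otimes> T b' b \<in> carrier R" if "b \<in> B" "b' \<in> B" for b b' using T that c by simp
  have ck: "c [^] k \<in> carrier R" using c by simp
  have "(?T ^^ Suc k) x = ?T (\<lambda>b\<in>B. c [^] k \<otimes> (?N ^^ k) x b)" by (simp only: funpow.simps comp_apply Suc.IH)
  also have "\<dots> = (\<lambda>b\<in>B. c [^] k \<otimes> ?T ((?N ^^ k) x) b)" by (rule mat_op_smult[OF cT B Nk ck])
  also have "?T ((?N ^^ k) x) = (\<lambda>b\<in>B. c \<otimes> ?N ((?N ^^ k) x) b)" by (rule mat_op_scale[of B T, OF T B c Nk])
  also have "(\<lambda>b\<in>B. c [^] k \<otimes> (\<lambda>b\<in>B. c \<otimes> ?N ((?N ^^ k) x) b) b) = (\<lambda>b\<in>B. c [^] Suc k \<otimes> (?N ^^ Suc k) x b)"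
    using Nk[of "Suc k"] c by (intro restrict_ext) (auto simp: PiE_iff m_assoc)
  finally show ?case .
qed

end

context graded_prime begin

text \<open>
  The numerators are homogeneous of the same degree as \<open>f\<close>; hence the same fractions are sections of degree \<open>0\<close> wherever
  \<open>f\<close> does not vanish.
\<close>

lemma common_denominator:
  assumes "finite B" "\<And>b. b \<in> B \<Longrightarrow> x b \<in> Hdeg 0"
  shows "\<exists>d f a. f \<in> gr d \<and> f \<notin> v \<and> (\<forall>b\<in>B. a b \<in> gr d \<and> x b = hfr (a b) f)"
  using assms
proof (induction B)
  case empty
  then show ?case using gr_one one_notin by blast
next
  case (insert b B)
  then obtain d f a where f: "f \<in> gr d" "f \<notin> v" and a: "\<And>c. c \<in> B \<Longrightarrow> a c \<in> gr d \<and> x c = hfr (a c) f"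
    by blast
  have "x b \<in> Hdeg 0" using insert.prems by simp
  then obtain a0 s0 e d0 where x: "x b = hfr a0 s0" "a0 \<in> gr e" "s0 \<in> gr d0" "s0 \<notin> v" "int e - int d0 = 0" "s0 \<in> D" "a0 \<in> carrier A"
    by (rule Hdeg_E)
  have e: "e = d0" using x(5) by simp
  have fD: "f \<in> D" using f by (rule gr_D)
  note car = D_carrier[OF fD] D_carrier[OF x(6)] x(7)
  define a' where "a' c = (if c = b then a0 \<otimes> f else a c \<otimes> s0)" for c
  have "f \<otimes> s0 \<in> gr (d + d0)" using gr_mult f x by blast
  moreover have "f \<otimes> s0 \<notin> v" using prime.I_prime car f x by blast
  moreover have "a' c \<in> gr (d + d0) \<and> x c = hfr (a' c) (f \<otimes> s0)" if "c \<in> insert b B" for c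
  proof (cases "c = b")
    case True
    have "a0 \<otimes> f \<in> gr (d + d0)" using gr_mult[OF x(2) f(1)] e by (simp add: add.commute)
    moreover have "hfr a0 s0 = hfr (a0 \<otimes> f) (f \<otimes> s0)"
      using car x fD by (intro frac_eqI mult_D) (auto simp: m_assoc)
    ultimately show ?thesis using True x(1) by (simp add: a'_def)
  next
    case False
    then have c: "c \<in> B" using that by simp
    have ac: "a c \<in> carrier A" using a[OF c] gr_carrier by blast
    have "hfr (a c) f = hfr (a c \<otimes> s0) (f \<otimes> s0)"
    proof (intro frac_eqI mult_D)
      show "a c \<otimes> (f \<otimes> s0) = a c \<otimes> s0 \<otimes> f" using car ac by algebra
    qed (use x fD ac car in auto)
    then show ?thesis using False a[OF c] gr_mult x(3) by (simp add: a'_def)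
  qed
  ultimately show ?case by blast
qed

lemma common_annihilator:
  assumes "finite B" "\<And>b. b \<in> B \<Longrightarrow> c b \<in> carrier A" "\<And>b. b \<in> B \<Longrightarrow> \<exists>u\<in>D. u \<otimes> c b = \<zero>"
  shows "\<exists>u\<in>D. \<forall>b\<in>B. u \<otimes> c b = \<zero>"
  using assms
proof (induction B)
  case empty
  then show ?case using one_D by blast
next
  case (insert b B)
  then obtain u where u: "u \<in> D" "\<forall>b\<in>B. u \<otimes> c b = \<zero>" by blast
  obtain w where w: "w \<in> D" "w \<otimes> c b = \<zero>" using insert.prems by blast
  note car = D_carrier[OF u(1)] D_carrier[OF w(1)]
  have "(u \<otimes> w) \<otimes> c b' = \<zero>" if "b' \<in> insert b B" for b'
  proof (cases "b' = b")
    case True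
    have "(u \<otimes> w) \<otimes> c b = u \<otimes> (w \<otimes> c b)" using car insert.prems by (intro m_assoc) auto
    then show ?thesis using True w car by simp
  next
    case False
    then have b': "b' \<in> B" using that by simp
    have cb: "c b' \<in> carrier A" using insert.prems(1)[OF that] .
    have "(u \<otimes> w) \<otimes> c b' = w \<otimes> (u \<otimes> c b')" using car cb by algebra
    then show ?thesis using b' u car by simp
  qed
  then show ?case using mult_D[OF u(1) w(1)] by blast
qed

lemma hfr_eq_zero:
  assumes "a \<in> carrier A" "s \<in> D"
  shows "hfr a s = \<zero>\<^bsub>H\<^esub> \<longleftrightarrow> (\<exists>u\<in>D. u \<otimes> a = \<zero>)"
  unfolding H_zero using assms D_carrier by (subst frac_eq) (auto simp: one_D)

lemma theta_hfr:
  assumes T: "\<And>b b'. b \<in> B \<Longrightarrow> b' \<in> B \<Longrightarrow> T b' b \<in> carrier A" and B: "finite B"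
    and a: "\<And>b. b \<in> B \<Longrightarrow> a b \<in> carrier A" and f: "f \<in> D" and b': "b' \<in> B"
    and x: "\<And>b. b \<in> B \<Longrightarrow> x b = hfr (a b) f"
  shows "(\<Oplus>\<^bsub>H\<^esub>b\<in>B. hfr (T b' b) \<one> \<otimes>\<^bsub>H\<^esub> x b) = hfr (\<Oplus>b\<in>B. T b' b \<otimes> a b) f"
proof -
  have "(\<Oplus>\<^bsub>H\<^esub>b\<in>B. hfr (T b' b) \<one> \<otimes>\<^bsub>H\<^esub> x b) = (\<Oplus>\<^bsub>H\<^esub>b\<in>B. hfr (T b' b \<otimes> a b) f)"
    using T a b' f D_carrier[OF f] x by (intro H.finsum_cong') (auto simp: frac_mult one_D intro!: frac_in_H)
  also have "\<dots> = hfr (\<Oplus>b\<in>B. T b' b \<otimes> a b) f" using T a b' f by (intro frac_finsum B) auto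
  finally show ?thesis .
qed

end

context graded_cring begin

lemma graded_prime_proj: "w \<in> proj A gr \<Longrightarrow> graded_prime A gr w"
  by (auto simp: proj_def intro!: graded_prime.intro graded_cring_axioms)

lemma gr_pow: "s \<in> gr m \<Longrightarrow> s [^] (k::nat) \<in> gr (k * m)"
proof (induction k)
  case 0
  then show ?case using gr_one by simp
next
  case (Suc k)
  then show ?case using gr_mult[of "s [^] k" "k * m" s m] by (simp add: add.commute)
qed

text \<open>Evaluating a section at a point \<open>w\<close> commutes with the operator, so iterates can be compared on the stalks.\<close>

lemma sec_op_at:
  assumes w: "w \<in> W" "w \<in> proj A gr" and T: "\<And>b b'. b \<in> B \<Longrightarrow> b' \<in> B \<Longrightarrow> T b' b \<in> carrier A"
    and y: "\<And>b. b \<in> B \<Longrightarrow> y b w \<in> carrier (hloc A gr w)"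
  shows "(\<lambda>b\<in>B. ((sec_op A gr B T W ^^ k) y) b w) =
    (mat_op (hloc A gr w) B (\<lambda>b' b. hfrac A gr w (T b' b) \<one>) ^^ k) (\<lambda>b\<in>B. y b w)"
proof (induction k)
  case (Suc k)
  interpret w: graded_prime A gr w by (rule graded_prime_proj) fact
  let ?y = "(sec_op A gr B T W ^^ k) y" and ?T = "\<lambda>b' b. hfrac A gr w (T b' b) \<one>"
  let ?M = "mat_op w.H B ?T"
  have Tc: "?T b' b \<in> carrier w.H" if "b \<in> B" "b' \<in> B" for b b'
    using T that by (intro w.frac_in_H w.one_D)
  have "(?M ^^ k) (\<lambda>b\<in>B. y b w) \<in> B \<rightarrow>\<^sub>E carrier w.H"
    by (rule w.H.mat_op_funpow_closed[of B ?T, OF Tc]) (use y in auto)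
  then have "(\<lambda>b\<in>B. ?y b w) \<in> B \<rightarrow>\<^sub>E carrier w.H" unfolding Suc.IH .
  then have yc: "?y b w \<in> carrier w.H" if "b \<in> B" for b using that by (auto simp: PiE_iff)
  have "(\<lambda>b\<in>B. (sec_op A gr B T W ?y) b w) = (\<lambda>b'\<in>B. \<Oplus>\<^bsub>w.H\<^esub>b\<in>B. ?T b' b \<otimes>\<^bsub>w.H\<^esub> ?y b w)"
    using w by (intro restrict_ext) (simp add: sec_op_def)
  also have "\<dots> = ?M (\<lambda>b\<in>B. ?y b w)"
    unfolding mat_op_def using Tc yc by (intro restrict_ext w.H.finsum_cong') auto
  finally show ?case by (simp only: funpow.simps comp_apply Suc.IH)
qed simp

lemma zopen_basic: "g \<in> gr n \<Longrightarrow> zopen A gr {w \<in> proj A gr. g \<notin> w}"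
  unfolding zopen_def by (intro exI[of _ "{g}"]) auto

text \<open>
  Write the components of \<open>x\<close> with a common denominator \<open>f\<close>, and let \<open>u \<notin> v\<close> be a homogeneous element that kills the numerators
  of \<open>T x\<close>. On the open set where \<open>f\<close>, \<open>u\<close> and \<open>s\<close> do not vanish, the same fractions define a section of the kernel sheaf.
  Its germ is zero in the trivial stalk, so near \<open>v\<close> it is the image under \<open>T^k\<close> of a section \<open>y\<close>, whose value at \<open>v\<close> is
  the required element.
\<close>

theorem exact_at_point:
  assumes v: "v \<in> proj A gr" and B: "finite B"
    and T: "\<And>b b'. b \<in> B \<Longrightarrow> b' \<in> B \<Longrightarrow> T b' b \<in> gr m"
    and s: "s \<in> gr m" "s \<notin> v"
    and triv: "v \<notin> quot_supp A gr B (ker_sec A gr B T) (im_sec A gr B T m k)"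
    and x: "x \<in> B \<rightarrow>\<^sub>E hloc_deg A gr v 0"
    and ker: "mat_op (hloc A gr v) B (\<lambda>b' b. hfrac A gr v (T b' b) \<one>) x = (\<lambda>b\<in>B. \<zero>\<^bsub>hloc A gr v\<^esub>)"
  shows "\<exists>y\<in>B \<rightarrow>\<^sub>E hloc_deg A gr v (- (int k * int m)).
    x = (mat_op (hloc A gr v) B (\<lambda>b' b. hfrac A gr v (T b' b) \<one>) ^^ k) y"
proof -
  interpret v: graded_prime A gr v by (rule graded_prime_proj) fact
  let ?F = "ker_sec A gr B T" and ?F' = "im_sec A gr B T m k"
  have Tc: "T b' b \<in> carrier A" if "b \<in> B" "b' \<in> B" for b b' using T[OF that] gr_carrier by blast
  have xb: "x b \<in> v.Hdeg 0" if "b \<in> B" for b using x that by (auto simp: PiE_iff)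
  obtain d f a where f: "f \<in> gr d" "f \<notin> v" and a: "\<And>b. b \<in> B \<Longrightarrow> a b \<in> gr d" "\<And>b. b \<in> B \<Longrightarrow> x b = v.hfr (a b) f"
    using v.common_denominator[of B x, OF B xb] by blast
  have fD: "f \<in> v.D" using f by (rule v.gr_D)
  have ac: "a b \<in> carrier A" if "b \<in> B" for b using a(1)[OF that] gr_carrier by blast
  define c where "c b' = (\<Oplus>b\<in>B. T b' b \<otimes> a b)" for b'
  have cc: "c b' \<in> carrier A" if "b' \<in> B" for b' using Tc ac that by (auto simp: c_def)
  have "\<exists>u\<in>v.D. u \<otimes> c b' = \<zero>" if b': "b' \<in> B" for b'
  proof -
    have "v.hfr (c b') f = (\<Oplus>\<^bsub>v.H\<^esub>b\<in>B. v.hfr (T b' b) \<one> \<otimes>\<^bsub>v.H\<^esub> x b)"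
      unfolding c_def by (rule v.theta_hfr[symmetric, of B T a]) (use Tc ac b' B fD a in auto)
    also have "\<dots> = \<zero>\<^bsub>v.H\<^esub>" using fun_cong[OF ker, of b'] b' by (simp add: mat_op_def)
    finally show ?thesis using v.hfr_eq_zero[OF cc[OF b'] fD] by simp
  qed
  then obtain u where u: "u \<in> v.D" "\<And>b'. b' \<in> B \<Longrightarrow> u \<otimes> c b' = \<zero>"
    using v.common_annihilator[of B c, OF B cc] by blast
  obtain n where un: "u \<in> gr n" "u \<notin> v" using u(1) by (auto simp: denoms_def)
  note car = gr_carrier[OF f(1)] gr_carrier[OF un(1)] gr_carrier[OF s(1)]
  \<comment> \<open>Where \<open>s\<close> does not vanish, zero is the fraction \<open>0/s^k\<close> of degree \<open>- k m\<close>, hence a section of the source of \<open>T^k\<close>.\<close>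
  define g where "g = f \<otimes> u \<otimes> s"
  have g: "g \<in> gr (d + n + m)" unfolding g_def by (intro gr_mult f un s)
  define U where "U = {w \<in> proj A gr. g \<notin> w}"
  have zU: "zopen A gr U" unfolding U_def by (rule zopen_basic[OF g])
  have "g \<notin> v" unfolding g_def using v.prime.I_prime car f un s by (meson m_closed)
  then have vU: "v \<in> U" using v by (simp add: U_def)
  have Up: "w \<in> proj A gr" if "w \<in> U" for w using that by (simp add: U_def)
  have notin: "f \<notin> w" "u \<notin> w" "s \<notin> w" if "w \<in> U" for w
  proof -
    interpret w: graded_prime A gr w by (rule graded_prime_proj[OF Up[OF that]])
    have gw: "g \<notin> w" using that by (simp add: U_def)
    show "s \<notin> w" using gw w.prime.I_l_closed[of s "f \<otimes> u"] car by (auto simp: g_def)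
    show "u \<notin> w" using gw w.prime.I_l_closed[of u "f \<otimes> s"] car by (auto simp: g_def m_ac)
    show "f \<notin> w" using gw w.prime.I_l_closed[of f "u \<otimes> s"] car by (auto simp: g_def m_ac)
  qed
  define xs where "xs = (\<lambda>b\<in>B. \<lambda>w\<in>U. hfrac A gr w (a b) f)"
  have OM_xs: "xs \<in> OM_sec A gr B 0 U"
  proof -
    have "(\<lambda>w\<in>U. hfrac A gr w (a b) f) \<in> O_sec A gr 0 U" if b: "b \<in> B" for b
    proof -
      have 1: "hfrac A gr w (a b) f \<in> hloc_deg A gr w 0" if "w \<in> U" for w
        by (rule graded_prime.Hdeg_I[OF graded_prime_proj[OF Up[OF that]] a(1)[OF b] f(1) notin(1)[OF that]]) simp
      have 2: "\<exists>W a' f' e d'. zopen A gr W \<and> w \<in> W \<and> W \<subseteq> U \<and> a' \<in> gr e \<and> f' \<in> gr d' \<and> int e - int d' = 0 \<and>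
         (\<forall>w\<in>W. f' \<notin> w \<and> (\<lambda>w\<in>U. hfrac A gr w (a b) f) w = hfrac A gr w a' f')" if "w \<in> U" for w
        by (rule exI[of _ U], rule exI[of _ "a b"], rule exI[of _ f], rule exI[of _ d], rule exI[of _ d])
           (use that zU a(1)[OF b] f(1) notin in auto)
      show ?thesis unfolding O_sec_def using 1 2 by (intro CollectI conjI ballI) auto
    qed
    then show ?thesis by (auto simp: OM_sec_def xs_def)
  qed
  have zero_res: "sec_res B W (sec_zero A gr B W') = sec_zero A gr B W" if "W \<subseteq> W'" for W W'
    unfolding sec_res_def sec_zero_def using that by (intro restrict_ext) (auto simp: restrict_def fun_eq_iff)
  have op_xs: "sec_op A gr B T U xs = sec_zero A gr B U"
    unfolding sec_op_def sec_zero_def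
  proof (intro restrict_ext)
    fix b' w assume b': "b' \<in> B" and w: "w \<in> U"
    interpret w: graded_prime A gr w by (rule graded_prime_proj[OF Up[OF w]])
    have D: "f \<in> w.D" "u \<in> w.D" using f un notin[OF w] by (auto intro: w.gr_D)
    have "(\<Oplus>\<^bsub>w.H\<^esub>b\<in>B. w.hfr (T b' b) \<one> \<otimes>\<^bsub>w.H\<^esub> xs b w) = w.hfr (c b') f"
      unfolding c_def by (rule w.theta_hfr) (use Tc ac b' B D w in \<open>auto simp: xs_def\<close>)
    also have "\<dots> = \<zero>\<^bsub>w.H\<^esub>" using w.hfr_eq_zero[OF cc[OF b'] D(1)] u(2)[OF b'] D(2) by blast
    finally show "(\<Oplus>\<^bsub>w.H\<^esub>b\<in>B. w.hfr (T b' b) \<one> \<otimes>\<^bsub>w.H\<^esub> xs b w) = \<zero>\<^bsub>w.H\<^esub>" .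
  qed
  then have xs_F: "xs \<in> ?F U" using OM_xs by (simp add: ker_sec_def)
  have OM_zero: "sec_zero A gr B U \<in> OM_sec A gr B (- (int j * int m)) U" for j
  proof -
    have "(\<lambda>w\<in>U. \<zero>\<^bsub>hloc A gr w\<^esub>) \<in> O_sec A gr (- (int j * int m)) U"
    proof -
      have sj: "s [^] j \<in> gr (j * m)" by (rule gr_pow[OF s(1)])
      have sw: "s [^] j \<notin> w \<and> \<zero>\<^bsub>hloc A gr w\<^esub> = hfrac A gr w \<zero> (s [^] j)" if "w \<in> U" for w
      proof -
        interpret w: graded_prime A gr w by (rule graded_prime_proj[OF Up[OF that]])
        have "s [^] j \<notin> w"
        proof (induction j)
          case (Suc j)
          then show ?case using w.prime.I_prime[of "s [^] j" s] car notin[OF that] by auto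
        qed (simp add: w.one_notin)
        then show ?thesis using w.frac_zero w.gr_D[OF sj] by simp
      qed
      have 1: "\<zero>\<^bsub>hloc A gr w\<^esub> \<in> hloc_deg A gr w (- (int j * int m))" if "w \<in> U" for w
        using sw[OF that] graded_prime.Hdeg_I[OF graded_prime_proj[OF Up[OF that]] gr_zero[of 0] sj] by simp
      have 2: "\<exists>W a' f' e d'. zopen A gr W \<and> w \<in> W \<and> W \<subseteq> U \<and> a' \<in> gr e \<and> f' \<in> gr d' \<and> int e - int d' = - (int j * int m) \<and>
         (\<forall>w\<in>W. f' \<notin> w \<and> (\<lambda>w\<in>U. \<zero>\<^bsub>hloc A gr w\<^esub>) w = hfrac A gr w a' f')" if "w \<in> U" for w
        by (rule exI[of _ U], rule exI[of _ \<zero>], rule exI[of _ "s [^] j"], rule exI[of _ 0], rule exI[of _ "j * m"])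
           (use that zU gr_zero sj sw in auto)
      show ?thesis unfolding O_sec_def using 1 2 by (intro CollectI conjI ballI) auto
    qed
    then show ?thesis by (auto simp: OM_sec_def sec_zero_def)
  qed
  have op_zero: "sec_op A gr B T U (sec_zero A gr B U) = sec_zero A gr B U"
    unfolding sec_op_def sec_zero_def
  proof (intro restrict_ext)
    fix b' w assume b': "b' \<in> B" and w: "w \<in> U"
    interpret w: graded_prime A gr w by (rule graded_prime_proj[OF Up[OF w]])
    have "(\<Oplus>\<^bsub>w.H\<^esub>b\<in>B. w.hfr (T b' b) \<one> \<otimes>\<^bsub>w.H\<^esub> (\<lambda>b\<in>B. \<lambda>w\<in>U. \<zero>\<^bsub>hloc A gr w\<^esub>) b w) = (\<Oplus>\<^bsub>w.H\<^esub>b\<in>B. \<zero>\<^bsub>w.H\<^esub>)"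
      using w w.H.r_null[OF w.frac_in_H[OF Tc[OF _ b'] w.one_D]] by (intro w.H.finsum_cong') simp_all
    then show "(\<Oplus>\<^bsub>w.H\<^esub>b\<in>B. w.hfr (T b' b) \<one> \<otimes>\<^bsub>w.H\<^esub> (\<lambda>b\<in>B. \<lambda>w\<in>U. \<zero>\<^bsub>hloc A gr w\<^esub>) b w) = \<zero>\<^bsub>w.H\<^esub>"
      by simp
  qed
  have zero_F': "sec_zero A gr B U \<in> ?F' U"
    unfolding im_sec_def
  proof (intro CollectI conjI ballI)
    show "sec_zero A gr B U \<in> OM_sec A gr B 0 U" using OM_zero[of 0] by simp
    fix w assume "w \<in> U"
    have "(sec_op A gr B T U ^^ k) (sec_zero A gr B U) = sec_zero A gr B U"
      by (induction k) (simp_all only: funpow.simps comp_apply id_apply op_zero)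
    then have "sec_res B U (sec_zero A gr B U) = (sec_op A gr B T U ^^ k) (sec_zero A gr B U)"
      using zero_res[of U U] by simp
    then show "\<exists>W. zopen A gr W \<and> w \<in> W \<and> W \<subseteq> U \<and>
      (\<exists>y\<in>OM_sec A gr B (- (int k * int m)) W. sec_res B W (sec_zero A gr B U) = (sec_op A gr B T W ^^ k) y)"
      using zU \<open>w \<in> U\<close> OM_zero[of k] by blast
  qed
  have diff_self: "sec_diff A gr B U y y = sec_zero A gr B U" if y: "y \<in> OM_sec A gr B 0 U" for y
    unfolding sec_diff_def sec_zero_def
  proof (intro restrict_ext)
    fix b w assume b: "b \<in> B" and w: "w \<in> U"
    interpret w: graded_prime A gr w by (rule graded_prime_proj[OF Up[OF w]])
    have "y b w \<in> w.Hdeg 0" using y b w by (auto simp: OM_sec_def O_sec_def PiE_iff)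
    then show "y b w \<ominus>\<^bsub>w.H\<^esub> y b w = \<zero>\<^bsub>w.H\<^esub>" using w.Hdeg_carrier w.H.r_neg by (simp add: a_minus_def)
  qed
  have res_xs: "sec_res B U xs = xs"
    unfolding sec_res_def xs_def by (auto simp: fun_eq_iff restrict_def)
  let ?Z = "quot_germ A gr B ?F ?F' v (proj A gr) (sec_zero A gr B (proj A gr))"
  have "quot_stalk A gr B ?F ?F' v = {?Z}" using triv v by (auto simp: quot_supp_def)
  moreover have "quot_germ A gr B ?F ?F' v U xs \<in> quot_stalk A gr B ?F ?F' v"
    unfolding quot_stalk_def using zU vU xs_F by blast
  moreover have "(U, xs) \<in> quot_germ A gr B ?F ?F' v U xs"
    unfolding quot_germ_def using zU vU xs_F zero_F' diff_self[OF OM_xs]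
    by (intro CollectI case_prodI conjI exI[of _ U]) (simp_all add: res_xs)
  ultimately have "(U, xs) \<in> ?Z" by blast
  then obtain W' where W': "v \<in> W'" "W' \<subseteq> proj A gr \<inter> U"
    and diff: "sec_diff A gr B W' (sec_res B W' xs) (sec_res B W' (sec_zero A gr B (proj A gr))) \<in> ?F' W'"
    unfolding quot_germ_def by blast
  define z where "z = sec_diff A gr B W' (sec_res B W' xs) (sec_res B W' (sec_zero A gr B (proj A gr)))"
  have "z \<in> ?F' W'" using diff by (simp add: z_def)
  then obtain W y where W: "v \<in> W" "W \<subseteq> W'" and y: "y \<in> OM_sec A gr B (- (int k * int m)) W"
    and zy: "sec_res B W z = (sec_op A gr B T W ^^ k) y"
    using W'(1) unfolding im_sec_def by blast
  have yv: "y b v \<in> v.Hdeg (- (int k * int m))" if "b \<in> B" for b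
    using y that W(1) by (auto simp: OM_sec_def O_sec_def PiE_iff)
  have "x = (\<lambda>b\<in>B. sec_res B W z b v)"
  proof (rule extensionalityI[of _ B])
    fix b assume b: "b \<in> B"
    have "sec_res B W z b v = x b \<ominus>\<^bsub>v.H\<^esub> \<zero>\<^bsub>v.H\<^esub>"
      using b W W' vU v a(2)[OF b] by (auto simp: sec_res_def z_def sec_diff_def xs_def sec_zero_def)
    also have "\<dots> = x b" using v.Hdeg_carrier[OF xb[OF b]] by (simp add: a_minus_def)
    finally show "x b = (\<lambda>b\<in>B. sec_res B W z b v) b" using b by simp
  qed (use x in \<open>auto simp: PiE_iff\<close>)
  also have "\<dots> = (mat_op v.H B (\<lambda>b' b. v.hfr (T b' b) \<one>) ^^ k) (\<lambda>b\<in>B. y b v)"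
    unfolding zy by (rule sec_op_at[of v W B T y, OF W(1) v Tc]) (use v.Hdeg_carrier[OF yv] in auto)
  finally show ?thesis using yv by (intro bexI[of _ "\<lambda>b\<in>B. y b v"]) auto
qed

text \<open>
  With \<open>\<sigma> = s/1\<close>, the operator on the stalks of the twisted sheaves is \<open>\<sigma> N\<close>, where \<open>N\<close> has entries of degree \<open>0\<close>.
  As \<open>\<sigma>\<close> is a unit of the homogeneous localization, \<open>(\<sigma> N)^k y = N^k (\<sigma>^k y)\<close>, and \<open>\<sigma>^k\<close> shifts degrees by \<open>k m\<close>,
  exactness of the operator between twists amounts to exactness of \<open>N\<close> over the local ring.
\<close>

theorem uniform_jordan_blocks_at_point:
  fixes p :: nat
  assumes v: "v \<in> proj A gr" and B: "finite B"
    and T: "\<And>b b'. b \<in> B \<Longrightarrow> b' \<in> B \<Longrightarrow> T b' b \<in> gr m"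
    and s: "s \<in> gr m" "s \<notin> v" and p: "p \<ge> 1"
    and nil: "\<And>x. x \<in> B \<rightarrow>\<^sub>E carrier A \<Longrightarrow> (mat_op A B T ^^ p) x = (\<lambda>b\<in>B. \<zero>)"
    and reg: "regular_local_ring (stalk_ring A gr v)"
    and triv: "v \<notin> quot_supp A gr B (ker_sec A gr B T) (im_sec A gr B T m (p - 1))"
    and jb: "jordan_blocks (residue_field (stalk_ring A gr v)) B
      (mat_op (residue_field (stalk_ring A gr v)) B
        (\<lambda>b' b. nonunits (stalk_ring A gr v) +>\<^bsub>stalk_ring A gr v\<^esub> hfrac A gr v (T b' b) s)) ls"
    and l: "l \<in> set ls"
  shows "l = p"
proof -
  interpret v: graded_prime A gr v by (rule graded_prime_proj) fact
  let ?N = "\<lambda>b' b. v.hfr (T b' b) s" and ?T = "\<lambda>b' b. v.hfr (T b' b) \<one>" and ?\<sigma> = "v.hfr s \<one>" and ?\<tau> = "v.hfr \<one> s"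
  have sD: "s \<in> v.D" using s by (rule v.gr_D)
  note sc = v.D_carrier[OF sD]
  have Tc: "T b' b \<in> carrier A" if "b \<in> B" "b' \<in> B" for b b' using T[OF that] gr_carrier by blast
  have N0: "?N b' b \<in> v.Hdeg 0" if "b \<in> B" "b' \<in> B" for b b'
    by (rule v.Hdeg_I[OF T[OF that] s]) simp
  have NR: "?N b' b \<in> carrier v.R" if "b \<in> B" "b' \<in> B" for b b' using N0[OF that] by (simp add: v.R_sel)
  have NH: "?N b' b \<in> carrier v.H" if "b \<in> B" "b' \<in> B" for b b' using N0[OF that] by (rule v.Hdeg_carrier)
  have TH: "?T b' b \<in> carrier v.H" if "b \<in> B" "b' \<in> B" for b b' using Tc[OF that] by (intro v.frac_in_H v.one_D)
  have \<sigma>: "?\<sigma> \<in> carrier v.H" and \<tau>: "?\<tau> \<in> carrier v.H" by (intro v.frac_in_H v.one_D sc sD one_closed)+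
  have \<tau>\<sigma>: "?\<tau> \<otimes>\<^bsub>v.H\<^esub> ?\<sigma> = \<one>\<^bsub>v.H\<^esub>"
    unfolding v.H_one using sc sD v.one_D by (subst v.frac_mult; (intro v.frac_eqI)?) (simp_all add: v.mult_D)
  have \<tau>\<sigma>_pow: "?\<tau> [^]\<^bsub>v.H\<^esub> k \<otimes>\<^bsub>v.H\<^esub> ?\<sigma> [^]\<^bsub>v.H\<^esub> k = \<one>\<^bsub>v.H\<^esub>" for k :: nat
    using v.H.nat_pow_distrib[OF \<tau> \<sigma>, of k] \<tau>\<sigma> by simp
  have \<sigma>N: "?\<sigma> \<otimes>\<^bsub>v.H\<^esub> ?N b' b = ?T b' b" if "b \<in> B" "b' \<in> B" for b b'
    using Tc[OF that] sc sD v.one_D by (subst v.frac_mult; (intro v.frac_eqI)?) (simp_all add: v.mult_D m_comm)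
  let ?MT = "mat_op v.H B ?T" and ?MN = "mat_op v.H B ?N" and ?MR = "mat_op v.R B ?N"
  have MT_eq: "?MT x = mat_op v.H B (\<lambda>b' b. ?\<sigma> \<otimes>\<^bsub>v.H\<^esub> ?N b' b) x" if "x \<in> B \<rightarrow>\<^sub>E carrier v.H" for x
    by (rule v.H.mat_op_cong[OF _ _ that]) (simp_all only: \<sigma>N TH)
  have MTc: "(?MT ^^ k) x \<in> B \<rightarrow>\<^sub>E carrier v.H" if "x \<in> B \<rightarrow>\<^sub>E carrier v.H" for x k
    by (rule v.H.mat_op_funpow_closed[of B ?T, OF TH that])
  have MNc: "(?MN ^^ k) x \<in> B \<rightarrow>\<^sub>E carrier v.H" if "x \<in> B \<rightarrow>\<^sub>E carrier v.H" for x k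
    by (rule v.H.mat_op_funpow_closed[of B ?N, OF NH that])
  have MT: "(?MT ^^ k) x = (\<lambda>b\<in>B. ?\<sigma> [^]\<^bsub>v.H\<^esub> k \<otimes>\<^bsub>v.H\<^esub> (?MN ^^ k) x b)" if x: "x \<in> B \<rightarrow>\<^sub>E carrier v.H" for x k
  proof -
    have "(?MT ^^ k) x = (mat_op v.H B (\<lambda>b' b. ?\<sigma> \<otimes>\<^bsub>v.H\<^esub> ?N b' b) ^^ k) x"
    proof (induction k)
      case (Suc k)
      show ?case using MT_eq[OF MTc[OF x, of k]] by (simp only: funpow.simps comp_apply Suc.IH)
    qed simp
    then show ?thesis using v.H.mat_op_scale_funpow[of B ?N, OF NH B \<sigma> x] by simp
  qed
  have RH: "x \<in> B \<rightarrow>\<^sub>E carrier v.H" if "x \<in> B \<rightarrow>\<^sub>E carrier v.R" for x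
    using that v.Hdeg_carrier by (auto simp: PiE_iff v.R_sel)
  have MRc: "(?MR ^^ k) x \<in> B \<rightarrow>\<^sub>E carrier v.R" if "x \<in> B \<rightarrow>\<^sub>E carrier v.R" for x k
    by (rule v.R.mat_op_funpow_closed[of B ?N, OF NR that])
  have MR: "(?MR ^^ k) x = (?MN ^^ k) x" if x: "x \<in> B \<rightarrow>\<^sub>E carrier v.R" for x k
  proof -
    have res: "(\<lambda>b\<in>B. y b) = y" if "y \<in> B \<rightarrow>\<^sub>E carrier v.R" for y using that by (intro extensional_restrict) (auto simp: PiE_iff)
    show ?thesis
      using mat_op_funpow_hom[OF v.R_inclusion, of B ?N, OF NR x, of k] unfolding res[OF x] res[OF MRc[OF x]] ..
  qed
  have cancel: "(\<lambda>b\<in>B. ?\<tau> [^]\<^bsub>v.H\<^esub> k \<otimes>\<^bsub>v.H\<^esub> (?\<sigma> [^]\<^bsub>v.H\<^esub> k \<otimes>\<^bsub>v.H\<^esub> x b)) = x" if x: "x \<in> B \<rightarrow>\<^sub>E carrier v.H" for x and k :: nat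
  proof (rule extensionalityI[of _ B])
    fix b assume b: "b \<in> B"
    have xb: "x b \<in> carrier v.H" using x b by (auto simp: PiE_iff)
    have "?\<tau> [^]\<^bsub>v.H\<^esub> k \<otimes>\<^bsub>v.H\<^esub> (?\<sigma> [^]\<^bsub>v.H\<^esub> k \<otimes>\<^bsub>v.H\<^esub> x b) = x b"
      using v.H.m_assoc[of "?\<tau> [^]\<^bsub>v.H\<^esub> k" "?\<sigma> [^]\<^bsub>v.H\<^esub> k" "x b"] \<sigma> \<tau> xb \<tau>\<sigma>_pow by simp
    then show "(\<lambda>b\<in>B. ?\<tau> [^]\<^bsub>v.H\<^esub> k \<otimes>\<^bsub>v.H\<^esub> (?\<sigma> [^]\<^bsub>v.H\<^esub> k \<otimes>\<^bsub>v.H\<^esub> x b)) b = x b" using b by simp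
  qed (use x in \<open>auto simp: PiE_iff\<close>)
  have nilR: "(?MR ^^ p) x = (\<lambda>b\<in>B. \<zero>\<^bsub>v.R\<^esub>)" if x: "x \<in> B \<rightarrow>\<^sub>E carrier v.R" for x
  proof -
    have xb: "x b \<in> v.Hdeg 0" if "b \<in> B" for b using x that by (auto simp: PiE_iff v.R_sel)
    obtain d f a where f: "f \<in> gr d" "f \<notin> v" and a: "\<And>b. b \<in> B \<Longrightarrow> a b \<in> gr d" "\<And>b. b \<in> B \<Longrightarrow> x b = v.hfr (a b) f"
      using v.common_denominator[of B x, OF B xb] by blast
    have fD: "f \<in> v.D" using f by (rule v.gr_D)
    have ac: "a b \<in> carrier A" if "b \<in> B" for b using a(1)[OF that] gr_carrier by blast
    let ?a = "restrict a B" and ?f = "v.hfr \<one> f"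
    have aA: "?a \<in> B \<rightarrow>\<^sub>E carrier A" using ac by auto
    have fH: "?f \<in> carrier v.H" using fD by (intro v.frac_in_H) auto
    have aH: "(\<lambda>b\<in>B. v.hfr (?a b) \<one>) \<in> B \<rightarrow>\<^sub>E carrier v.H" using ac v.one_D by (auto intro!: v.frac_in_H)
    have "x = (\<lambda>b\<in>B. ?f \<otimes>\<^bsub>v.H\<^esub> (\<lambda>b\<in>B. v.hfr (?a b) \<one>) b)"
    proof (rule extensionalityI[of _ B])
      fix b assume b: "b \<in> B"
      have "?f \<otimes>\<^bsub>v.H\<^esub> v.hfr (a b) \<one> = v.hfr (a b) f"
        using ac[OF b] fD v.one_D v.D_carrier[OF fD] by (subst v.frac_mult) auto
      then show "x b = (\<lambda>b\<in>B. ?f \<otimes>\<^bsub>v.H\<^esub> (\<lambda>b\<in>B. v.hfr (?a b) \<one>) b) b" using a(2)[OF b] b by simp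
    qed (use x in \<open>auto simp: PiE_iff\<close>)
    then have "(?MT ^^ p) x = (\<lambda>b\<in>B. ?f \<otimes>\<^bsub>v.H\<^esub> (?MT ^^ p) (\<lambda>b\<in>B. v.hfr (?a b) \<one>) b)"
      using v.H.mat_op_smult_funpow[of B ?T, OF TH B fH aH, of p] by simp
    also have "(?MT ^^ p) (\<lambda>b\<in>B. v.hfr (?a b) \<one>) = (\<lambda>b\<in>B. v.hfr ((mat_op A B T ^^ p) ?a b) \<one>)"
      by (rule mat_op_funpow_hom[OF v.unit_hom, of B T, OF Tc aA])
    also have "(\<lambda>b\<in>B. ?f \<otimes>\<^bsub>v.H\<^esub> (\<lambda>b\<in>B. v.hfr ((mat_op A B T ^^ p) ?a b) \<one>) b) = (\<lambda>b\<in>B. \<zero>\<^bsub>v.H\<^esub>)"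
      using fH by (intro restrict_ext) (simp add: nil[OF aA] v.H_zero[symmetric])
    finally have "(?MT ^^ p) x = (\<lambda>b\<in>B. \<zero>\<^bsub>v.H\<^esub>)" .
    then have z: "?\<sigma> [^]\<^bsub>v.H\<^esub> p \<otimes>\<^bsub>v.H\<^esub> (?MN ^^ p) x b = \<zero>\<^bsub>v.H\<^esub>" if "b \<in> B" for b
      using fun_cong[OF MT[OF RH[OF x], of p], of b] that by simp
    have "(?MN ^^ p) x = (\<lambda>b\<in>B. ?\<tau> [^]\<^bsub>v.H\<^esub> p \<otimes>\<^bsub>v.H\<^esub> (?\<sigma> [^]\<^bsub>v.H\<^esub> p \<otimes>\<^bsub>v.H\<^esub> (?MN ^^ p) x b))"
      by (rule cancel[OF MNc[OF RH[OF x]], symmetric])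
    also have "\<dots> = (\<lambda>b\<in>B. \<zero>\<^bsub>v.H\<^esub>)" using \<tau> z by (intro restrict_ext) simp
    finally show ?thesis by (simp only: MR[OF x] v.R_sel)
  qed
  have exR: "\<exists>y\<in>B \<rightarrow>\<^sub>E carrier v.R. x = (?MR ^^ (p - 1)) y"
    if x: "x \<in> B \<rightarrow>\<^sub>E carrier v.R" and ker: "?MR x = (\<lambda>b\<in>B. \<zero>\<^bsub>v.R\<^esub>)" for x
  proof -
    have kerN: "?MN x = (\<lambda>b\<in>B. \<zero>\<^bsub>v.H\<^esub>)"
      using MR[OF x, of 1] ker by (simp only: v.R_sel One_nat_def funpow.simps comp_apply id_apply)
    have "?MT x = (\<lambda>b\<in>B. ?\<sigma> [^]\<^bsub>v.H\<^esub> (1::nat) \<otimes>\<^bsub>v.H\<^esub> (\<lambda>b\<in>B. \<zero>\<^bsub>v.H\<^esub>) b)"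
      using MT[OF RH[OF x], of 1] by (simp only: kerN One_nat_def funpow.simps comp_apply id_apply)
    also have "\<dots> = (\<lambda>b\<in>B. \<zero>\<^bsub>v.H\<^esub>)" using \<sigma> by (intro restrict_ext) simp
    finally have kerT: "?MT x = (\<lambda>b\<in>B. \<zero>\<^bsub>v.H\<^esub>)" .
    have xdeg: "x \<in> B \<rightarrow>\<^sub>E v.Hdeg 0" using x by (simp only: v.R_sel)
    obtain y where y: "y \<in> B \<rightarrow>\<^sub>E v.Hdeg (- (int (p - 1) * int m))" "x = (?MT ^^ (p - 1)) y"
      using exact_at_point[OF v B T s triv xdeg kerT] by blast
    have yH: "y \<in> B \<rightarrow>\<^sub>E carrier v.H" using y(1) v.Hdeg_carrier by (auto simp: PiE_iff)
    let ?c = "?\<sigma> [^]\<^bsub>v.H\<^esub> (p - 1)"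
    have \<sigma>deg: "?\<sigma> [^]\<^bsub>v.H\<^esub> k \<in> v.Hdeg (int k * int m)" for k :: nat
    proof (induction k)
      case 0
      then show ?case using v.Hdeg_one by simp
    next
      case (Suc k)
      have "?\<sigma> \<in> v.Hdeg (int m)" by (rule v.Hdeg_I[OF s(1) gr_one v.one_notin]) simp
      from v.Hdeg_mult[OF Suc this] show ?case by (simp add: algebra_simps)
    qed
    define y' where "y' = (\<lambda>b\<in>B. ?c \<otimes>\<^bsub>v.H\<^esub> y b)"
    have y'R: "y' \<in> B \<rightarrow>\<^sub>E carrier v.R"
    proof -
      have "?c \<otimes>\<^bsub>v.H\<^esub> y b \<in> v.Hdeg 0" if "b \<in> B" for b
        using v.Hdeg_mult[OF \<sigma>deg[of "p - 1"] PiE_mem[OF y(1) that]] by simp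
      then show ?thesis by (auto simp: y'_def v.R_sel)
    qed
    have cH: "?c \<in> carrier v.H" using \<sigma> by simp
    have "(?MR ^^ (p - 1)) y' = (?MN ^^ (p - 1)) y'" by (rule MR[OF y'R])
    also have "\<dots> = (\<lambda>b\<in>B. ?c \<otimes>\<^bsub>v.H\<^esub> (?MN ^^ (p - 1)) y b)"
      unfolding y'_def by (rule v.H.mat_op_smult_funpow[of B ?N, OF NH B cH yH])
    also have "\<dots> = x" unfolding y(2) MT[OF yH] ..
    finally show ?thesis using y'R by (intro bexI[of _ y']) simp_all
  qed
  show ?thesis
    by (rule p_exact_residue_field[OF reg, of B ?N, OF NR B p nilR exR jb l])
qed

end

section \<open>The reduced coordinate ring of the scheme of one-parameter subgroups\<close>

context cring begin

text \<open>
  The factor \<open>c\<close> makes the induction work: expanding one factor of the power leads to the same claim with \<open>c a\<close> and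
  \<open>m - 1\<close>, and with \<open>c b\<close> and \<open>n - 1\<close>.
\<close>

lemma nilpotent_add:
  assumes "a \<in> carrier R" "b \<in> carrier R" "c \<in> carrier R" "c \<otimes> a [^] (m::nat) = \<zero>" "c \<otimes> b [^] (n::nat) = \<zero>"
  shows "c \<otimes> (a \<oplus> b) [^] (m + n) = \<zero>"
  using assms(3-5)
proof (induction "m + n" arbitrary: m n c)
  case 0
  then show ?case by simp
next
  case (Suc k)
  show ?case
  proof (cases "m = 0 \<or> n = 0")
    case True
    then have "c = \<zero>" using Suc.prems by auto
    then show ?thesis using assms by simp
  next
    case False
    then obtain m' n' where mn: "m = Suc m'" "n = Suc n'" by (metis not0_implies_Suc)
    have am: "c \<otimes> a \<otimes> a [^] m' = \<zero>" "c \<otimes> a \<otimes> b [^] n = \<zero>"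
    proof -
      show "c \<otimes> a \<otimes> a [^] m' = \<zero>" using Suc.prems assms(1) by (simp add: mn m_assoc m_comm[of a])
      have "c \<otimes> a \<otimes> b [^] n = a \<otimes> (c \<otimes> b [^] n)" using Suc.prems assms(1,2) by (simp add: m_ac)
      then show "c \<otimes> a \<otimes> b [^] n = \<zero>" using Suc.prems assms(1) by simp
    qed
    have bm: "c \<otimes> b \<otimes> a [^] m = \<zero>" "c \<otimes> b \<otimes> b [^] n' = \<zero>"
    proof -
      show "c \<otimes> b \<otimes> b [^] n' = \<zero>" using Suc.prems assms(2) by (simp add: mn m_assoc m_comm[of b])
      have "c \<otimes> b \<otimes> a [^] m = b \<otimes> (c \<otimes> a [^] m)" using Suc.prems assms(1,2) by (simp add: m_ac)
      then show "c \<otimes> b \<otimes> a [^] m = \<zero>" using Suc.prems assms(2) by simp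
    qed
    have 1: "c \<otimes> a \<otimes> (a \<oplus> b) [^] (m' + n) = \<zero>"
      by (rule Suc.hyps(1)) (use Suc.hyps(2) Suc.prems assms am mn in auto)
    have 2: "c \<otimes> b \<otimes> (a \<oplus> b) [^] (m + n') = \<zero>"
      by (rule Suc.hyps(1)) (use Suc.hyps(2) Suc.prems assms bm mn in auto)
    let ?k = "m' + n"
    have e: "m + n = Suc ?k" "m + n' = ?k" using mn by auto
    have pw: "(a \<oplus> b) [^] ?k \<in> carrier R" using assms by simp
    have "c \<otimes> ((a \<oplus> b) [^] ?k \<otimes> (a \<oplus> b)) = c \<otimes> a \<otimes> (a \<oplus> b) [^] ?k \<oplus> c \<otimes> b \<otimes> (a \<oplus> b) [^] ?k"
      using pw assms(1,2) Suc.prems(1) by algebra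
    then show ?thesis using 1 2 e by simp
  qed
qed

lemma nilradical_ideal: "ideal (nilradical R) R"
proof (rule idealI[OF ring_axioms])
  have mult: "x \<otimes> a \<in> nilradical R" if "a \<in> nilradical R" "x \<in> carrier R" for a x
    using that nat_pow_distrib[of x a] by (auto simp: nilradical_def) (metis nat_pow_closed r_null)
  show "subgroup (nilradical R) (add_monoid R)"
  proof (rule add.subgroupI)
    show "nilradical R \<subseteq> carrier R" by (auto simp: nilradical_def)
    have "\<zero> [^] (1::nat) = \<zero>" by simp
    then have "\<zero> \<in> nilradical R" unfolding nilradical_def by blast
    then show "nilradical R \<noteq> {}" by blast
    fix a b assume a: "a \<in> nilradical R"
    have "\<ominus> a = \<ominus> \<one> \<otimes> a" using a by (simp add: nilradical_def l_minus)
    then show "\<ominus> a \<in> nilradical R" using mult[OF a, of "\<ominus> \<one>"] by simp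
    assume b: "b \<in> nilradical R"
    obtain m n :: nat where "a \<in> carrier R" "b \<in> carrier R" "a [^] m = \<zero>" "b [^] n = \<zero>"
      using a b unfolding nilradical_def by blast
    then show "a \<oplus> b \<in> nilradical R" using nilpotent_add[of a b \<one> m n] by (auto simp: nilradical_def)
  qed
  fix a x assume a: "a \<in> nilradical R" and x: "x \<in> carrier R"
  show "x \<otimes> a \<in> nilradical R" using mult[OF a x] .
  then show "a \<otimes> x \<in> nilradical R" using a x by (simp add: m_comm nilradical_def)
qed

end

context
  fixes G :: "('k::field, 'h::comm_ring_1) group_scheme" and r :: nat
begin

lemma V_ideal: "ideal (V_ideal G r) ring_of_type_algebra"
proof -
  interpret cring "ring_of_type_algebra :: ('k, 'h) vpoly ring" by (rule cring_from_type_algebra)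
  show ?thesis unfolding V_ideal_def by (rule genideal_ideal) (simp add: ring_of_type_algebra_def)
qed

lemma V_class_hom: "ring_hom_cring ring_of_type_algebra (V_ring G r) (V_class G r)"
  using ideal.rcos_ring_hom_cring[OF V_ideal cring_from_type_algebra]
  unfolding V_ring_def V_class_def[abs_def] by simp

lemma Vred_class_hom: "ring_hom_cring ring_of_type_algebra (Vred G r) (Vred_class G r)"
proof -
  interpret h: ring_hom_cring ring_of_type_algebra "V_ring G r" "V_class G r" by (rule V_class_hom)
  interpret k: ring_hom_cring "V_ring G r" "Vred G r" "\<lambda>x. nilradical (V_ring G r) +>\<^bsub>V_ring G r\<^esub> x"
    unfolding Vred_def by (rule ideal.rcos_ring_hom_cring[OF h.S.nilradical_ideal h.S.is_cring])
  show ?thesis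
    unfolding Vred_class_def[abs_def]
    by (intro ring_hom_cring.intro ring_hom_cring_axioms.intro h.R.is_cring k.S.is_cring ring_hom_memI) auto
qed

lemma Vred_class_relator:
  assumes "x \<in> relators G r vcst vvar"
  shows "Vred_class G r x = \<zero>\<^bsub>Vred G r\<^esub>"
proof -
  interpret P: cring "ring_of_type_algebra :: ('k, 'h) vpoly ring" by (rule cring_from_type_algebra)
  interpret I: ideal "V_ideal G r" ring_of_type_algebra by (rule V_ideal)
  interpret h: ring_hom_cring ring_of_type_algebra "V_ring G r" "V_class G r" by (rule V_class_hom)
  interpret N: ideal "nilradical (V_ring G r)" "V_ring G r" by (rule h.S.nilradical_ideal)
  have "x \<in> V_ideal G r"
    using P.genideal_self[of "relators G r vcst vvar"] assms unfolding V_ideal_def by (auto simp: ring_of_type_algebra_def)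
  then have "V_class G r x = V_ideal G r" unfolding V_class_def by (rule I.a_rcos_const)
  then have "V_class G r x = \<zero>\<^bsub>V_ring G r\<^esub>" by (simp add: V_ring_def FactRing_def)
  then show ?thesis unfolding Vred_class_def using N.a_rcos_const[OF N.zero_closed] by (simp add: Vred_def FactRing_def)
qed

end

lemma typeclass_ring_sel:
  "carrier ring_of_type_algebra = UNIV" "x \<otimes>\<^bsub>ring_of_type_algebra\<^esub> y = x * y"
  "x \<oplus>\<^bsub>ring_of_type_algebra\<^esub> y = x + y" "\<one>\<^bsub>ring_of_type_algebra\<^esub> = 1" "\<zero>\<^bsub>ring_of_type_algebra\<^esub> = 0"
  by (auto simp: ring_of_type_algebra_def)

lemma ring_hom_of_type_simps:
  assumes "ring_hom_cring (ring_of_type_algebra :: 'a::comm_ring_1 ring) S h"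
  shows "h x \<in> carrier S" "h (x + y) = h x \<oplus>\<^bsub>S\<^esub> h y" "h (x * y) = h x \<otimes>\<^bsub>S\<^esub> h y" "h 1 = \<one>\<^bsub>S\<^esub>" "h 0 = \<zero>\<^bsub>S\<^esub>"
    "h (- x) = \<ominus>\<^bsub>S\<^esub> h x" "h (x - y) = h x \<ominus>\<^bsub>S\<^esub> h y"
    "finite B \<Longrightarrow> h (sum f B) = (\<Oplus>\<^bsub>S\<^esub>b\<in>B. h (f b))"
proof -
  interpret ring_hom_cring "ring_of_type_algebra :: 'a ring" S h by fact
  note sel = typeclass_ring_sel
  show c: "h x \<in> carrier S" for x using hom_closed[of x] by (simp add: sel)
  show add: "h (x + y) = h x \<oplus>\<^bsub>S\<^esub> h y" for x y using hom_add[of x y] by (simp add: sel)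
  show "h (x * y) = h x \<otimes>\<^bsub>S\<^esub> h y" using hom_mult[of x y] by (simp add: sel)
  show "h 1 = \<one>\<^bsub>S\<^esub>" using hom_one by (simp add: sel)
  show z: "h 0 = \<zero>\<^bsub>S\<^esub>" using hom_zero by (simp add: sel)
  show neg: "h (- x) = \<ominus>\<^bsub>S\<^esub> h x" for x
    by (rule S.minus_equality[symmetric]) (use add[of "- x" x] z c in simp_all)
  show "h (x - y) = h x \<ominus>\<^bsub>S\<^esub> h y" using add[of x "- y"] neg by (simp add: a_minus_def)
  show "h (sum f B) = (\<Oplus>\<^bsub>S\<^esub>b\<in>B. h (f b))" if "finite B"
    using that by (induction B) (simp_all add: z add c)
qed

section \<open>The grading of the reduced coordinate ring\<close>

lemma whomog_zero: "0 \<in> whomog n" by (simp add: whomog_def)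

lemma whomog_add: "x \<in> whomog n \<Longrightarrow> y \<in> whomog n \<Longrightarrow> x + y \<in> whomog n"
  using keys_add[of x y] by (auto simp: whomog_def)

lemma whomog_neg: "x \<in> whomog n \<Longrightarrow> - x \<in> whomog n"
  by (simp add: whomog_def)

lemma whomog_sum: "(\<And>b. b \<in> B \<Longrightarrow> f b \<in> whomog n) \<Longrightarrow> sum f B \<in> whomog n"
  by (induction B rule: infinite_finite_induct) (auto simp: whomog_zero whomog_add)

lemma weight_superset:
  assumes "finite S" "Poly_Mapping.keys m \<subseteq> S"
  shows "(\<Sum>y\<in>Poly_Mapping.keys m. Poly_Mapping.lookup m y * snd y) = (\<Sum>y\<in>S. Poly_Mapping.lookup m y * (snd y :: nat))"
  by (rule sum.mono_neutral_left) (use assms in \<open>auto simp: in_keys_iff\<close>)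

lemma weight_add:
  "(\<Sum>y\<in>Poly_Mapping.keys (m + n). Poly_Mapping.lookup (m + n) y * (snd y :: nat)) =
   (\<Sum>y\<in>Poly_Mapping.keys m. Poly_Mapping.lookup m y * snd y) + (\<Sum>y\<in>Poly_Mapping.keys n. Poly_Mapping.lookup n y * snd y)"
proof -
  let ?S = "Poly_Mapping.keys m \<union> Poly_Mapping.keys n"
  have "Poly_Mapping.keys (m + n) \<subseteq> ?S" by (rule keys_add)
  then have mn: "(\<Sum>y\<in>Poly_Mapping.keys (m + n). Poly_Mapping.lookup (m + n) y * (snd y :: nat)) =
      (\<Sum>y\<in>?S. Poly_Mapping.lookup (m + n) y * snd y)"
    by (intro weight_superset) simp_all
  have m: "(\<Sum>y\<in>Poly_Mapping.keys m. Poly_Mapping.lookup m y * (snd y :: nat)) = (\<Sum>y\<in>?S. Poly_Mapping.lookup m y * snd y)"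
    and n: "(\<Sum>y\<in>Poly_Mapping.keys n. Poly_Mapping.lookup n y * (snd y :: nat)) = (\<Sum>y\<in>?S. Poly_Mapping.lookup n y * snd y)"
    by (intro weight_superset; simp)+
  show ?thesis unfolding mn m n by (simp add: lookup_add add_mult_distrib sum.distrib)
qed

lemma whomog_mult:
  assumes "x \<in> whomog m" "y \<in> whomog n" shows "x * y \<in> whomog (m + n)"
  unfolding whomog_def
proof (intro CollectI ballI)
  fix k assume "k \<in> Poly_Mapping.keys (x * y)"
  then obtain a b where "k = a + b" "a \<in> Poly_Mapping.keys x" "b \<in> Poly_Mapping.keys y"
    using keys_mult[of x y] by blast
  then show "(\<Sum>y\<in>Poly_Mapping.keys k. Poly_Mapping.lookup k y * snd y) = m + n"
    using assms by (simp add: weight_add whomog_def)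
qed

lemma whomog_vcst: "vcst a \<in> whomog 0" by (auto simp: whomog_def vcst_def)

lemma whomog_vvar: "vvar f i \<in> whomog i" by (auto simp: whomog_def vvar_def)

lemma whomog_one: "1 \<in> whomog 0" using whomog_vcst[of 1] by (simp add: vcst_def)

lemma Vred_graded: "graded_cring (Vred G r) (Vred_gr G r)"
proof -
  interpret h: ring_hom_cring ring_of_type_algebra "Vred G r" "Vred_class G r" by (rule Vred_class_hom)
  note hs = ring_hom_of_type_simps[OF Vred_class_hom[of G r]]
  show ?thesis
  proof (intro graded_cring.intro graded_cring_axioms.intro h.S.is_cring)
    show "\<zero>\<^bsub>Vred G r\<^esub> \<in> Vred_gr G r n" for n unfolding Vred_gr_def using whomog_zero hs(5) by (metis imageI)
    show "\<one>\<^bsub>Vred G r\<^esub> \<in> Vred_gr G r 0" unfolding Vred_gr_def using whomog_one hs(4) by (metis imageI)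
    show "a \<in> carrier (Vred G r)" if "a \<in> Vred_gr G r n" for a n using that hs(1) by (auto simp: Vred_gr_def)
    show "a \<oplus>\<^bsub>Vred G r\<^esub> b \<in> Vred_gr G r n" if "a \<in> Vred_gr G r n" "b \<in> Vred_gr G r n" for a b n
      using that by (auto simp: Vred_gr_def simp flip: hs(2) intro!: imageI whomog_add)
    show "\<ominus>\<^bsub>Vred G r\<^esub> a \<in> Vred_gr G r n" if "a \<in> Vred_gr G r n" for a n
      using that by (auto simp: Vred_gr_def simp flip: hs(6) intro!: imageI whomog_neg)
    show "a \<otimes>\<^bsub>Vred G r\<^esub> b \<in> Vred_gr G r (m + n)" if "a \<in> Vred_gr G r m" "b \<in> Vred_gr G r n" for a b m n
      using that by (auto simp: Vred_gr_def simp flip: hs(3) intro!: imageI whomog_mult)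
  qed
qed

section \<open>Nilpotence of the universal operator\<close>

lemma finite_basis_coordinates:
  assumes "finite_basis sc E"
  defines "coord \<equiv> module.representation sc E"
  shows "(\<Sum>b\<in>E. sc (coord v b) b) = v"
    and "coord (u + v) b = coord u b + coord v b" and "coord (sc c v) b = c * coord v b"
    and "b \<in> E \<Longrightarrow> coord b b' = (if b' = b then 1 else 0)"
    and "coord (sum f I) b = (\<Sum>i\<in>I. coord (f i) b)"
proof -
  interpret vector_space sc using assms(1) by (simp add: finite_basis_def)
  have E: "independent E" "v \<in> span E" "finite E" for v using assms(1) by (simp_all add: finite_basis_def)
  show "(\<Sum>b\<in>E. sc (coord v b) b) = v" unfolding coord_def by (rule sum_representation_eq) (use E in auto)
  show add: "coord (u + v) b = coord u b + coord v b" for u v unfolding coord_def using E by (simp add: representation_add)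
  show "coord (sc c v) b = c * coord v b" unfolding coord_def using E by (simp add: representation_scale)
  show "b \<in> E \<Longrightarrow> coord b b' = (if b' = b then 1 else 0)" unfolding coord_def using E by (simp add: representation_basis)
  have "coord 0 b = 0" by (simp add: coord_def representation_zero)
  then show "coord (sum f I) b = (\<Sum>i\<in>I. coord (f i) b)"
    by (induction I rule: infinite_finite_induct) (simp_all add: add)
qed

lemma vcst_add: "vcst (a + b) = vcst a + vcst b" by (simp add: vcst_def single_add)
lemma vcst_mult: "vcst (a * b) = vcst a * vcst b" by (simp add: vcst_def mult_single)
lemma vcst_sum: "vcst (sum f I) = (\<Sum>i\<in>I. vcst (f i))"
  by (induction I rule: infinite_finite_induct) (simp_all add: vcst_add, simp_all add: vcst_def)

definition act_entry :: "('k::field, 'h::comm_ring_1) group_scheme \<Rightarrow> ('k, 'h, 'v::ab_group_add) gmodule \<Rightarrow> 'h \<Rightarrow> 'v \<Rightarrow> 'v \<Rightarrow> 'k" where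
  "act_entry G M e b' b = module.representation (mscl M) (mbas M) (act M (\<lambda>x. crd G x e) b) b'"

text \<open>
  The action on \<open>k[V(G)] \<otimes> M\<close> of the functional \<open>f \<mapsto> X f i\<close>, the coefficient of \<open>t^i\<close> in the universal
  one-parameter subgroup. The operator \<open>\<Theta>\<close> is the case \<open>i = p^(r-1)\<close>.
\<close>

definition coeff_matrix :: "('k::field, 'h::comm_ring_1) group_scheme \<Rightarrow> nat \<Rightarrow> ('k, 'h, 'v::ab_group_add) gmodule
     \<Rightarrow> nat \<Rightarrow> 'v \<Rightarrow> 'v \<Rightarrow> ('k, 'h) vpoly set set" where
  "coeff_matrix G r M i b' b = Vred_class G r (\<Sum>e\<in>bas G. vvar e i * vcst (act_entry G M e b' b))"

lemma Theta_eq_coeff_matrix: "Theta G r M = coeff_matrix G r M (CHAR('k) ^ (r - 1))"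
  for G :: "('k::field, 'h::comm_ring_1) group_scheme"
  by (intro ext) (simp add: Theta_def coeff_matrix_def act_entry_def)

context
  fixes G :: "('k::field, 'h::comm_ring_1) group_scheme" and M :: "('k, 'h, 'v::ab_group_add) gmodule"
  assumes G: "finite_group_scheme G" and M: "fd_module G M"
begin

lemma scheme_basis: "finite_basis (scl G) (bas G)" using G by (simp add: finite_group_scheme_def)
lemma module_basis: "finite_basis (mscl M) (mbas M)" using M by (simp add: fd_module_def)
lemma finite_scheme_basis: "finite (bas G)" using scheme_basis by (simp add: finite_basis_def)
lemma finite_module_basis: "finite (mbas M)" using module_basis by (simp add: finite_basis_def)

lemma crd_simps:
  "(\<Sum>e\<in>bas G. scl G (crd G f e) e) = f" "crd G (f + g) e = crd G f e + crd G g e"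
  "crd G (scl G c f) e = c * crd G f e" "a \<in> bas G \<Longrightarrow> crd G a e = (if e = a then 1 else 0)"
  using finite_basis_coordinates[OF scheme_basis] by (simp_all add: crd_def)

lemma dual_basis_in_group_algebra: "(\<lambda>x. crd G x e) \<in> group_algebra G"
proof -
  have "vector_space (scl G)" using scheme_basis by (simp add: finite_basis_def)
  moreover have "vector_space ((*) :: 'k \<Rightarrow> 'k \<Rightarrow> 'k)" by unfold_locales (auto simp: algebra_simps)
  ultimately show ?thesis by (simp add: group_algebra_def Vector_Spaces.linear_iff crd_simps)
qed

lemma group_algebra_sum:
  "finite I \<Longrightarrow> (\<lambda>f. \<Sum>i\<in>I. c i * crd G f i) \<in> group_algebra G"
proof -
  have "vector_space (scl G)" using scheme_basis by (simp add: finite_basis_def)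
  moreover have "vector_space ((*) :: 'k \<Rightarrow> 'k \<Rightarrow> 'k)" by unfold_locales (auto simp: algebra_simps)
  ultimately show ?thesis
    by (simp add: group_algebra_def Vector_Spaces.linear_iff crd_simps sum.distrib algebra_simps sum_distrib_left)
qed

lemma act_simps:
  assumes "l \<in> group_algebra G"
  shows "Vector_Spaces.linear (mscl M) (mscl M) (act M l)"
    and "act M (\<lambda>f. c * l f) x = mscl M c (act M l x)"
    and "m \<in> group_algebra G \<Longrightarrow> act M (\<lambda>f. l f + m f) x = act M l x + act M m x"
    and "m \<in> group_algebra G \<Longrightarrow> act M (conv G l m) x = act M l (act M m x)"
  using M assms unfolding fd_module_def by blast+

lemma act_sum:
  assumes "finite I"
  shows "act M (\<lambda>f. \<Sum>i\<in>I. c i * crd G f i) x = (\<Sum>i\<in>I. mscl M (c i) (act M (\<lambda>f. crd G f i) x))"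
  using assms
proof (induction I)
  case empty
  interpret vector_space "mscl M" using module_basis by (simp add: finite_basis_def)
  show ?case using act_simps(2)[OF dual_basis_in_group_algebra, of 0] by simp
next
  case (insert i I)
  have sc: "(\<lambda>f. c i * crd G f i) \<in> group_algebra G" using group_algebra_sum[of "{i}" c] by simp
  have "act M (\<lambda>f. \<Sum>j\<in>insert i I. c j * crd G f j) x = act M (\<lambda>f. c i * crd G f i + (\<Sum>j\<in>I. c j * crd G f j)) x"
    using insert by simp
  also have "\<dots> = act M (\<lambda>f. c i * crd G f i) x + act M (\<lambda>f. \<Sum>j\<in>I. c j * crd G f j) x"
    by (rule act_simps(3)[OF sc group_algebra_sum[OF insert.hyps(1), of c]])
  also have "act M (\<lambda>f. c i * crd G f i) x = mscl M (c i) (act M (\<lambda>f. crd G f i) x)"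
    by (rule act_simps(2)[OF dual_basis_in_group_algebra])
  finally show ?case using insert by simp
qed

lemma conv_dual_basis:
  assumes e: "e \<in> bas G" "e' \<in> bas G"
  shows "conv G (\<lambda>x. crd G x e) (\<lambda>x. crd G x e') = (\<lambda>f. \<Sum>g\<in>bas G. comul G g e e' * crd G f g)"
proof
  fix f
  have lin: "Vector_Spaces.linear (scl G) (*) (\<lambda>f. comul G f e e')" using G e by (simp add: finite_group_scheme_def)
  interpret lin: Vector_Spaces.linear "scl G" "(*)" "\<lambda>f. comul G f e e'" by (rule lin)
  have "conv G (\<lambda>x. crd G x e) (\<lambda>x. crd G x e') f = (\<Sum>a\<in>bas G. \<Sum>b\<in>bas G. if b = e' then (if a = e then comul G f a b else 0) else 0)"
    unfolding conv_def by (intro sum.cong refl) (auto simp: crd_simps)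
  also have "\<dots> = comul G f e e'" using e finite_scheme_basis by (simp add: sum.delta)
  also have "\<dots> = comul G (\<Sum>g\<in>bas G. scl G (crd G f g) g) e e'" by (simp add: crd_simps)
  also have "\<dots> = (\<Sum>g\<in>bas G. comul G g e e' * crd G f g)"
    by (simp add: lin.sum lin.scale mult.commute)
  finally show "conv G (\<lambda>x. crd G x e) (\<lambda>x. crd G x e') f = (\<Sum>g\<in>bas G. comul G g e e' * crd G f g)" .
qed

text \<open>
  The matrices of the dual basis multiply as in the group algebra, whose structure constants with respect to the dual basis
  are the coefficients of the comultiplication.
\<close>

lemma act_entry_mult:
  assumes e: "e \<in> bas G" "e' \<in> bas G"
  shows "(\<Sum>c\<in>mbas M. act_entry G M e b' c * act_entry G M e' c b) = (\<Sum>g\<in>bas G. comul G g e e' * act_entry G M g b' b)"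
proof -
  let ?l = "\<lambda>x. crd G x e" and ?m = "\<lambda>x. crd G x e'"
  let ?co = "module.representation (mscl M) (mbas M)"
  note co = finite_basis_coordinates[OF module_basis]
  interpret lin: Vector_Spaces.linear "mscl M" "mscl M" "act M ?l"
    by (rule act_simps(1)[OF dual_basis_in_group_algebra])
  have "(\<Sum>g\<in>bas G. comul G g e e' * act_entry G M g b' b) = ?co (\<Sum>g\<in>bas G. mscl M (comul G g e e') (act M (\<lambda>x. crd G x g) b)) b'"
    by (simp add: co act_entry_def)
  also have "\<dots> = ?co (act M (conv G ?l ?m) b) b'" by (simp add: conv_dual_basis[OF e] act_sum[OF finite_scheme_basis])
  also have "act M (conv G ?l ?m) b = act M ?l (act M ?m b)"
    by (rule act_simps(4)[OF dual_basis_in_group_algebra dual_basis_in_group_algebra])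
  also have "\<dots> = act M ?l (\<Sum>c\<in>mbas M. mscl M (?co (act M ?m b) c) c)" by (simp add: co(1))
  also have "\<dots> = (\<Sum>c\<in>mbas M. mscl M (?co (act M ?m b) c) (act M ?l c))" by (simp add: lin.sum lin.scale)
  also have "?co \<dots> b' = (\<Sum>c\<in>mbas M. act_entry G M e b' c * act_entry G M e' c b)"
    by (simp add: co act_entry_def mult.commute)
  finally show ?thesis ..
qed

text \<open>
  The functionals \<open>f \<mapsto> X f i\<close> multiply like divided powers, as one-parameter subgroups are compatible with
  comultiplication and \<open>t \<mapsto> s + t\<close> on the additive group.
\<close>

lemma coeff_matrix_mult:
  "(\<Oplus>\<^bsub>Vred G r\<^esub>c\<in>mbas M. coeff_matrix G r M i b' c \<otimes>\<^bsub>Vred G r\<^esub> coeff_matrix G r M j c b) =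
   Vred_class G r (of_nat ((i + j) choose i)) \<otimes>\<^bsub>Vred G r\<^esub> coeff_matrix G r M (i + j) b' b"
proof -
  let ?cl = "Vred_class G r" and ?\<rho> = "act_entry G M"
  interpret h: ring_hom_cring ring_of_type_algebra "Vred G r" ?cl by (rule Vred_class_hom)
  note hs = ring_hom_of_type_simps[OF Vred_class_hom[of G r]]
  define D where "D g = (\<Sum>e\<in>bas G. \<Sum>e'\<in>bas G. vcst (comul G g e e') * (vvar e i * vvar e' j) :: ('k, 'h) vpoly)" for g
  have "(\<Sum>c\<in>mbas M. (\<Sum>e\<in>bas G. vvar e i * vcst (?\<rho> e b' c)) * (\<Sum>e'\<in>bas G. vvar e' j * vcst (?\<rho> e' c b)))
    = (\<Sum>c\<in>mbas M. \<Sum>e\<in>bas G. \<Sum>e'\<in>bas G. vvar e i * vvar e' j * vcst (?\<rho> e b' c * ?\<rho> e' c b))"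
    by (simp add: sum_product vcst_mult mult_ac)
  also have "\<dots> = (\<Sum>e\<in>bas G. \<Sum>e'\<in>bas G. \<Sum>c\<in>mbas M. vvar e i * vvar e' j * vcst (?\<rho> e b' c * ?\<rho> e' c b))"
    by (subst sum.swap, intro sum.cong refl sum.swap)
  also have "\<dots> = (\<Sum>e\<in>bas G. \<Sum>e'\<in>bas G. \<Sum>g\<in>bas G. vvar e i * vvar e' j * vcst (comul G g e e' * ?\<rho> g b' b))"
    by (intro sum.cong refl) (simp add: act_entry_mult flip: sum_distrib_left vcst_sum)
  also have "\<dots> = (\<Sum>e\<in>bas G. \<Sum>g\<in>bas G. \<Sum>e'\<in>bas G. vvar e i * vvar e' j * vcst (comul G g e e' * ?\<rho> g b' b))"
    by (intro sum.cong refl sum.swap)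
  also have "\<dots> = (\<Sum>g\<in>bas G. \<Sum>e\<in>bas G. \<Sum>e'\<in>bas G. vvar e i * vvar e' j * vcst (comul G g e e' * ?\<rho> g b' b))"
    by (rule sum.swap)
  also have "\<dots> = (\<Sum>g\<in>bas G. D g * vcst (?\<rho> g b' b))"
    by (simp add: D_def sum_distrib_left sum_distrib_right vcst_mult mult_ac)
  finally have poly: "(\<Sum>c\<in>mbas M. (\<Sum>e\<in>bas G. vvar e i * vcst (?\<rho> e b' c)) * (\<Sum>e'\<in>bas G. vvar e' j * vcst (?\<rho> e' c b))) =
    (\<Sum>g\<in>bas G. D g * vcst (?\<rho> g b' b))" .
  have D: "?cl (D g) = ?cl (of_nat ((i + j) choose i) * vvar g (i + j))" for g
  proof -
    have "D g - of_nat ((i + j) choose i) * vvar g (i + j) \<in> relators G r vcst vvar"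
      unfolding relators_def Let_def D_def by blast
    then have "?cl (D g) \<ominus>\<^bsub>Vred G r\<^esub> ?cl (of_nat ((i + j) choose i) * vvar g (i + j)) = \<zero>\<^bsub>Vred G r\<^esub>"
      using Vred_class_relator by (simp flip: hs(7))
    then show ?thesis using hs(1) by simp
  qed
  have "(\<Oplus>\<^bsub>Vred G r\<^esub>c\<in>mbas M. coeff_matrix G r M i b' c \<otimes>\<^bsub>Vred G r\<^esub> coeff_matrix G r M j c b) =
    ?cl (\<Sum>g\<in>bas G. D g * vcst (?\<rho> g b' b))"
    unfolding poly[symmetric] coeff_matrix_def by (simp add: hs(8)[OF finite_module_basis] hs(3))
  also have "\<dots> = (\<Oplus>\<^bsub>Vred G r\<^esub>g\<in>bas G. ?cl (D g) \<otimes>\<^bsub>Vred G r\<^esub> ?cl (vcst (?\<rho> g b' b)))"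
    by (simp add: hs(8)[OF finite_scheme_basis] hs(3))
  also have "\<dots> = ?cl (\<Sum>g\<in>bas G. of_nat ((i + j) choose i) * vvar g (i + j) * vcst (?\<rho> g b' b))"
    by (simp add: D hs(8)[OF finite_scheme_basis] hs(3))
  also have "\<dots> = ?cl (of_nat ((i + j) choose i)) \<otimes>\<^bsub>Vred G r\<^esub> coeff_matrix G r M (i + j) b' b"
    unfolding coeff_matrix_def hs(3)[symmetric] by (simp add: sum_distrib_left mult.assoc)
  finally show ?thesis .
qed

lemma coeff_matrix_zero:
  assumes "i \<ge> CHAR('k) ^ r"
  shows "coeff_matrix G r M i b' b = \<zero>\<^bsub>Vred G r\<^esub>"
proof -
  interpret h: ring_hom_cring ring_of_type_algebra "Vred G r" "Vred_class G r" by (rule Vred_class_hom)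
  note hs = ring_hom_of_type_simps[OF Vred_class_hom[of G r]]
  have "Vred_class G r (vvar e i) = \<zero>\<^bsub>Vred G r\<^esub>" for e
    by (rule Vred_class_relator) (use assms in \<open>auto simp: relators_def Let_def\<close>)
  then show ?thesis unfolding coeff_matrix_def by (simp add: hs(8)[OF finite_scheme_basis] hs(3) hs(1))
qed

text \<open>
  With \<open>q = p^(r-1)\<close>, the \<open>n\<close>-th power of \<open>\<Theta>\<close> is a multiple of the coefficient matrix of index \<open>n q\<close>, which vanishes for
  \<open>n q \<ge> p^r\<close>. It suffices to evaluate on the unit vectors, which \<open>\<Theta>\<close> maps to the columns of its matrix.
\<close>

lemma Theta_nilpotent:
  assumes r: "r \<ge> 1" and p: "CHAR('k) > 0"
    and x: "x \<in> mbas M \<rightarrow>\<^sub>E carrier (Vred G r)"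
  shows "(mat_op (Vred G r) (mbas M) (Theta G r M) ^^ CHAR('k)) x = (\<lambda>b\<in>mbas M. \<zero>\<^bsub>Vred G r\<^esub>)"
proof -
  let ?A = "Vred G r" and ?B = "mbas M" and ?p = "CHAR('k)"
  define q where "q = ?p ^ (r - 1)"
  let ?W = "coeff_matrix G r M"
  let ?N = "mat_op ?A ?B (?W q)"
  interpret h: ring_hom_cring ring_of_type_algebra ?A "Vred_class G r" by (rule Vred_class_hom)
  note hs = ring_hom_of_type_simps[OF Vred_class_hom[of G r]]
  have Wc: "?W i b' b \<in> carrier ?A" for i b' b using hs(1) by (simp add: coeff_matrix_def)
  have pq: "?p * q = ?p ^ r" using r by (simp add: q_def power_eq_if)
  have iter: "\<exists>d\<in>carrier ?A. (?N ^^ n) (\<lambda>b'\<in>?B. ?W i b' b) = (\<lambda>b'\<in>?B. d \<otimes>\<^bsub>?A\<^esub> ?W (n * q + i) b' b)" for n i b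
  proof (induction n)
    case 0
    have "(\<lambda>b'\<in>?B. ?W i b' b) = (\<lambda>b'\<in>?B. \<one>\<^bsub>?A\<^esub> \<otimes>\<^bsub>?A\<^esub> ?W i b' b)" using Wc by simp
    then show ?case by (intro bexI[of _ "\<one>\<^bsub>?A\<^esub>"]) simp_all
  next
    case (Suc n)
    then obtain d where d: "d \<in> carrier ?A" "(?N ^^ n) (\<lambda>b'\<in>?B. ?W i b' b) = (\<lambda>b'\<in>?B. d \<otimes>\<^bsub>?A\<^esub> ?W (n * q + i) b' b)" by blast
    let ?j = "n * q + i" and ?w = "\<lambda>b'\<in>?B. ?W (n * q + i) b' b"
    define e where "e = Vred_class G r (of_nat ((q + ?j) choose q))"
    have e: "e \<in> carrier ?A" unfolding e_def by (rule hs(1))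
    have w: "?w \<in> ?B \<rightarrow>\<^sub>E carrier ?A" using Wc by auto
    have "?N ?w = (\<lambda>b'\<in>?B. \<Oplus>\<^bsub>?A\<^esub>c\<in>?B. ?W q b' c \<otimes>\<^bsub>?A\<^esub> ?W ?j c b)"
      unfolding mat_op_def using Wc by (intro restrict_ext h.S.finsum_cong') auto
    also have "\<dots> = (\<lambda>b'\<in>?B. e \<otimes>\<^bsub>?A\<^esub> ?W (q + ?j) b' b)" unfolding coeff_matrix_mult e_def ..
    finally have Nw: "?N ?w = (\<lambda>b'\<in>?B. e \<otimes>\<^bsub>?A\<^esub> ?W (q + ?j) b' b)" .
    have "(?N ^^ Suc n) (\<lambda>b'\<in>?B. ?W i b' b) = ?N (\<lambda>b'\<in>?B. d \<otimes>\<^bsub>?A\<^esub> ?w b')"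
      unfolding funpow.simps comp_apply d(2) by (rule arg_cong[of _ _ ?N], rule restrict_ext) simp
    also have "\<dots> = (\<lambda>b'\<in>?B. d \<otimes>\<^bsub>?A\<^esub> ?N ?w b')"
      by (rule h.S.mat_op_smult[of ?B "?W q", OF Wc finite_module_basis w d(1)])
    also have "\<dots> = (\<lambda>b'\<in>?B. (d \<otimes>\<^bsub>?A\<^esub> e) \<otimes>\<^bsub>?A\<^esub> ?W (Suc n * q + i) b' b)"
      unfolding Nw using d e Wc by (intro restrict_ext) (simp add: h.S.m_assoc add.assoc)
    finally show ?case using d e by blast
  qed
  define E where "E b = (\<lambda>c\<in>?B. if b = c then \<one>\<^bsub>?A\<^esub> else \<zero>\<^bsub>?A\<^esub>)" for b
  have E: "E b \<in> ?B \<rightarrow>\<^sub>E carrier ?A" for b by (auto simp: E_def)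
  have xb: "x b \<in> carrier ?A" if "b \<in> ?B" for b using x that by (auto simp: PiE_iff)
  have NE: "?N (E b) = (\<lambda>b'\<in>?B. ?W q b' b)" if b: "b \<in> ?B" for b
    unfolding mat_op_def
  proof (rule restrict_ext)
    fix b'
    have "(\<Oplus>\<^bsub>?A\<^esub>c\<in>?B. ?W q b' c \<otimes>\<^bsub>?A\<^esub> E b c) = (\<Oplus>\<^bsub>?A\<^esub>c\<in>?B. if b = c then ?W q b' c else \<zero>\<^bsub>?A\<^esub>)"
      using Wc by (intro h.S.finsum_cong') (auto simp: E_def)
    then show "(\<Oplus>\<^bsub>?A\<^esub>c\<in>?B. ?W q b' c \<otimes>\<^bsub>?A\<^esub> E b c) = ?W q b' b"
      using h.S.finsum_singleton[OF b finite_module_basis, of "\<lambda>c. ?W q b' c"] Wc by auto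
  qed
  have NpE: "(?N ^^ ?p) (E b) = (\<lambda>b'\<in>?B. \<zero>\<^bsub>?A\<^esub>)" if b: "b \<in> ?B" for b
  proof -
    obtain d where d: "d \<in> carrier ?A" "(?N ^^ (?p - 1)) (\<lambda>b'\<in>?B. ?W q b' b) = (\<lambda>b'\<in>?B. d \<otimes>\<^bsub>?A\<^esub> ?W ((?p - 1) * q + q) b' b)"
      using iter by blast
    have "(?p - 1) * q + q = ?p ^ r" using p pq by (cases ?p) auto
    then have W0: "?W ((?p - 1) * q + q) b' b = \<zero>\<^bsub>?A\<^esub>" for b' by (intro coeff_matrix_zero) simp
    have "?p = Suc (?p - 1)" using p by simp
    then have "(?N ^^ ?p) (E b) = (?N ^^ Suc (?p - 1)) (E b)" by simp
    also have "\<dots> = (?N ^^ (?p - 1)) (?N (E b))" by (simp only: funpow_Suc_right comp_apply)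
    also have "\<dots> = (\<lambda>b'\<in>?B. \<zero>\<^bsub>?A\<^esub>)" unfolding NE[OF b] d(2) W0 using d(1) by (intro restrict_ext) simp
    finally show ?thesis .
  qed
  have "x = (\<lambda>c\<in>?B. \<Oplus>\<^bsub>?A\<^esub>b\<in>?B. x b \<otimes>\<^bsub>?A\<^esub> E b c)"
  proof (rule extensionalityI[of _ ?B])
    fix c assume c: "c \<in> ?B"
    have "(\<Oplus>\<^bsub>?A\<^esub>b\<in>?B. x b \<otimes>\<^bsub>?A\<^esub> E b c) = (\<Oplus>\<^bsub>?A\<^esub>b\<in>?B. if c = b then x b else \<zero>\<^bsub>?A\<^esub>)"
      using xb c by (intro h.S.finsum_cong') (auto simp: E_def)
    also have "\<dots> = x c" using h.S.finsum_singleton[OF c finite_module_basis, of x] xb by auto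
    finally show "x c = (\<lambda>c\<in>?B. \<Oplus>\<^bsub>?A\<^esub>b\<in>?B. x b \<otimes>\<^bsub>?A\<^esub> E b c) c" using c by simp
  qed (use x in \<open>auto simp: PiE_iff\<close>)
  then have "(?N ^^ ?p) x = (?N ^^ ?p) (\<lambda>c\<in>?B. \<Oplus>\<^bsub>?A\<^esub>b\<in>?B. x b \<otimes>\<^bsub>?A\<^esub> E b c)" by (rule arg_cong)
  also have "\<dots> = (\<lambda>c\<in>?B. \<Oplus>\<^bsub>?A\<^esub>b\<in>?B. x b \<otimes>\<^bsub>?A\<^esub> (?N ^^ ?p) (E b) c)"
    by (rule h.S.mat_op_finsum[of ?B "?W q" ?B x E, OF Wc finite_module_basis finite_module_basis xb E])
  also have "\<dots> = (\<lambda>c\<in>?B. \<zero>\<^bsub>?A\<^esub>)"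
  proof (rule restrict_ext)
    fix c assume c: "c \<in> ?B"
    have "(\<Oplus>\<^bsub>?A\<^esub>b\<in>?B. x b \<otimes>\<^bsub>?A\<^esub> (?N ^^ ?p) (E b) c) = (\<Oplus>\<^bsub>?A\<^esub>b\<in>?B. \<zero>\<^bsub>?A\<^esub>)"
      using xb c by (intro h.S.finsum_cong') (auto simp: NpE)
    then show "(\<Oplus>\<^bsub>?A\<^esub>b\<in>?B. x b \<otimes>\<^bsub>?A\<^esub> (?N ^^ ?p) (E b) c) = \<zero>\<^bsub>?A\<^esub>" by simp
  qed
  finally show ?thesis unfolding Theta_eq_coeff_matrix q_def .
qed

end

lemma Theta_homogeneous: "Theta G r M b' b \<in> Vred_gr G r (CHAR('k) ^ (r - 1))"
  for G :: "('k::field, 'h::comm_ring_1) group_scheme"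
proof -
  have "(\<Sum>e\<in>bas G. vvar e (CHAR('k) ^ (r - 1)) * vcst (act_entry G M e b' b)) \<in> whomog (CHAR('k) ^ (r - 1))"
  proof (rule whomog_sum)
    fix e
    show "vvar e (CHAR('k) ^ (r - 1)) * vcst (act_entry G M e b' b) \<in> whomog (CHAR('k) ^ (r - 1))"
      using whomog_mult[OF whomog_vvar[of e "CHAR('k) ^ (r - 1)"] whomog_vcst[of "act_entry G M e b' b"]] by simp
  qed
  then show ?thesis unfolding Theta_eq_coeff_matrix coeff_matrix_def Vred_gr_def by (rule imageI)
qed

section \<open>The support on the regular locus\<close>

theorem theorem4p8:
  fixes G :: "('k::alg_closed_field, 'h::comm_ring_1) group_scheme"
    and M :: "('k, 'h, 'v::ab_group_add) gmodule"
    and r :: nat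
  assumes "CHAR('k) > 0" and "r \<ge> 1"
    and "infinitesimal G r"
    and "fd_module G M"
  shows "PG_support G r M \<inter> RegPG G r \<subseteq> H1_supp G r M"
proof (rule subsetI, rule ccontr)
  fix v assume v: "v \<in> PG_support G r M \<inter> RegPG G r" and neg: "v \<notin> H1_supp G r M"
  let ?A = "Vred G r" and ?gr = "Vred_gr G r" and ?p = "CHAR('k)" and ?m = "CHAR('k) ^ (r - 1)"
  have G: "finite_group_scheme G" using assms(3) by (simp add: infinitesimal_def)
  interpret graded_cring ?A ?gr by (rule Vred_graded)
  have vP: "v \<in> proj ?A ?gr" and reg: "regular_local_ring (stalk_ring ?A ?gr v)"
    using v by (auto simp: RegPG_def PG_def)
  obtain s ls l where s: "s \<in> ?gr ?m" "s \<notin> v"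
    and jb: "jordan_blocks (residue_field (stalk_ring ?A ?gr v)) (mbas M) (local_op G r M v s) ls"
    and l: "l \<in> set ls" "l \<noteq> ?p"
    using v by (auto simp: PG_support_def)
  have "l = ?p"
  proof (rule uniform_jordan_blocks_at_point[OF vP finite_module_basis[OF G assms(4)] Theta_homogeneous s _ _ reg])
    show "?p \<ge> 1" using assms(1) by simp
    show "(mat_op ?A (mbas M) (Theta G r M) ^^ ?p) x = (\<lambda>b\<in>mbas M. \<zero>\<^bsub>?A\<^esub>)"
      if "x \<in> mbas M \<rightarrow>\<^sub>E carrier ?A" for x
      by (rule Theta_nilpotent[OF G assms(4,2,1) that])
    show "v \<notin> quot_supp ?A ?gr (mbas M) (ker_sec ?A ?gr (mbas M) (Theta G r M))
      (im_sec ?A ?gr (mbas M) (Theta G r M) ?m (?p - 1))"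
      using neg by (simp add: H1_supp_def Let_def)
    show "jordan_blocks (residue_field (stalk_ring ?A ?gr v)) (mbas M)
      (mat_op (residue_field (stalk_ring ?A ?gr v)) (mbas M)
        (\<lambda>b' b. nonunits (stalk_ring ?A ?gr v) +>\<^bsub>stalk_ring ?A ?gr v\<^esub> hfrac ?A ?gr v (Theta G r M b' b) s)) ls"
      using jb by (simp add: local_op_def Let_def)
  qed (rule l)
  then show False using l by simp
qed

end
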